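(* Suppose $\mathbf X$ and $Y$ are independent, and that the following three conditions hold, where $\mathbf X_1,\mathbf X_2,\mathbf X_3,\mathbf X_4$ are i.i.d. copies of $\mathbf X$ and $d$ is the double centered distance: (1) $\mathbb E\|\mathbf X\|^4<\infty$; (2) $\dfrac{\mathbb E\, d^4(\mathbf X_1,\mathbf X_2)}{n\,(\mathbb E\, d^2(\mathbf X_1,\mathbf X_2))^2}\to 0$; (3) $\dfrac{\mathbb E[d(\mathbf X_1,\mathbf X_3)d(\mathbf X_2,\mathbf X_3)d(\mathbf X_1,\mathbf X_4)d(\mathbf X_2,\mathbf X_4)]}{(\mathbb E\, d^2(\mathbf X_1,\mathbf X_2))^2}\to 0$. Then, as $\min\{n_1,\dots,n_K\}\to\infty$ and $p\to\infty$, $$\frac{\hat\Delta}{\hat\sigma_0}\,\mathrm{gCor}_n(\mathbf X,Y)\stackrel{d}{\longrightarrow}\mathcal N(0,1).$$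
   Context: $\|\cdot\|$ is the Euclidean norm. $\mathbf X$ is an $\mathbb R^p$-valued random vector with distribution $F$; $Y$ is a categorical variable with values $L_1,\dots,L_K$ ($K$ fixed) and $P(Y=L_k)=p_k>0$; the conditional distribution of $\mathbf X$ given $Y=L_k$ is $F_k$ (under independence $F_1=\dots=F_K=F$). One observes an i.i.d. sample $(\mathbf X_1,Y_1),\dots,(\mathbf X_n,Y_n)$ from the joint distribution of $(\mathbf X,Y)$; $n_k$ is the number of observations with $Y_i=L_k$, these observations are denoted $\mathbf X^{(k)}_1,\dots,\mathbf X^{(k)}_{n_k}$, and $\hat p_k=n_k/n$. The asymptotics are along a sequence in which the sample size $n$ and the dimension $p=p(n)$ both diverge in an arbitrary fashion (the distribution of $\mathbf X$ may change with $p$); all limits are along this sequence. Put $\hat\Delta=U_n=\binom n2^{-1}\sum_{1\le i<j\le n}\|\mathbf X_i-\mathbf X_j\|$ and $U_{n_k}=\binom{n_k}2^{-1}\sum_{1\le i<j\le n_k}\|\mathbf X^{(k)}_i-\mathbf X^{(k)}_j\|$. The sample Gini covariance is $\mathrm{gCov}_n(\mathbf X,Y)=U_n-\sum_{k=1}^K\hat p_kU_{n_k}$ and the sample Gini correlation is $\mathrm{gCor}_n(\mathbf X,Y)=\mathrm{gCov}_n(\mathbf X,Y)/\hat\Delta$. The double centered distance is, for $\mathbf X_1,\mathbf X_2$ i.i.d. from $F$, $d(\mathbf X_1,\mathbf X_2)=\|\mathbf X_1-\mathbf X_2\|-\mathbb E(\|\mathbf X_1-\mathbf X_2\|\mid\mathbf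 X_1)-\mathbb E(\|\mathbf X_1-\mathbf X_2\|\mid\mathbf X_2)+\mathbb E\|\mathbf X_1-\mathbf X_2\|$. The variance estimator is $\hat\sigma_0^2=\Big(\sum_{k=1}^K\hat p_k^2\binom{n_k}2^{-1}-\binom n2^{-1}\Big)V_n^2(\mathbf X)$, where $V_n^2(\mathbf X)=\frac1{n(n-3)}\sum_{1\le k\ne l\le n}A_{k,l}^2$ and $A_{k,l}=\|\mathbf X_k-\mathbf X_l\|-\frac1{n-2}\sum_{i=1}^n\|\mathbf X_i-\mathbf X_l\|-\frac1{n-2}\sum_{j=1}^n\|\mathbf X_k-\mathbf X_j\|+\frac1{(n-1)(n-2)}\sum_{1\le i,j\le n}\|\mathbf X_i-\mathbf X_j\|$. *)

theory Defs
  imports "HOL-Probability.Probability"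
begin

text \<open>
  The dimension varies along the asymptotic sequence, so \<open>\<real>\<^sup>p\<close> cannot be a fixed type. Its points are
  the functions \<open>nat \<Rightarrow> real\<close> that are extensional on \<open>{..<p}\<close>, i.e. the space of \<open>euclid p\<close>, whose
  sigma-algebra is the Borel one.
\<close>

definition euclid :: "nat \<Rightarrow> (nat \<Rightarrow> real) measure" where
  "euclid p = Pi\<^sub>M {..<p} (\<lambda>_. borel)"

definition enorm :: "nat \<Rightarrow> (nat \<Rightarrow> real) \<Rightarrow> real" where
  "enorm p x = L2_set x {..<p}"

definition edist :: "nat \<Rightarrow> (nat \<Rightarrow> real) \<Rightarrow> (nat \<Rightarrow> real) \<Rightarrow> real" where
  "edist p x y = enorm p (\<lambda>i. x i - y i)"


text \<open>
  Double centered distance for the law \<open>F\<close>. As \<open>X\<^sub>1\<close>, \<open>X\<^sub>2\<close> are independent with law \<open>F\<close>, the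
  conditional expectation of \<open>\<parallel>X\<^sub>1 - X\<^sub>2\<parallel>\<close> given \<open>X\<^sub>1 = x\<close> is the integral of \<open>\<parallel>x - z\<parallel>\<close> over \<open>z\<close>
  with respect to \<open>F\<close>. This version makes \<open>d\<close> a function on \<open>\<real>\<^sup>p \<times> \<real>\<^sup>p\<close>.
\<close>

definition dcdist :: "nat \<Rightarrow> (nat \<Rightarrow> real) measure \<Rightarrow> (nat \<Rightarrow> real) \<Rightarrow> (nat \<Rightarrow> real) \<Rightarrow> real" where
  "dcdist p F x y = edist p x y - (LINT z|F. edist p x z) - (LINT z|F. edist p z y)
     + (LINT w|(F \<Otimes>\<^sub>M F). edist p (fst w) (snd w))"

text \<open>The joint law of i.i.d. \<open>X\<^sub>1, X\<^sub>2, X\<^sub>3, X\<^sub>4\<close> with common law \<open>F\<close>.\<close>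

definition iid4 :: "(nat \<Rightarrow> real) measure \<Rightarrow> (nat \<Rightarrow> nat \<Rightarrow> real) measure" where
  "iid4 F = Pi\<^sub>M {1..4} (\<lambda>_. F)"

definition d_moment :: "nat \<Rightarrow> (nat \<Rightarrow> real) measure \<Rightarrow> nat \<Rightarrow> real" where
  "d_moment p F r = (LINT x|iid4 F. dcdist p F (x 1) (x 2) ^ r)"

definition d_cycle :: "nat \<Rightarrow> (nat \<Rightarrow> real) measure \<Rightarrow> real" where
  "d_cycle p F = (LINT x|iid4 F. dcdist p F (x 1) (x 3) * dcdist p F (x 2) (x 3)
     * dcdist p F (x 1) (x 4) * dcdist p F (x 2) (x 4))"


text \<open>
  Sample statistics. A sample of size \<open>n\<close> is given by \<open>x\<close> and \<open>y\<close> at the indices \<open>1, \<dots>, n\<close>. The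
  subsample with label \<open>l\<close> keeps its original indices, which does not change \<open>U\<^bsub>n\<^sub>k\<^esub>\<close> because the kernel
  is symmetric. When a class has fewer than two observations, \<open>U\<^bsub>n\<^sub>k\<^esub>\<close> is \<open>0\<close> (division by zero).
\<close>

definition class_idx :: "nat \<Rightarrow> (nat \<Rightarrow> 'l) \<Rightarrow> 'l \<Rightarrow> nat set" where
  "class_idx n y l = {i \<in> {1..n}. y i = l}"

definition class_size :: "nat \<Rightarrow> (nat \<Rightarrow> 'l) \<Rightarrow> 'l \<Rightarrow> nat" where
  "class_size n y l = card (class_idx n y l)"

definition phat :: "nat \<Rightarrow> (nat \<Rightarrow> 'l) \<Rightarrow> 'l \<Rightarrow> real" where
  "phat n y l = real (class_size n y l) / real n"

definition U_stat :: "nat \<Rightarrow> nat set \<Rightarrow> (nat \<Rightarrow> nat \<Rightarrow> real) \<Rightarrow> real" where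
  "U_stat p I x = (\<Sum>(i, j) \<in> {(i, j). i \<in> I \<and> j \<in> I \<and> i < j}. edist p (x i) (x j))
     / real (card I choose 2)"

definition Delta_hat :: "nat \<Rightarrow> nat \<Rightarrow> (nat \<Rightarrow> nat \<Rightarrow> real) \<Rightarrow> real" where
  "Delta_hat p n x = U_stat p {1..n} x"

definition gCov :: "nat \<Rightarrow> nat \<Rightarrow> (nat \<Rightarrow> 'l) \<Rightarrow> nat \<Rightarrow> (nat \<Rightarrow> nat \<Rightarrow> real) \<Rightarrow> (nat \<Rightarrow> 'l) \<Rightarrow> real" where
  "gCov K p L n x y =
     U_stat p {1..n} x - (\<Sum>k=1..K. phat n y (L k) * U_stat p (class_idx n y (L k)) x)"

definition gCor :: "nat \<Rightarrow> nat \<Rightarrow> (nat \<Rightarrow> 'l) \<Rightarrow> nat \<Rightarrow> (nat \<Rightarrow> nat \<Rightarrow> real) \<Rightarrow> (nat \<Rightarrow> 'l) \<Rightarrow> real" where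
  "gCor K p L n x y = gCov K p L n x y / Delta_hat p n x"

definition A_centered :: "nat \<Rightarrow> nat \<Rightarrow> (nat \<Rightarrow> nat \<Rightarrow> real) \<Rightarrow> nat \<Rightarrow> nat \<Rightarrow> real" where
  "A_centered p n x k l =
     edist p (x k) (x l)
     - (\<Sum>i=1..n. edist p (x i) (x l)) / (real n - 2)
     - (\<Sum>j=1..n. edist p (x k) (x j)) / (real n - 2)
     + (\<Sum>i=1..n. \<Sum>j=1..n. edist p (x i) (x j)) / ((real n - 1) * (real n - 2))"

definition V2 :: "nat \<Rightarrow> nat \<Rightarrow> (nat \<Rightarrow> nat \<Rightarrow> real) \<Rightarrow> real" where
  "V2 p n x = (\<Sum>(k, l) \<in> {(k, l). k \<in> {1..n} \<and> l \<in> {1..n} \<and> k \<noteq> l}. (A_centered p n x k l)\<^sup>2)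
     / (real n * (real n - 3))"

definition sigma0_sq_hat ::
  "nat \<Rightarrow> nat \<Rightarrow> (nat \<Rightarrow> 'l) \<Rightarrow> nat \<Rightarrow> (nat \<Rightarrow> nat \<Rightarrow> real) \<Rightarrow> (nat \<Rightarrow> 'l) \<Rightarrow> real" where
  "sigma0_sq_hat K p L n x y =
     ((\<Sum>k=1..K. (phat n y (L k))\<^sup>2 / real (class_size n y (L k) choose 2)) - 1 / real (n choose 2))
     * V2 p n x"

definition sigma0_hat ::
  "nat \<Rightarrow> nat \<Rightarrow> (nat \<Rightarrow> 'l) \<Rightarrow> nat \<Rightarrow> (nat \<Rightarrow> nat \<Rightarrow> real) \<Rightarrow> (nat \<Rightarrow> 'l) \<Rightarrow> real" where
  "sigma0_hat K p L n x y = sqrt (sigma0_sq_hat K p L n x y)"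


text \<open>
  Independence of two random variables with different value types. The library's \<open>indep_var\<close> requires
  equal value types; there this formula is its characterization \<open>indep_var_eq\<close>.
\<close>

definition indep_rvs ::
  "'a measure \<Rightarrow> 'b measure \<Rightarrow> ('a \<Rightarrow> 'b) \<Rightarrow> 'c measure \<Rightarrow> ('a \<Rightarrow> 'c) \<Rightarrow> bool" where
  "indep_rvs M S X T Y \<longleftrightarrow> X \<in> M \<rightarrow>\<^sub>M S \<and> Y \<in> M \<rightarrow>\<^sub>M T \<and>
     prob_space.indep_set M
       (sigma_sets (space M) {X -` A \<inter> space M |A. A \<in> sets S})
       (sigma_sets (space M) {Y -` B \<inter> space M |B. B \<in> sets T})"

text \<open>
  On the probability space \<open>M\<close>, the pairs \<open>(Xs i, Ys i)\<close>, \<open>1 \<le> i \<le> n\<close>, are an i.i.d. sample from the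
  joint distribution of \<open>(X, Y)\<close>, where \<open>X\<close> is \<open>\<real>\<^sup>p\<close>-valued and \<open>Y\<close> takes values in the label set
  \<open>\<L>\<close>. The pair \<open>(X, Y)\<close> only serves to name that distribution; nothing is said about its joint
  behaviour with the sample.
\<close>

definition iid_sample ::
  "'a measure \<Rightarrow> nat \<Rightarrow> 'l set \<Rightarrow> nat \<Rightarrow> ('a \<Rightarrow> nat \<Rightarrow> real) \<Rightarrow> ('a \<Rightarrow> 'l)
     \<Rightarrow> (nat \<Rightarrow> 'a \<Rightarrow> nat \<Rightarrow> real) \<Rightarrow> (nat \<Rightarrow> 'a \<Rightarrow> 'l) \<Rightarrow> bool" where
  "iid_sample M p \<L> n X Y Xs Ys \<longleftrightarrow>
     prob_space.indep_vars M (\<lambda>_. euclid p \<Otimes>\<^sub>M count_space \<L>) (\<lambda>i \<omega>. (Xs i \<omega>, Ys i \<omega>)) {1..n} \<and>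
     (\<forall>i\<in>{1..n}. distr M (euclid p \<Otimes>\<^sub>M count_space \<L>) (\<lambda>\<omega>. (Xs i \<omega>, Ys i \<omega>))
                = distr M (euclid p \<Otimes>\<^sub>M count_space \<L>) (\<lambda>\<omega>. (X \<omega>, Y \<omega>)))"

end

theory Submission
  imports Defs
begin

text \<open>
  Let \<open>d\<close> be the double centered distance. It differs from \<open>\<parallel>x - y\<parallel>\<close> by an additive term:
  \<open>\<parallel>x - y\<parallel> = d x y + u x + u y\<close>. In \<open>U\<^sub>n - \<Sum>\<^sub>k (n\<^sub>k / n) U\<^bsub>n\<^sub>k\<^esub>\<close> the terms \<open>u\<close> cancel exactly once
  every class has two elements, so the sample Gini covariance is \<open>\<Sum>\<^bsub>i<j\<^esub> w\<^sub>i\<^sub>j d(X\<^sub>i, X\<^sub>j)\<close> with weights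
  depending on the labels alone (\<open>gCov_eq_weighted_sum\<close>), and \<open>\<Sum>\<^bsub>i<j\<^esub> w\<^sub>i\<^sub>j\<^sup>2\<close> is the label-dependent factor
  of the variance estimator (\<open>weight_square_sum\<close>). The entries \<open>A\<^sub>k\<^sub>l\<close> are unchanged as well when \<open>\<parallel>x - y\<parallel>\<close>
  is replaced by \<open>d\<close> (\<open>A_centered_eq\<close>).

  By independence, conditioning on the labels leaves the observations i.i.d. with law \<open>F\<close> and turns the
  weights into constants (\<open>conditional_law\<close>). Chebyshev's inequality makes every class size at least a
  fixed fraction of \<open>n\<close> with probability tending to one (\<open>small_class_prob\<close>), and then all standardized
  weights are \<open>O(1/n)\<close>. For such labels the statistic is \<open>W \<surd>(E d\<^sup>2 / V\<^sub>n\<^sup>2)\<close>, where \<open>W\<close> is a weighted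
  degenerate U-statistic of variance one.

  The central limit theorem for \<open>W\<close> (\<open>cf_bound\<close>) adds the observations one at a time. If \<open>D\<^sub>j\<close> is the
  increment brought by \<open>X\<^sub>j\<close> and \<open>v\<^sub>j = E D\<^sub>j\<^sup>2\<close>, integrating \<open>X\<^sub>j\<close> out first gives
  \<open>|E e\<^bsup>itS\<^sub>j\<^esup> - e\<^bsup>-t\<^sup>2v\<^sub>j/2\<^esup> E e\<^bsup>itS\<^bsub>j-1\<^esub>\<^esup>| \<le> (t\<^sup>2/2) E|E[D\<^sub>j\<^sup>2 | X\<^sub>1, \<dots>, X\<^bsub>j-1\<^esub>] - v\<^sub>j| + (|t|\<^sup>3/6) E|D\<^sub>j|\<^sup>3 + (t\<^sup>2v\<^sub>j/2)\<^sup>2\<close>,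
  and these errors telescope. With weights \<open>O(1/n)\<close> each of the \<open>n\<close> errors is \<open>o(1/n)\<close>: the first because
  the conditional variance is a weighted sum of the values \<open>G X\<^sub>i X\<^sub>i\<close> plus a degenerate U-statistic with
  kernel \<open>G x y = E d(x, Z) d(y, Z)\<close>, and these are controlled by the assumptions on the fourth moment of \<open>d\<close>
  and on the cycle moment, which equals \<open>E G\<^sup>2\<close>; the second by the fourth moment again.

  Consistency of \<open>V\<^sub>n\<^sup>2\<close> (\<open>vstat_deviation\<close>) follows from writing it as the average of \<open>d(X\<^sub>k, X\<^sub>l)\<^sup>2\<close> up
  to row-sum and total-sum corrections of relative size \<open>1/n\<close>. The two results combine in
  \<open>studentized_cf_bound\<close>, averaging over the labels gives \<open>gini_cf_bound\<close>, and Levy's continuity theorem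
  concludes.
\<close>

section \<open>Finite moments and i.i.d. product spaces\<close>

declare One_nat_def [simp del]

lemmas lebesgue_integral_cong = Bochner_Integration.integral_cong

text \<open>
  Integrability of products and sums is needed at every step below. Bundling measurability with a finite
  absolute moment gives a notion closed under these operations, so that all such obligations are discharged
  by the rules that follow.
\<close>

definition has_moment :: "'b measure \<Rightarrow> nat \<Rightarrow> ('b \<Rightarrow> real) \<Rightarrow> bool" where
  "has_moment M k f \<longleftrightarrow> f \<in> borel_measurable M \<and> integrable M (\<lambda>x. \<bar>f x\<bar> ^ k)"

lemma has_moment_1: "has_moment M 1 f \<longleftrightarrow> integrable M f"
  unfolding has_moment_def by (auto dest: integrable_abs simp: integrable_abs_iff)

lemma has_moment_bound:
  assumes "integrable M g" "f \<in> borel_measurable M" "\<And>x. x \<in> space M \<Longrightarrow> \<bar>f x\<bar> ^ k \<le> g x"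
  shows "has_moment M k f"
  unfolding has_moment_def
proof
  show "integrable M (\<lambda>x. \<bar>f x\<bar> ^ k)"
    by (rule Bochner_Integration.integrable_bound[OF assms(1)])
       (use assms(2,3) in \<open>auto intro!: AE_I2 intro: order_trans[OF _ abs_ge_self]\<close>)
qed fact

lemma power_add_le: "\<bar>a + b\<bar> ^ k \<le> 2 ^ k * (\<bar>a\<bar> ^ k + \<bar>b\<bar> ^ k)" for a b :: real
proof -
  have "\<bar>a + b\<bar> ^ k \<le> (2 * max \<bar>a\<bar> \<bar>b\<bar>) ^ k"
    by (rule power_mono) auto
  also have "\<dots> = 2 ^ k * max \<bar>a\<bar> \<bar>b\<bar> ^ k" by (simp add: power_mult_distrib)
  also have "max \<bar>a\<bar> \<bar>b\<bar> ^ k \<le> \<bar>a\<bar> ^ k + \<bar>b\<bar> ^ k"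
    by (cases "\<bar>a\<bar> \<le> \<bar>b\<bar>") (auto simp: max_def)
  finally show ?thesis by simp
qed

lemma has_moment_add:
  assumes "has_moment M k f" "has_moment M k g"
  shows "has_moment M k (\<lambda>x. f x + g x)"
  by (rule has_moment_bound[of _ "\<lambda>x. 2 ^ k * (\<bar>f x\<bar> ^ k + \<bar>g x\<bar> ^ k)"])
     (use assms power_add_le in \<open>auto simp: has_moment_def\<close>)

lemma has_moment_cmult: "has_moment M k f \<Longrightarrow> has_moment M k (\<lambda>x. c * f x)"
  by (auto simp: has_moment_def abs_mult power_mult_distrib)

lemma has_moment_diff:
  "has_moment M k f \<Longrightarrow> has_moment M k g \<Longrightarrow> has_moment M k (\<lambda>x. f x - g x)"
  using has_moment_add[of M k f "\<lambda>x. -1 * g x"] has_moment_cmult[of M k g "-1"] by simp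

lemma (in prob_space) has_moment_const: "has_moment M k (\<lambda>_. c)"
  by (simp add: has_moment_def)

lemma (in prob_space) has_moment_sum:
  "(\<And>i. i \<in> I \<Longrightarrow> has_moment M k (f i)) \<Longrightarrow> has_moment M k (\<lambda>x. \<Sum>i\<in>I. f i x)"
  by (induction I rule: infinite_finite_induct) (auto intro: has_moment_add has_moment_const)

lemma has_moment_mult:
  assumes "has_moment M (2 * k) f" "has_moment M (2 * k) g"
  shows "has_moment M k (\<lambda>x. f x * g x)"
proof (rule has_moment_bound)
  show "integrable M (\<lambda>x. \<bar>f x\<bar> ^ (2 * k) + \<bar>g x\<bar> ^ (2 * k))"
    using assms by (auto simp: has_moment_def)
  show "\<bar>f x * g x\<bar> ^ k \<le> \<bar>f x\<bar> ^ (2 * k) + \<bar>g x\<bar> ^ (2 * k)" for x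
  proof -
    have "2 * (\<bar>f x\<bar> ^ k * \<bar>g x\<bar> ^ k) \<le> (\<bar>f x\<bar> ^ k)\<^sup>2 + (\<bar>g x\<bar> ^ k)\<^sup>2"
      using sum_squares_bound[of "\<bar>f x\<bar> ^ k" "\<bar>g x\<bar> ^ k"] by simp
    moreover have "0 \<le> \<bar>f x\<bar> ^ k * \<bar>g x\<bar> ^ k" by simp
    ultimately have "\<bar>f x\<bar> ^ k * \<bar>g x\<bar> ^ k \<le> (\<bar>f x\<bar> ^ k)\<^sup>2 + (\<bar>g x\<bar> ^ k)\<^sup>2" by linarith
    then show ?thesis
      by (simp only: abs_mult power_mult_distrib power_mult[of _ k 2] mult.commute[of 2 k])
  qed
qed (use assms in \<open>auto simp: has_moment_def\<close>)

lemma (in prob_space) has_moment_mono: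
  assumes "has_moment M k f" "j \<le> k"
  shows "has_moment M j f"
proof (rule has_moment_bound)
  show "integrable M (\<lambda>x. 1 + \<bar>f x\<bar> ^ k)"
    using assms by (auto simp: has_moment_def)
  show "\<bar>f x\<bar> ^ j \<le> 1 + \<bar>f x\<bar> ^ k" for x
  proof (cases "\<bar>f x\<bar> \<le> 1")
    case True
    then have "\<bar>f x\<bar> ^ j \<le> 1" by (simp add: power_le_one)
    then show ?thesis by (simp add: add_increasing2)
  next
    case False
    then show ?thesis using power_increasing[OF assms(2), of "\<bar>f x\<bar>"] by linarith
  qed
qed (use assms in \<open>auto simp: has_moment_def\<close>)

lemma has_moment_dominated:
  assumes "has_moment M k g" "f \<in> borel_measurable M" "\<And>x. x \<in> space M \<Longrightarrow> \<bar>f x\<bar> \<le> g x"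
  shows "has_moment M k f"
  by (rule has_moment_bound[of _ "\<lambda>x. \<bar>g x\<bar> ^ k"])
     (use assms in \<open>auto simp: has_moment_def intro!: power_mono intro: order_trans[OF _ abs_ge_self]\<close>)

lemma has_moment_distr:
  assumes "T \<in> M \<rightarrow>\<^sub>M N" "distr M N T = N'" "has_moment N' k f"
  shows "has_moment M k (\<lambda>x. f (T x))"
proof -
  have s: "sets N' = sets N" using assms(2) by auto
  have f: "f \<in> borel_measurable N" using assms(3) s by (auto simp: has_moment_def cong: measurable_cong_sets)
  have "integrable (distr M N T) (\<lambda>x. \<bar>f x\<bar> ^ k)" using assms by (simp add: has_moment_def)
  then show ?thesis
    using assms(1) f by (simp add: has_moment_def integrable_distr_eq)
qed

lemma (in prob_space) abs_expectation_le_sqrt: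
  assumes "has_moment M 2 f"
  shows "(\<integral>x. \<bar>f x\<bar> \<partial>M) \<le> sqrt (\<integral>x. (f x)\<^sup>2 \<partial>M)"
proof (rule real_le_rsqrt)
  have i: "integrable M f" using has_moment_mono[OF assms, of 1] by (simp add: has_moment_1)
  have "0 \<le> variance (\<lambda>x. \<bar>f x\<bar>)" by (rule variance_positive)
  also have "\<dots> = (\<integral>x. (f x)\<^sup>2 \<partial>M) - (\<integral>x. \<bar>f x\<bar> \<partial>M)\<^sup>2"
    using assms i by (subst variance_eq) (auto simp: has_moment_def)
  finally show "(\<integral>x. \<bar>f x\<bar> \<partial>M)\<^sup>2 \<le> (\<integral>x. (f x)\<^sup>2 \<partial>M)" by simp
qed

abbreviation iid :: "'b measure \<Rightarrow> nat \<Rightarrow> (nat \<Rightarrow> 'b) measure" where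
  "iid F n \<equiv> Pi\<^sub>M {1..n} (\<lambda>_. F)"

lemma prob_space_iid: "prob_space F \<Longrightarrow> prob_space (iid F n)"
  by (rule prob_space_PiM)

context prob_space begin

lemma iid_component: "i \<in> {1..n} \<Longrightarrow> distr (iid M n) M (\<lambda>x. x i) = M"
  using product_prob_space.PiM_component[of "\<lambda>_::nat. M" i "{1..n}"]
  by (simp add: product_prob_spaceI prob_space_axioms)

lemma has_moment_component:
  "has_moment M k f \<Longrightarrow> i \<in> {1..n} \<Longrightarrow> has_moment (iid M n) k (\<lambda>x. f (x i))"
  by (rule has_moment_distr[OF _ iid_component]) auto

lemma integral_component:
  "f \<in> borel_measurable M \<Longrightarrow> i \<in> {1..n} \<Longrightarrow> (\<integral>x. f (x i) \<partial>iid M n) = (\<integral>x. f x \<partial>M)"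
  for f :: "'a \<Rightarrow> real"
  by (subst (2) iid_component[of i n, symmetric]) (auto simp: integral_distr)

text \<open>
  The product space is built by adding one coordinate at a time. This is the basis of all inductions on the
  sample size, with the newest observation integrated out either first or last.
\<close>

lemma iid_Suc: "distr (iid M n \<Otimes>\<^sub>M M) (iid M (Suc n)) (\<lambda>(x, z). x(Suc n := z)) = iid M (Suc n)"
proof -
  have sf: "sigma_finite_measure M" by unfold_locales
  interpret product_prob_space "\<lambda>_::nat. M" "{1..Suc n}"
    by (simp add: product_prob_spaceI prob_space_axioms)
  have ins: "{1..Suc n} = insert (Suc n) {1..n}" by auto
  have m[measurable]: "(\<lambda>(x, z). x(Suc n := z)) \<in> iid M n \<Otimes>\<^sub>M M \<rightarrow>\<^sub>M iid M (Suc n)"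
    unfolding ins by measurable
  show ?thesis
  proof (rule PiM_eqI)
    fix A assume A: "\<And>i. i \<in> {1..Suc n} \<Longrightarrow> A i \<in> sets M"
    have last: "A (Suc n) \<subseteq> space M" using A[of "Suc n"] by (auto dest: sets.sets_into_space)
    have "(\<lambda>(x, z). x(Suc n := z)) -` (Pi\<^sub>E {1..Suc n} A) \<inter> space (iid M n \<Otimes>\<^sub>M M)
        = (Pi\<^sub>E {1..n} A) \<times> A (Suc n)"
      using A[THEN sets.sets_into_space]
      by (auto simp: space_pair_measure space_PiM PiE_iff extensional_def split: if_splits)
         (use last in \<open>auto simp: Pi_iff Ball_def le_Suc_eq\<close>)
    moreover have "emeasure (iid M n \<Otimes>\<^sub>M M) ((Pi\<^sub>E {1..n} A) \<times> A (Suc n)) =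
       (\<Prod>i\<in>{1..n}. emeasure M (A i)) * emeasure M (A (Suc n))"
    proof -
      have "emeasure (iid M n) (Pi\<^sub>E {1..n} A) = (\<Prod>i\<in>{1..n}. emeasure M (A i))"
        by (rule emeasure_PiM) (use A in auto)
      moreover have "Pi\<^sub>E {1..n} A \<in> sets (iid M n)" using A by (intro sets_PiM_I_finite) auto
      moreover have "A (Suc n) \<in> sets M" using A by auto
      ultimately show ?thesis by (simp add: sigma_finite_measure.emeasure_pair_measure_Times[OF sf])
    qed
    moreover have "Pi\<^sub>E {1..Suc n} A \<in> sets (iid M (Suc n))"
      using A by (intro sets_PiM_I_finite) auto
    ultimately show "emeasure (distr (iid M n \<Otimes>\<^sub>M M) (iid M (Suc n)) (\<lambda>(x, z). x(Suc n := z)))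
      (Pi\<^sub>E {1..Suc n} A) = (\<Prod>i\<in>{1..Suc n}. emeasure M (A i))"
      by (subst emeasure_distr) (auto)
  qed auto
qed

lemma measurable_iid_upd[measurable]:
  "(\<lambda>(x, z). x(Suc n := z)) \<in> iid M n \<Otimes>\<^sub>M M \<rightarrow>\<^sub>M iid M (Suc n)"
proof -
  have ins: "{1..Suc n} = insert (Suc n) {1..n}" by auto
  show ?thesis unfolding ins by measurable
qed

lemma
  fixes f :: "(nat \<Rightarrow> 'a) \<Rightarrow> 'c::{banach, second_countable_topology}"
  assumes f: "integrable (iid M (Suc n)) f"
  shows integral_iid_Suc: "(\<integral>x. f x \<partial>iid M (Suc n)) = (\<integral>x. (\<integral>z. f (x(Suc n := z)) \<partial>M) \<partial>iid M n)"
    and integral_iid_Suc': "(\<integral>x. f x \<partial>iid M (Suc n)) = (\<integral>z. (\<integral>x. f (x(Suc n := z)) \<partial>iid M n) \<partial>M)"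
    and integrable_iid_Suc: "integrable (iid M n) (\<lambda>x. \<integral>z. f (x(Suc n := z)) \<partial>M)"
    and integrable_iid_Suc': "integrable M (\<lambda>z. \<integral>x. f (x(Suc n := z)) \<partial>iid M n)"
proof -
  interpret I: prob_space "iid M n" by (rule prob_space_iid) unfold_locales
  interpret P: pair_prob_space "iid M n" M ..
  have f_m: "f \<in> borel_measurable (iid M (Suc n))" using f by auto
  have i: "integrable (iid M n \<Otimes>\<^sub>M M) (\<lambda>p. f ((\<lambda>(x, z). x(Suc n := z)) p))"
    by (rule integrable_distr[OF measurable_iid_upd]) (subst iid_Suc, rule f)
  have e: "(\<integral>x. f x \<partial>iid M (Suc n)) = (\<integral>p. f ((\<lambda>(x, z). x(Suc n := z)) p) \<partial>(iid M n \<Otimes>\<^sub>M M))"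
    by (subst iid_Suc[symmetric]) (rule integral_distr[OF measurable_iid_upd f_m])
  show "(\<integral>x. f x \<partial>iid M (Suc n)) = (\<integral>x. (\<integral>z. f (x(Suc n := z)) \<partial>M) \<partial>iid M n)"
    using P.integral_fst'[OF i] by (simp add: e)
  show "(\<integral>x. f x \<partial>iid M (Suc n)) = (\<integral>z. (\<integral>x. f (x(Suc n := z)) \<partial>iid M n) \<partial>M)"
    using P.integral_snd[of "\<lambda>x z. f (x(Suc n := z))"] i by (simp add: e case_prod_unfold)
  show "integrable (iid M n) (\<lambda>x. \<integral>z. f (x(Suc n := z)) \<partial>M)"
    using P.integrable_fst'[OF i] by simp
  show "integrable M (\<lambda>z. \<integral>x. f (x(Suc n := z)) \<partial>iid M n)"
    using P.integrable_snd[of "\<lambda>x z. f (x(Suc n := z))"] i by (simp add: case_prod_unfold)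
qed

lemma integral_iid_Suc_const:
  fixes f :: "(nat \<Rightarrow> 'a) \<Rightarrow> real"
  assumes "integrable (iid M (Suc n)) f" "\<And>x z. x \<in> space (iid M n) \<Longrightarrow> f (x(Suc n := z)) = g x"
  shows "(\<integral>x. f x \<partial>iid M (Suc n)) = (\<integral>x. g x \<partial>iid M n)"
  unfolding integral_iid_Suc[OF assms(1)] using assms(2)
  by (intro lebesgue_integral_cong) (auto simp: prob_space)

lemma iid_sum_second_moment:
  assumes f: "has_moment M 2 f" and f0: "(\<integral>x. f x \<partial>M) = 0"
  shows "(\<integral>x. (\<Sum>i=1..n. c i * f (x i)) ^ 2 \<partial>iid M n) = (\<integral>x. (f x)^2 \<partial>M) * (\<Sum>i=1..n. (c i)^2)"
proof (induction n)
  case 0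
  then show ?case by simp
next
  case (Suc n)
  interpret I: prob_space "iid M n" by (rule prob_space_iid) unfold_locales
  interpret J: prob_space "iid M (Suc n)" by (rule prob_space_iid) unfold_locales
  define S where "S = (\<lambda>x. \<Sum>i=1..n. c i * f (x i))"
  have S: "has_moment (iid M n) 2 S" unfolding S_def
    by (intro I.has_moment_sum has_moment_cmult has_moment_component f)
  have T: "has_moment (iid M (Suc n)) 2 (\<lambda>x. \<Sum>i=1..Suc n. c i * f (x i))"
    by (intro J.has_moment_sum has_moment_cmult has_moment_component f)
  have 1: "integrable M f" using has_moment_mono[OF f, of 1] by (simp add: has_moment_1)
  have 2: "integrable M (\<lambda>x. (f x)^2)" using f by (simp add: has_moment_def)
  have "(\<integral>x. (\<Sum>i=1..Suc n. c i * f (x i)) ^ 2 \<partial>iid M (Suc n)) =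
     (\<integral>x. (\<integral>z. (\<Sum>i=1..Suc n. c i * f ((x(Suc n := z)) i)) ^ 2 \<partial>M) \<partial>iid M n)"
    by (rule integral_iid_Suc) (use T in \<open>simp add: has_moment_def\<close>)
  also have "\<dots> = (\<integral>x. (\<integral>z. (S x)^2 + 2 * S x * c (Suc n) * f z + (c (Suc n))^2 * (f z)^2 \<partial>M) \<partial>iid M n)"
    by (intro lebesgue_integral_cong) (simp_all add: S_def power2_sum power_mult_distrib)
  also have "\<dots> = (\<integral>x. (S x)^2 + (c (Suc n))^2 * (\<integral>z. (f z)^2 \<partial>M) \<partial>iid M n)"
    by (intro lebesgue_integral_cong) (use 1 2 f0 in \<open>auto simp: prob_space\<close>)
  also have "\<dots> = (\<integral>x. (S x)^2 \<partial>iid M n) + (c (Suc n))^2 * (\<integral>z. (f z)^2 \<partial>M)"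
    using S by (subst Bochner_Integration.integral_add) (auto simp: has_moment_def I.prob_space)
  finally show ?case using Suc.IH by (simp add: S_def algebra_simps)
qed

lemma iid_sum_mean:
  fixes f :: "'a \<Rightarrow> real"
  assumes f: "integrable M f" and f0: "(\<integral>x. f x \<partial>M) = 0"
  shows "(\<integral>x. (\<Sum>i=1..n. c i * f (x i)) \<partial>iid M n) = 0"
proof -
  have "(\<integral>x. (\<Sum>i=1..n. c i * f (x i)) \<partial>iid M n) = (\<Sum>i=1..n. c i * (\<integral>x. f (x i) \<partial>iid M n))"
    using has_moment_component[of 1 f] f
    by (subst Bochner_Integration.integral_sum) (auto simp: has_moment_1)
  also have "\<dots> = 0" using integral_component[of f] f f0 by (intro sum.neutral) auto
  finally show ?thesis .
qed

lemma power4_binomial: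
  "(s + c * y) ^ 4 = s^4 + 4 * s^3 * c * y + 6 * s^2 * c^2 * y^2 + 4 * s * c^3 * y^3 + c^4 * y^4"
  for s c y :: real
  by (simp add: power4_eq_xxxx power3_eq_cube power2_eq_square) (simp add: algebra_simps)

text \<open>
  Induction on \<open>n\<close>: in \<open>E(S + c f)\<^sup>4\<close> the odd terms in \<open>S\<close> vanish because \<open>S\<close> and \<open>f\<close> are centered, which leaves
  \<open>6 c\<^sup>2 E f\<^sup>2 E S\<^sup>2\<close>; then \<open>(E f\<^sup>2)\<^sup>2 \<le> E f\<^sup>4\<close>.
\<close>

lemma iid_sum_fourth_moment:
  assumes f: "has_moment M 4 f" and f0: "(\<integral>x. f x \<partial>M) = 0"
  shows "(\<integral>x. (\<Sum>i=1..n. c i * f (x i)) ^ 4 \<partial>iid M n) \<le> 3 * (\<integral>x. (f x)^4 \<partial>M) * (\<Sum>i=1..n. (c i)^2)^2"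
proof (induction n)
  case 0
  then show ?case by simp
next
  case (Suc n)
  interpret I: prob_space "iid M n" by (rule prob_space_iid) unfold_locales
  interpret J: prob_space "iid M (Suc n)" by (rule prob_space_iid) unfold_locales
  define S where "S = (\<lambda>x. \<Sum>i=1..n. c i * f (x i))"
  define s where "s = (\<Sum>i=1..n. (c i)^2)"
  let ?m = "\<lambda>k. (\<integral>z. (f z)^k \<partial>M)" and ?c = "c (Suc n)"
  have S: "has_moment (iid M n) 4 S" unfolding S_def
    by (intro I.has_moment_sum has_moment_cmult has_moment_component f)
  have T: "has_moment (iid M (Suc n)) 4 (\<lambda>x. \<Sum>i=1..Suc n. c i * f (x i))"
    by (intro J.has_moment_sum has_moment_cmult has_moment_component f)
  have k: "integrable M (\<lambda>x. (f x)^k)" if "k \<le> 4" for k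
    using has_moment_mono[OF f that]
    by (auto simp: has_moment_def intro: integrable_abs_cancel simp flip: power_abs)
  have Sk: "integrable (iid M n) (\<lambda>x. (S x)^k)" if "k \<le> 4" for k
    using I.has_moment_mono[OF S that]
    by (auto simp: has_moment_def intro: integrable_abs_cancel simp flip: power_abs)
  have "(\<integral>x. (\<Sum>i=1..Suc n. c i * f (x i)) ^ 4 \<partial>iid M (Suc n)) =
     (\<integral>x. (\<integral>z. (\<Sum>i=1..Suc n. c i * f ((x(Suc n := z)) i)) ^ 4 \<partial>M) \<partial>iid M n)"
    by (rule integral_iid_Suc) (use T in \<open>simp add: has_moment_def\<close>)
  also have "\<dots> = (\<integral>x. (\<integral>z. (S x)^4 + 4 * (S x)^3 * ?c * f z + 6 * (S x)^2 * ?c^2 * (f z)^2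
       + 4 * S x * ?c^3 * (f z)^3 + ?c^4 * (f z)^4 \<partial>M) \<partial>iid M n)"
    by (intro lebesgue_integral_cong) (simp_all add: S_def power4_binomial)
  also have "\<dots> = (\<integral>x. (S x)^4 + 6 * (S x)^2 * ?c^2 * ?m 2 + 4 * S x * ?c^3 * ?m 3 + ?c^4 * ?m 4 \<partial>iid M n)"
    by (intro lebesgue_integral_cong) (use k[of 1] k[of 2] k[of 3] k[of 4] f0 in \<open>auto simp: prob_space\<close>)
  also have "\<dots> = (\<integral>x. (S x)^4 \<partial>iid M n) + 6 * ?c^2 * ?m 2 * (\<integral>x. (S x)^2 \<partial>iid M n)
      + 4 * ?c^3 * ?m 3 * (\<integral>x. S x \<partial>iid M n) + ?c^4 * ?m 4"
    using Sk[of 1] Sk[of 2] Sk[of 3] Sk[of 4] by (simp add: I.prob_space)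
  also have "(\<integral>x. S x \<partial>iid M n) = 0" unfolding S_def using k[of 1] f0 by (intro iid_sum_mean) auto
  also have "(\<integral>x. (S x)^2 \<partial>iid M n) = ?m 2 * s" unfolding S_def s_def
    by (intro iid_sum_second_moment has_moment_mono[OF f]) (auto simp: f0)
  finally have eq: "(\<integral>x. (\<Sum>i=1..Suc n. c i * f (x i)) ^ 4 \<partial>iid M (Suc n)) =
     (\<integral>x. (S x)^4 \<partial>iid M n) + 6 * ?c^2 * s * (?m 2)^2 + ?c^4 * ?m 4"
    by (simp add: power2_eq_square algebra_simps)
  have "0 \<le> variance (\<lambda>x. (f x)^2)" by (rule variance_positive)
  also have "\<dots> = ?m 4 - (?m 2)^2"
    using k[of 2] k[of 4] by (subst variance_eq) (auto simp flip: power_mult)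
  finally have m: "(?m 2)^2 \<le> ?m 4" by simp
  have s0: "0 \<le> s" unfolding s_def by (intro sum_nonneg) auto
  have m0: "0 \<le> ?m 4" by (intro integral_nonneg_AE) auto
  have "6 * ?c^2 * s * (?m 2)^2 \<le> 6 * ?c^2 * s * ?m 4"
    using m s0 by (intro mult_left_mono) auto
  moreover have "?c^4 * ?m 4 \<le> 3 * (?c^4 * ?m 4)" using m0 by simp
  moreover have "3 * ?m 4 * (s + ?c^2)^2 = 3 * ?m 4 * s^2 + 6 * ?c^2 * s * ?m 4 + 3 * (?c^4 * ?m 4)"
    by (simp add: power4_eq_xxxx power2_eq_square algebra_simps)
  moreover have "(\<integral>x. (S x)^4 \<partial>iid M n) \<le> 3 * ?m 4 * s^2" using Suc.IH by (simp add: S_def s_def)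
  moreover have "(\<Sum>i=1..Suc n. (c i)^2) = s + ?c^2" by (simp add: s_def)
  ultimately show ?case unfolding eq \<open>(\<Sum>i=1..Suc n. (c i)^2) = s + ?c^2\<close> by linarith
qed

end

section \<open>Degenerate kernels and weighted U-statistics\<close>

text \<open>
  This is \<open>E|f|\<^sup>3 \<le> \<surd>(E f\<^sup>2 E f\<^sup>4)\<close> with upper bounds in place of the moments. It follows from
  \<open>2 \<delta> |y|\<^sup>3 \<le> \<delta>\<^sup>2 y\<^sup>2 + y\<^sup>4\<close>, optimized in \<open>\<delta>\<close>.
\<close>

lemma (in prob_space) third_moment_le:
  assumes f: "has_moment M 4 f" and P: "(\<integral>x. (f x)^2 \<partial>M) \<le> P" and Q: "(\<integral>x. (f x)^4 \<partial>M) \<le> Q"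
    and pos: "P > 0" "Q > 0"
  shows "(\<integral>x. \<bar>f x\<bar>^3 \<partial>M) \<le> sqrt (P * Q)"
proof -
  \<comment> \<open>the value of \<open>\<delta>\<close> that balances the two terms\<close>
  define \<delta> where "\<delta> = sqrt Q / sqrt P"
  have \<delta>: "\<delta> > 0" using pos by (simp add: \<delta>_def)
  have i3: "integrable M (\<lambda>x. \<bar>f x\<bar>^3)" and i2: "integrable M (\<lambda>x. (f x)^2)"
    and i4: "integrable M (\<lambda>x. (f x)^4)"
    using has_moment_mono[OF f, of 3] has_moment_mono[OF f, of 2] f by (auto simp: has_moment_def)
  have pt: "\<bar>y\<bar>^3 \<le> (\<delta> * y^2 + y^4 / \<delta>) / 2" for y :: real
  proof -
    have "0 \<le> y^2 * (\<delta> - \<bar>y\<bar>)^2" by simp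
    also have "\<dots> = \<delta>^2 * y^2 + y^4 - 2 * \<delta> * \<bar>y\<bar>^3"
      by (simp add: power2_diff algebra_simps power2_eq_square power4_eq_xxxx power3_eq_cube abs_mult_self_eq)
    finally show ?thesis using \<delta> by (simp add: field_simps power2_eq_square)
  qed
  have "(\<integral>x. \<bar>f x\<bar>^3 \<partial>M) \<le> (\<integral>x. (\<delta> * (f x)^2 + (f x)^4 / \<delta>) / 2 \<partial>M)"
    using i2 i3 i4 pt by (intro integral_mono) auto
  also have "\<dots> = (\<delta> * (\<integral>x. (f x)^2 \<partial>M) + (\<integral>x. (f x)^4 \<partial>M) / \<delta>) / 2"
    using i2 i4 by simp
  also have "\<dots> \<le> (\<delta> * P + Q / \<delta>) / 2"
    using P Q \<delta> by (intro divide_right_mono add_mono mult_left_mono) auto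
  also have "\<dots> = sqrt (P * Q)"
  proof -
    have "sqrt P * sqrt P = P" "sqrt Q * sqrt Q = Q" "sqrt P > 0" "sqrt Q > 0" using pos by auto
    then show ?thesis unfolding \<delta>_def real_sqrt_mult by (simp add: field_simps)
  qed
  finally show ?thesis .
qed

lemma iid_space: "x \<in> space (iid F n) \<Longrightarrow> i \<in> {1..n} \<Longrightarrow> x i \<in> space F"
  by (auto simp: space_PiM)

text \<open>
  The pointwise bound \<open>|K x y| \<le> u x + u y\<close> is stronger than integrability of \<open>K\<close> on the product space: it
  makes every section \<open>K x\<close> integrable, not only almost every one, so no exceptional null sets appear. For the
  distance kernel \<open>u\<close> is an affine function of the norm.
\<close>

locale degenerate_kernel = prob_space F for F :: "'b measure" +
  fixes K :: "'b \<Rightarrow> 'b \<Rightarrow> real" and u :: "'b \<Rightarrow> real"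
  assumes K_pair: "(\<lambda>(x, y). K x y) \<in> borel_measurable (F \<Otimes>\<^sub>M F)"
    and K_sym: "\<And>x y. x \<in> space F \<Longrightarrow> y \<in> space F \<Longrightarrow> K x y = K y x"
    and K_bound: "\<And>x y. x \<in> space F \<Longrightarrow> y \<in> space F \<Longrightarrow> \<bar>K x y\<bar> \<le> u x + u y"
    and u_moment: "has_moment F 2 u"
    and K_degenerate: "\<And>x. x \<in> space F \<Longrightarrow> (\<integral>z. K x z \<partial>F) = 0"
begin

lemma K_measurable[measurable (raw)]:
  "f \<in> N \<rightarrow>\<^sub>M F \<Longrightarrow> g \<in> N \<rightarrow>\<^sub>M F \<Longrightarrow> (\<lambda>x. K (f x) (g x)) \<in> borel_measurable N"
  using measurable_compose[OF measurable_Pair K_pair, of f N g] by simp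

lemma moment_u_const: "has_moment F k u \<Longrightarrow> has_moment F k (\<lambda>x. u x + c)"
  by (intro has_moment_add has_moment_const)

lemma K_moment_section:
  assumes "has_moment F k u" "x \<in> space F"
  shows "has_moment F k (\<lambda>z. K x z)" "has_moment F k (\<lambda>z. K z x)"
proof -
  show "has_moment F k (\<lambda>z. K x z)"
    by (rule has_moment_dominated[OF moment_u_const[OF assms(1), of "u x"]])
       (use assms K_bound[of x] in \<open>auto simp: add.commute\<close>)
  show "has_moment F k (\<lambda>z. K z x)"
    by (rule has_moment_dominated[OF moment_u_const[OF assms(1), of "u x"]])
       (use assms K_bound[of _ x] in auto)
qed

lemma K_moment_iid:
  assumes "has_moment F k u" "i \<in> {1..n}" "j \<in> {1..n}"
  shows "has_moment (iid F n) k (\<lambda>x. K (x i) (x j))"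
  by (rule has_moment_dominated[of _ _ "\<lambda>x. u (x i) + u (x j)"])
     (use assms K_bound in \<open>auto intro!: has_moment_add has_moment_component simp: iid_space[of _ n F]\<close>)

definition "K_second = (\<integral>x. (\<integral>z. (K x z)^2 \<partial>F) \<partial>F)"

lemma K_degenerate': "x \<in> space F \<Longrightarrow> (\<integral>z. K z x \<partial>F) = 0"
  using K_degenerate[of x] K_sym[of x] by (auto cong: lebesgue_integral_cong)

definition ustat :: "(nat \<Rightarrow> nat \<Rightarrow> real) \<Rightarrow> nat \<Rightarrow> (nat \<Rightarrow> 'b) \<Rightarrow> real" where
  "ustat c n x = (\<Sum>j=1..n. \<Sum>i=1..<j. c i j * K (x i) (x j))"

text \<open>
  What observation number \<open>n + 1\<close>, placed at \<open>z\<close>, adds to the U-statistic of the first \<open>n\<close>. Given those, it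
  has mean zero because the kernel is degenerate, so the partial U-statistics form a martingale.
\<close>

definition increment :: "(nat \<Rightarrow> nat \<Rightarrow> real) \<Rightarrow> nat \<Rightarrow> (nat \<Rightarrow> 'b) \<Rightarrow> 'b \<Rightarrow> real" where
  "increment c n x z = (\<Sum>i=1..n. c i (Suc n) * K (x i) z)"

lemma ustat_Suc: "ustat c (Suc n) x = ustat c n x + increment c n x (x (Suc n))"
  by (simp add: ustat_def increment_def atLeastLessThanSuc_atLeastAtMost)

lemma ustat_upd: "ustat c n (x(Suc n := z)) = ustat c n x"
  unfolding ustat_def by (intro sum.cong) auto

lemma increment_upd: "increment c n (x(Suc n := z)) y = increment c n x y"
  unfolding increment_def by (intro sum.cong) auto

lemma ustat_moment:
  assumes "has_moment F k u" "n \<le> m"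
  shows "has_moment (iid F m) k (ustat c n)"
proof -
  interpret I: prob_space "iid F m" by (rule prob_space_iid) unfold_locales
  show ?thesis unfolding ustat_def
    by (intro I.has_moment_sum has_moment_cmult K_moment_iid) (use assms in auto)
qed

lemma increment_moment:
  assumes "has_moment F k u"
  shows "has_moment (iid F (Suc n)) k (\<lambda>x. increment c n x (x (Suc n)))"
proof -
  interpret I: prob_space "iid F (Suc n)" by (rule prob_space_iid) unfold_locales
  show ?thesis unfolding increment_def
    by (intro I.has_moment_sum has_moment_cmult K_moment_iid) (use assms in auto)
qed

lemma increment_moment_section:
  assumes "has_moment F k u" "x \<in> space (iid F n)"
  shows "has_moment F k (increment c n x)"
  unfolding increment_def
  by (intro has_moment_sum has_moment_cmult K_moment_section) (use assms in \<open>auto simp: iid_space[of x n F]\<close>)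

lemma increment_mean:
  assumes "x \<in> space (iid F n)"
  shows "(\<integral>z. increment c n x z \<partial>F) = 0"
proof -
  have "integrable F (\<lambda>z. K (x i) z)" if "i \<in> {1..n}" for i
    using has_moment_mono[OF K_moment_section(1)[OF u_moment], of "x i" 1] iid_space[OF assms that]
    by (simp add: has_moment_1)
  then have "(\<integral>z. increment c n x z \<partial>F) = (\<Sum>i=1..n. c i (Suc n) * (\<integral>z. K (x i) z \<partial>F))"
    unfolding increment_def by (subst Bochner_Integration.integral_sum) auto
  then show ?thesis using K_degenerate iid_space[OF assms] by simp
qed

text \<open>
  Integrating the old observations first, for a fixed new one, turns the increment into a sum of centered
  i.i.d. terms.
\<close>

lemma increment_second_moment:
  "(\<integral>x. (increment c n x (x (Suc n)))^2 \<partial>iid F (Suc n)) = K_second * (\<Sum>i=1..n. (c i (Suc n))^2)"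
proof -
  have "(\<integral>x. (increment c n x (x (Suc n)))^2 \<partial>iid F (Suc n)) =
        (\<integral>z. (\<integral>x. (increment c n (x(Suc n := z)) ((x(Suc n := z)) (Suc n)))^2 \<partial>iid F n) \<partial>F)"
    by (rule integral_iid_Suc') (use increment_moment[OF u_moment] in \<open>simp add: has_moment_def\<close>)
  also have "\<dots> = (\<integral>z. (\<integral>x. (K x z)^2 \<partial>F) * (\<Sum>i=1..n. (c i (Suc n))^2) \<partial>F)"
  proof (rule lebesgue_integral_cong[OF refl])
    fix z assume z: "z \<in> space F"
    show "(\<integral>x. (increment c n (x(Suc n := z)) ((x(Suc n := z)) (Suc n)))^2 \<partial>iid F n)
       = (\<integral>x. (K x z)^2 \<partial>F) * (\<Sum>i=1..n. (c i (Suc n))^2)"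
      using iid_sum_second_moment[OF K_moment_section(2)[OF u_moment z] K_degenerate'[OF z], where c="\<lambda>i. c i (Suc n)" and n=n]
      by (simp add: increment_upd increment_def)
  qed
  also have "\<dots> = (\<integral>z. (\<integral>x. (K z x)^2 \<partial>F) * (\<Sum>i=1..n. (c i (Suc n))^2) \<partial>F)"
    by (intro lebesgue_integral_cong refl arg_cong2[where f="(*)"]) (simp add: K_sym)
  also have "\<dots> = K_second * (\<Sum>i=1..n. (c i (Suc n))^2)"
    by (simp add: K_second_def)
  finally show ?thesis .
qed

text \<open>
  The increments of the martingale are orthogonal.
\<close>

lemma ustat_second_moment:
  "(\<integral>x. (ustat c n x)^2 \<partial>iid F n) = K_second * (\<Sum>j=1..n. \<Sum>i=1..<j. (c i j)^2)"
proof (induction n)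
  case 0
  then show ?case by (simp add: ustat_def)
next
  case (Suc n)
  interpret J: prob_space "iid F (Suc n)" by (rule prob_space_iid) unfold_locales
  let ?D = "\<lambda>x. increment c n x (x (Suc n))"
  have U: "has_moment (iid F (Suc n)) 2 (ustat c n)" by (rule ustat_moment[OF u_moment]) simp
  have D: "has_moment (iid F (Suc n)) 2 ?D" by (rule increment_moment[OF u_moment])
  have UD: "has_moment (iid F (Suc n)) 1 (\<lambda>x. ustat c n x * ?D x)"
    by (rule has_moment_mult) (use U D in auto)
  have "(\<integral>x. ustat c n x * ?D x \<partial>iid F (Suc n)) =
     (\<integral>x. (\<integral>z. ustat c n (x(Suc n := z)) * ?D (x(Suc n := z)) \<partial>F) \<partial>iid F n)"
    by (rule integral_iid_Suc) (use UD in \<open>simp add: has_moment_1\<close>)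
  also have "\<dots> = (\<integral>x. ustat c n x * (\<integral>z. increment c n x z \<partial>F) \<partial>iid F n)"
    by (simp add: ustat_upd increment_upd)
  also have "\<dots> = (\<integral>x. 0 \<partial>iid F n)"
    by (intro lebesgue_integral_cong) (auto simp: increment_mean)
  finally have cross: "(\<integral>x. ustat c n x * ?D x \<partial>iid F (Suc n)) = 0" by simp
  have old: "(\<integral>x. (ustat c n x)^2 \<partial>iid F (Suc n)) = (\<integral>x. (ustat c n x)^2 \<partial>iid F n)"
    by (rule integral_iid_Suc_const) (use U in \<open>auto simp: has_moment_def ustat_upd\<close>)
  have "(\<integral>x. (ustat c (Suc n) x)^2 \<partial>iid F (Suc n)) =
    (\<integral>x. (ustat c n x)^2 + 2 * (ustat c n x * ?D x) + (?D x)^2 \<partial>iid F (Suc n))"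
    by (simp add: ustat_Suc power2_sum algebra_simps)
  also have "\<dots> = (\<integral>x. (ustat c n x)^2 \<partial>iid F (Suc n)) + 2 * (\<integral>x. ustat c n x * ?D x \<partial>iid F (Suc n))
      + (\<integral>x. (?D x)^2 \<partial>iid F (Suc n))"
    using U D UD[unfolded has_moment_1] by (auto simp: has_moment_def)
  finally show ?case
    by (simp add: cross old Suc.IH increment_second_moment algebra_simps atLeastLessThanSuc_atLeastAtMost)
qed

end

section \<open>Conditional variance of the increments\<close>

lemma double_sum_symmetric:
  fixes f :: "nat \<Rightarrow> nat \<Rightarrow> real"
  assumes "\<And>i j. f i j = f j i"
  shows "(\<Sum>i=1..n. \<Sum>j=1..n. f i j) = (\<Sum>i=1..n. f i i) + 2 * (\<Sum>j=1..n. \<Sum>i=1..<j. f i j)"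
proof (induction n)
  case (Suc n)
  have "(\<Sum>i=1..Suc n. \<Sum>j=1..Suc n. f i j)
     = (\<Sum>i=1..n. \<Sum>j=1..n. f i j) + (\<Sum>i=1..n. f i (Suc n)) + (\<Sum>j=1..n. f (Suc n) j) + f (Suc n) (Suc n)"
    by (simp add: sum.distrib)
  also have "(\<Sum>j=1..n. f (Suc n) j) = (\<Sum>i=1..n. f i (Suc n))" using assms by simp
  finally show ?case using Suc.IH by (simp add: atLeastLessThanSuc_atLeastAtMost)
qed simp

lemma sum_square_le:
  fixes c :: "nat \<Rightarrow> real"
  assumes "\<And>i. i \<in> {1..n} \<Longrightarrow> \<bar>c i\<bar> \<le> A"
  shows "(\<Sum>i=1..n. (c i)^2) \<le> n * A^2"
proof -
  have "(\<Sum>i=1..n. (c i)^2) \<le> (\<Sum>i=1..n. A^2)"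
    using assms by (intro sum_mono) (metis abs_ge_zero power2_abs power_mono)
  then show ?thesis by simp
qed

text \<open>
  Fourth moments are needed for the conditional variances and for the variance estimator, both of which are
  quadratic in the kernel.
\<close>

locale degenerate_kernel4 = degenerate_kernel F K u for F :: "'b measure" and K u +
  assumes u_moment4: "has_moment F 4 u"
begin

text \<open>
  Kernel of the square of the integral operator with kernel \<open>K\<close>. Its diagonal is the conditional second
  moment of \<open>K x Z\<close>.
\<close>

definition G :: "'b \<Rightarrow> 'b \<Rightarrow> real" where
  "G x y = (\<integral>z. K x z * K y z \<partial>F)"

definition "K_fourth = (\<integral>x. (\<integral>z. (K x z)^4 \<partial>F) \<partial>F)"
definition "K_cycle = (\<integral>x. (\<integral>y. (G x y)^2 \<partial>F) \<partial>F)"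

lemma G_pair: "(\<lambda>(x, y). G x y) \<in> borel_measurable (F \<Otimes>\<^sub>M F)"
  unfolding G_def case_prod_unfold by measurable

lemma G_measurable[measurable (raw)]:
  "f \<in> N \<rightarrow>\<^sub>M F \<Longrightarrow> g \<in> N \<rightarrow>\<^sub>M F \<Longrightarrow> (\<lambda>x. G (f x) (g x)) \<in> borel_measurable N"
  using measurable_compose[OF measurable_Pair G_pair, of f N g] by simp

lemma G_diag: "G x x = (\<integral>z. (K x z)^2 \<partial>F)"
  by (simp add: G_def power2_eq_square)

lemma section_integrable:
  assumes "x \<in> space F" "k \<le> 4"
  shows "integrable F (\<lambda>z. (K x z)^k)"
  using has_moment_mono[OF K_moment_section(1)[OF u_moment4 assms(1)] assms(2)]
  by (auto simp: has_moment_def intro: integrable_abs_cancel simp flip: power_abs)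

lemma G_integrable:
  assumes "x \<in> space F" "y \<in> space F"
  shows "integrable F (\<lambda>z. K x z * K y z)"
proof -
  have "has_moment F 1 (\<lambda>z. K x z * K y z)"
    by (rule has_moment_mult) (use K_moment_section[OF u_moment] assms in auto)
  then show ?thesis by (simp add: has_moment_1)
qed

definition Gu :: "'b \<Rightarrow> real" where
  "Gu x = (u x)^2 + (\<integral>z. (u z)^2 \<partial>F)"

lemma Gu_moment: "has_moment F 2 Gu"
proof -
  have "has_moment F 2 (\<lambda>x. u x * u x)"
    by (rule has_moment_mult) (use u_moment4 in auto)
  then show ?thesis unfolding Gu_def power2_eq_square
    by (intro has_moment_add has_moment_const)
qed

lemma G_diag_bound:
  assumes x: "x \<in> space F"
  shows "0 \<le> G x x" "G x x \<le> 2 * Gu x"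
proof -
  show "0 \<le> G x x" unfolding G_diag by (intro integral_nonneg_AE) auto
  have i: "integrable F (\<lambda>z. (u z)^2)" using u_moment by (simp add: has_moment_def)
  have "G x x \<le> (\<integral>z. 2 * (u x)^2 + 2 * (u z)^2 \<partial>F)"
    unfolding G_diag
  proof (rule integral_mono)
    fix z assume z: "z \<in> space F"
    have "(K x z)^2 \<le> (u x + u z)^2"
      using K_bound[OF x z] by (metis abs_ge_zero power2_abs power_mono)
    also have "\<dots> \<le> 2 * (u x)^2 + 2 * (u z)^2"
      using sum_squares_bound[of "u x" "u z"] by (simp add: power2_sum)
    finally show "(K x z)^2 \<le> 2 * (u x)^2 + 2 * (u z)^2" .
  qed (use i section_integrable[OF x, of 2] in auto)
  also have "\<dots> = 2 * Gu x" using i by (simp add: Gu_def prob_space)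
  finally show "G x x \<le> 2 * Gu x" .
qed

lemma G_bound:
  assumes x: "x \<in> space F" and y: "y \<in> space F"
  shows "\<bar>G x y\<bar> \<le> Gu x + Gu y"
proof -
  have "\<bar>G x y\<bar> \<le> (\<integral>z. \<bar>K x z * K y z\<bar> \<partial>F)"
    unfolding G_def by (rule integral_abs_bound)
  also have "\<dots> \<le> (\<integral>z. ((K x z)^2 + (K y z)^2) / 2 \<partial>F)"
  proof (rule integral_mono)
    show "\<bar>K x z * K y z\<bar> \<le> ((K x z)^2 + (K y z)^2) / 2" for z
      using sum_squares_bound[of "\<bar>K x z\<bar>" "\<bar>K y z\<bar>"] by (simp add: abs_mult)
  qed (use G_integrable[OF x y] section_integrable[OF x, of 2] section_integrable[OF y, of 2] in auto)
  also have "\<dots> = (G x x + G y y) / 2"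
    using section_integrable[OF x, of 2] section_integrable[OF y, of 2] by (simp add: G_diag)
  finally show ?thesis using G_diag_bound(2)[OF x] G_diag_bound(2)[OF y] by simp
qed

text \<open>
  Fubini on two coordinates: \<open>E\<^sub>Y G x Y = E\<^sub>Z (K x Z \<cdot> E\<^sub>Y K Y Z) = 0\<close>. Hence sums of \<open>G\<close> over pairs are again
  degenerate U-statistics, and the second-moment formula applies to them.
\<close>

lemma G_degenerate:
  assumes x: "x \<in> space F"
  shows "(\<integral>y. G x y \<partial>F) = 0"
proof -
  let ?f = "\<lambda>v. K x (v 2) * K (v 1) (v (2::nat))"
  have "has_moment (iid F 2) 1 ?f"
    by (rule has_moment_mult)
       (use K_moment_iid[OF u_moment, of 1 2 2] has_moment_component[OF K_moment_section(1)[OF u_moment x], of 2 2] in auto)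
  then have f: "integrable (iid F (Suc 1)) ?f" unfolding has_moment_1 Suc_1 .
  have "(\<integral>v. ?f v \<partial>iid F (Suc 1)) = (\<integral>v. G x (v 1) \<partial>iid F 1)"
    unfolding integral_iid_Suc[OF f] G_def by simp
  also have "\<dots> = (\<integral>y. G x y \<partial>F)" by (rule integral_component) (use x in auto)
  finally have 1: "(\<integral>v. ?f v \<partial>iid F (Suc 1)) = (\<integral>y. G x y \<partial>F)" .
  have "(\<integral>v. ?f v \<partial>iid F (Suc 1)) = (\<integral>z. K x z * (\<integral>v. K (v 1) z \<partial>iid F 1) \<partial>F)"
    unfolding integral_iid_Suc'[OF f] by simp
  also have "\<dots> = (\<integral>z. K x z * 0 \<partial>F)"
  proof (intro lebesgue_integral_cong refl arg_cong2[where f="(*)"])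
    fix z assume z: "z \<in> space F"
    have "(\<integral>v. K (v 1) z \<partial>iid F 1) = (\<integral>y. K y z \<partial>F)"
      by (rule integral_component) (use z in auto)
    then show "(\<integral>v. K (v 1) z \<partial>iid F 1) = 0" using K_degenerate'[OF z] by simp
  qed
  finally show ?thesis using 1 by simp
qed

sublocale G: degenerate_kernel F G Gu
proof
  show "(\<lambda>(x, y). G x y) \<in> borel_measurable (F \<Otimes>\<^sub>M F)" by (rule G_pair)
  show "G x y = G y x" for x y by (simp add: G_def mult.commute)
qed (use G_bound Gu_moment G_degenerate in auto)

lemma G_second: "G.K_second = K_cycle"
  by (simp add: G.K_second_def K_cycle_def)

lemma diag_moment: "has_moment F 2 (\<lambda>x. G x x)"
  by (rule has_moment_dominated[OF has_moment_cmult[OF Gu_moment, of 2]])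
     (use G_diag_bound in auto)

lemma diag_mean: "(\<integral>x. G x x \<partial>F) = K_second"
  by (simp add: G_diag K_second_def)

lemma fourth_integrable: "integrable F (\<lambda>x. \<integral>z. (K x z)^4 \<partial>F)"
proof -
  have "integrable (iid F (Suc 1)) (\<lambda>v. (K (v 1) (v 2))^4)"
    unfolding Suc_1 using K_moment_iid[OF u_moment4, of 1 2 2] by (simp add: has_moment_def)
  from integrable_iid_Suc[OF this]
  have "integrable (iid F 1) (\<lambda>v. (\<integral>z. (K (v 1) z)^4 \<partial>F))" by simp
  then have "integrable (distr (iid F 1) F (\<lambda>v. v 1)) (\<lambda>x. \<integral>z. (K x z)^4 \<partial>F)"
    by (subst integrable_distr_eq) auto
  then show ?thesis by (subst (asm) iid_component) auto
qed

lemma diag_second_moment: "(\<integral>x. (G x x)^2 \<partial>F) \<le> K_fourth"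
  unfolding K_fourth_def
proof (rule integral_mono)
  show "integrable F (\<lambda>x. (G x x)^2)" using diag_moment by (simp add: has_moment_def)
  show "integrable F (\<lambda>x. \<integral>z. (K x z)^4 \<partial>F)" by (rule fourth_integrable)
  fix x assume x: "x \<in> space F"
  have "0 \<le> variance (\<lambda>z. (K x z)^2)" by (rule variance_positive)
  also have "\<dots> = (\<integral>z. (K x z)^4 \<partial>F) - (G x x)^2"
    using section_integrable[OF x, of 2] section_integrable[OF x, of 4]
    by (subst variance_eq) (auto simp: G_diag simp flip: power_mult)
  finally show "(G x x)^2 \<le> (\<integral>z. (K x z)^4 \<partial>F)" by simp
qed

lemma second_nonneg: "0 \<le> K_second" and fourth_nonneg: "0 \<le> K_fourth" and cycle_nonneg: "0 \<le> K_cycle"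
  unfolding K_second_def K_fourth_def K_cycle_def by (intro integral_nonneg_AE AE_I2; simp)+

lemma diag_centered:
  shows "has_moment F 2 (\<lambda>x. G x x - K_second)" "(\<integral>x. G x x - K_second \<partial>F) = 0"
    "(\<integral>x. (G x x - K_second)^2 \<partial>F) \<le> K_fourth"
proof -
  have i: "integrable F (\<lambda>x. G x x)" "integrable F (\<lambda>x. (G x x)^2)"
    using has_moment_mono[OF diag_moment, of 1] diag_moment by (auto simp: has_moment_1) (simp add: has_moment_def)
  show "has_moment F 2 (\<lambda>x. G x x - K_second)" by (intro has_moment_diff diag_moment has_moment_const)
  show "(\<integral>x. G x x - K_second \<partial>F) = 0" using i by (simp add: diag_mean prob_space)
  have "(\<integral>x. (G x x - K_second)^2 \<partial>F) = (\<integral>x. (G x x)^2 \<partial>F) - K_second^2"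
    using variance_eq[of "\<lambda>x. G x x"] i by (simp add: diag_mean)
  also have "\<dots> \<le> K_fourth" using diag_second_moment by (smt (verit) zero_le_power2)
  finally show "(\<integral>x. (G x x - K_second)^2 \<partial>F) \<le> K_fourth" .
qed

lemma second_sq_le_fourth: "K_second^2 \<le> K_fourth"
proof -
  have i: "integrable F (\<lambda>x. G x x)" "integrable F (\<lambda>x. (G x x)^2)"
    using has_moment_mono[OF diag_moment, of 1] diag_moment by (auto simp: has_moment_1) (simp add: has_moment_def)
  have "0 \<le> variance (\<lambda>x. G x x)" by (rule variance_positive)
  also have "\<dots> = (\<integral>x. (G x x)^2 \<partial>F) - K_second^2"
    using variance_eq[of "\<lambda>x. G x x"] i by (simp add: diag_mean)
  finally show ?thesis using diag_second_moment by linarith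
qed

text \<open>
  Conditional variance of the next increment given the first \<open>n\<close> observations.
\<close>

definition condvar :: "(nat \<Rightarrow> nat \<Rightarrow> real) \<Rightarrow> nat \<Rightarrow> (nat \<Rightarrow> 'b) \<Rightarrow> real" where
  "condvar c n x = (\<integral>z. (increment c n x z)^2 \<partial>F)"

text \<open>
  Expanding the square splits the fluctuation of the conditional variance into a diagonal part, a sum of
  centered i.i.d. terms, and an off-diagonal part, a degenerate U-statistic with kernel \<open>G\<close>.
\<close>

lemma condvar_expand:
  assumes x: "x \<in> space (iid F n)"
  shows "condvar c n x - K_second * (\<Sum>i=1..n. (c i (Suc n))^2) =
    (\<Sum>i=1..n. (c i (Suc n))^2 * (G (x i) (x i) - K_second))
      + 2 * G.ustat (\<lambda>i j. c i (Suc n) * c j (Suc n)) n x"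
proof -
  let ?b = "\<lambda>i. c i (Suc n)"
  have i: "integrable F (\<lambda>z. K (x i) z * K (x j) z)" if "i \<in> {1..n}" "j \<in> {1..n}" for i j
    using that by (intro G_integrable iid_space[OF x])
  have "condvar c n x = (\<integral>z. (\<Sum>i=1..n. \<Sum>j=1..n. (?b i * ?b j) * (K (x i) z * K (x j) z)) \<partial>F)"
    unfolding condvar_def increment_def power2_eq_square sum_product
    by (simp add: mult_ac)
  also have "\<dots> = (\<Sum>i=1..n. \<Sum>j=1..n. (?b i * ?b j) * G (x i) (x j))"
  proof -
    have "(\<integral>z. (\<Sum>i=1..n. \<Sum>j=1..n. (?b i * ?b j) * (K (x i) z * K (x j) z)) \<partial>F)
       = (\<Sum>i=1..n. (\<integral>z. (\<Sum>j=1..n. (?b i * ?b j) * (K (x i) z * K (x j) z)) \<partial>F))"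
      by (rule Bochner_Integration.integral_sum)
         (intro Bochner_Integration.integrable_sum integrable_mult_right i)
    also have "\<dots> = (\<Sum>i=1..n. \<Sum>j=1..n. (\<integral>z. (?b i * ?b j) * (K (x i) z * K (x j) z) \<partial>F))"
      by (intro sum.cong refl Bochner_Integration.integral_sum integrable_mult_right i)
    finally show ?thesis by (simp add: G_def)
  qed
  also have "\<dots> = (\<Sum>i=1..n. (?b i * ?b i) * G (x i) (x i))
      + 2 * (\<Sum>j=1..n. \<Sum>i=1..<j. (?b i * ?b j) * G (x i) (x j))"
    by (rule double_sum_symmetric) (simp add: G_def mult_ac)
  finally show ?thesis
    by (simp add: G.ustat_def power2_eq_square right_diff_distrib sum_subtractf sum_distrib_left mult_ac)
qed

lemma condvar_moment: "integrable (iid F n) (condvar c n)"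
proof -
  have "integrable (iid F (Suc n)) (\<lambda>x. (increment c n x (x (Suc n)))^2)"
    using increment_moment[OF u_moment] by (simp add: has_moment_def)
  from integrable_iid_Suc[OF this] show ?thesis
    by (simp add: condvar_def[abs_def] increment_upd)
qed

text \<open>
  The diagonal part is governed by the fourth moment of the kernel and the off-diagonal part by the cycle
  moment. For \<open>A\<close> of order \<open>1/n\<close> the bound is \<open>o(1/n)\<close> exactly under the two moment conditions.
\<close>

lemma condvar_deviation:
  assumes c: "\<And>i. i \<in> {1..n} \<Longrightarrow> \<bar>c i (Suc n)\<bar> \<le> A"
  shows "(\<integral>x. \<bar>condvar c n x - K_second * (\<Sum>i=1..n. (c i (Suc n))^2)\<bar> \<partial>iid F n)
    \<le> A^2 * (sqrt (n * K_fourth) + 2 * n * sqrt K_cycle)"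
proof -
  interpret I: prob_space "iid F n" by (rule prob_space_iid) unfold_locales
  let ?b = "\<lambda>i. c i (Suc n)"
  let ?A = "\<lambda>x. \<Sum>i=1..n. (?b i)^2 * (G (x i) (x i) - K_second)"
  let ?B = "G.ustat (\<lambda>i j. ?b i * ?b j) n"
  have b2: "(?b i)^2 \<le> A^2" if "i \<in> {1..n}" for i
    using c[OF that] by (metis abs_ge_zero power2_abs power_mono)
  have mA: "has_moment (iid F n) 2 ?A"
    by (intro I.has_moment_sum has_moment_cmult has_moment_component[OF diag_centered(1)])
  have mB: "has_moment (iid F n) 2 ?B" by (rule G.ustat_moment[OF Gu_moment]) simp
  have iA: "integrable (iid F n) ?A" and iB: "integrable (iid F n) ?B"
    using I.has_moment_mono[OF mA, of 1] I.has_moment_mono[OF mB, of 1] by (auto simp: has_moment_1)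
  have "(\<integral>x. \<bar>condvar c n x - K_second * (\<Sum>i=1..n. (?b i)^2)\<bar> \<partial>iid F n)
      = (\<integral>x. \<bar>?A x + 2 * ?B x\<bar> \<partial>iid F n)"
    by (intro lebesgue_integral_cong refl) (simp add: condvar_expand)
  also have "\<dots> \<le> (\<integral>x. \<bar>?A x\<bar> + 2 * \<bar>?B x\<bar> \<partial>iid F n)"
    using iA iB by (intro integral_mono) auto
  also have "\<dots> = (\<integral>x. \<bar>?A x\<bar> \<partial>iid F n) + 2 * (\<integral>x. \<bar>?B x\<bar> \<partial>iid F n)"
    using iA iB by simp
  also have "(\<integral>x. \<bar>?A x\<bar> \<partial>iid F n) \<le> sqrt (\<integral>x. (?A x)^2 \<partial>iid F n)"
    by (rule I.abs_expectation_le_sqrt[OF mA])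
  also have "(\<integral>x. (?A x)^2 \<partial>iid F n) \<le> K_fourth * (n * (A^2)^2)"
    unfolding iid_sum_second_moment[OF diag_centered(1,2)]
  proof (rule mult_mono[OF diag_centered(3)])
    show "(\<Sum>i=1..n. ((?b i)^2)^2) \<le> n * (A^2)^2"
      by (rule sum_square_le) (use b2 in auto)
  qed (use fourth_nonneg in \<open>auto intro!: sum_nonneg\<close>)
  also have "(\<integral>x. \<bar>?B x\<bar> \<partial>iid F n) \<le> sqrt (\<integral>x. (?B x)^2 \<partial>iid F n)"
    by (rule I.abs_expectation_le_sqrt[OF mB])
  also have "(\<integral>x. (?B x)^2 \<partial>iid F n) \<le> K_cycle * (n * (n * (A^2)^2))"
    unfolding G.ustat_second_moment G_second
  proof (rule mult_left_mono[OF _ cycle_nonneg])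
    have "(\<Sum>j=1..n. \<Sum>i=1..<j. (?b i * ?b j)^2) \<le> (\<Sum>j=1..n. \<Sum>i=1..n. (?b i * ?b j)^2)"
      by (intro sum_mono sum_mono2) auto
    also have "\<dots> \<le> (\<Sum>j=1..n. \<Sum>i=1..n. A^2 * A^2)"
      unfolding power_mult_distrib by (intro sum_mono mult_mono b2) auto
    finally show "(\<Sum>j=1..n. \<Sum>i=1..<j. (?b i * ?b j)^2) \<le> n * (n * (A^2)^2)"
      by (simp add: power2_eq_square)
  qed
  also have "sqrt (K_fourth * (n * (A^2)^2)) = A^2 * sqrt (n * K_fourth)"
    by (simp only: real_sqrt_mult real_sqrt_abs abs_power2 mult_ac)
  also have "n * (n * (A^2)^2) = (n * A^2)^2" by (simp add: power2_eq_square)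
  also have "sqrt (K_cycle * (n * A^2)^2) = A^2 * (n * sqrt K_cycle)"
    by (simp only: real_sqrt_mult real_sqrt_abs abs_mult abs_of_nat abs_power2 mult_ac)
  finally show ?thesis by (simp add: algebra_simps)
qed

lemma increment_fourth_moment:
  assumes c: "\<And>i. i \<in> {1..n} \<Longrightarrow> \<bar>c i (Suc n)\<bar> \<le> A"
  shows "(\<integral>x. (increment c n x (x (Suc n)))^4 \<partial>iid F (Suc n)) \<le> 3 * K_fourth * (n * A^2)^2"
proof -
  let ?s = "\<Sum>i=1..n. (c i (Suc n))^2"
  have s: "0 \<le> ?s" "?s \<le> n * A^2" using sum_square_le[of n "\<lambda>i. c i (Suc n)" A] c by (auto intro: sum_nonneg)
  have i: "integrable (iid F (Suc n)) (\<lambda>x. (increment c n x (x (Suc n)))^4)"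
    using increment_moment[OF u_moment4] by (simp add: has_moment_def)
  have "(\<integral>x. (increment c n x (x (Suc n)))^4 \<partial>iid F (Suc n)) =
        (\<integral>z. (\<integral>x. (increment c n x z)^4 \<partial>iid F n) \<partial>F)"
    using integral_iid_Suc'[OF i] by (simp add: increment_upd)
  also have "\<dots> \<le> (\<integral>z. (\<integral>x. (K z x)^4 \<partial>F) * (3 * ?s^2) \<partial>F)"
  proof (rule integral_mono)
    show "integrable F (\<lambda>z. (\<integral>x. (increment c n x z)^4 \<partial>iid F n))"
      using integrable_iid_Suc'[OF i] by (simp add: increment_upd)
    show "integrable F (\<lambda>z. (\<integral>x. (K z x)^4 \<partial>F) * (3 * ?s^2))" using fourth_integrable by simp
    fix z assume z: "z \<in> space F"
    have "(\<integral>x. (K x z)^4 \<partial>F) = (\<integral>x. (K z x)^4 \<partial>F)"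
      by (intro lebesgue_integral_cong refl) (simp add: K_sym z)
    then show "(\<integral>x. (increment c n x z)^4 \<partial>iid F n) \<le> (\<integral>x. (K z x)^4 \<partial>F) * (3 * ?s^2)"
      using iid_sum_fourth_moment[OF K_moment_section(2)[OF u_moment4 z] K_degenerate'[OF z], where c="\<lambda>i. c i (Suc n)" and n=n]
      by (simp add: increment_def mult_ac)
  qed
  also have "\<dots> = 3 * K_fourth * ?s^2" by (simp add: K_fourth_def)
  also have "\<dots> \<le> 3 * K_fourth * (n * A^2)^2"
    using s fourth_nonneg by (intro mult_left_mono power_mono) auto
  finally show ?thesis .
qed

end

section \<open>Central limit theorem for degenerate U-statistics\<close>

text \<open>
  From \<open>1 - a \<le> e\<^bsup>-a\<^esup> \<le> 1 / (1 + a) \<le> 1 - a + a\<^sup>2\<close>.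
\<close>

lemma exp_minus_approx:
  fixes a :: real assumes "0 \<le> a" shows "\<bar>exp (- a) - (1 - a)\<bar> \<le> a^2"
proof -
  have 1: "1 - a \<le> exp (- a)" using exp_ge_add_one_self[of "- a"] by simp
  have "exp (- a) * (1 + a) \<le> exp (- a) * exp a"
    by (intro mult_left_mono) (use exp_ge_add_one_self[of a] in auto)
  then have "exp (- a) * (1 + a) \<le> 1" by (simp flip: exp_add)
  then have "exp (- a) \<le> 1 / (1 + a)" using assms by (simp add: field_simps)
  also have "\<dots> \<le> 1 - a + a^2"
  proof -
    have "1 \<le> (1 - a + a^2) * (1 + a)" using assms
      by (simp add: algebra_simps power2_eq_square)
    then show ?thesis using assms by (simp add: pos_divide_le_eq)
  qed
  finally show ?thesis using 1 by simp
qed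

lemma telescope_step: "x - a * b = (x - a * y) + a * (y - b)" for x a b y :: complex
  by (simp add: algebra_simps)

context degenerate_kernel4
begin

definition cf :: "(nat \<Rightarrow> nat \<Rightarrow> real) \<Rightarrow> nat \<Rightarrow> real \<Rightarrow> complex" where
  "cf c n t = (CLINT x|iid F n. iexp (t * ustat c n x))"

lemma ustat_measurable[measurable]: "ustat c n \<in> borel_measurable (iid F n)"
  using ustat_moment[OF u_moment, of n n c] by (simp add: has_moment_def)

text \<open>
  Given the past, the increment is centered with variance \<open>condvar c n x\<close>, so its characteristic function is
  \<open>1 - t\<^sup>2 condvar / 2\<close> up to the third absolute moment. Replacing the random conditional variance by its mean
  and \<open>1 - a\<close> by \<open>e\<^bsup>-a\<^esup>\<close> gives the other two terms.
\<close>

lemma section_cf: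
  fixes t :: real and c :: "nat \<Rightarrow> nat \<Rightarrow> real"
  assumes x: "x \<in> space (iid F n)"
  defines "a \<equiv> t^2 * (K_second * (\<Sum>i=1..n. (c i (Suc n))^2)) / 2"
  shows "cmod ((CLINT z|F. iexp (t * increment c n x z)) - of_real (exp (- a)))
    \<le> t^2 / 2 * \<bar>condvar c n x - K_second * (\<Sum>i=1..n. (c i (Suc n))^2)\<bar>
      + \<bar>t\<bar>^3 / 6 * (\<integral>z. \<bar>increment c n x z\<bar>^3 \<partial>F) + a^2"
proof -
  let ?D = "increment c n x" and ?v = "K_second * (\<Sum>i=1..n. (c i (Suc n))^2)"
  have D: "has_moment F 4 ?D" by (rule increment_moment_section[OF u_moment4 x])
  have i1: "integrable F ?D" and i2: "integrable F (\<lambda>z. (?D z)^2)" and i3: "integrable F (\<lambda>z. \<bar>?D z\<bar>^3)"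
    using has_moment_mono[OF D, of 1] has_moment_mono[OF D, of 2] has_moment_mono[OF D, of 3]
    by (simp_all add: has_moment_1) (simp_all add: has_moment_def)
  have m: "?D \<in> borel_measurable F" using D by (simp add: has_moment_def)
  have mean: "(\<integral>z. ?D z \<partial>F) = 0" by (rule increment_mean[OF x])
  have var: "variance ?D = condvar c n x" by (simp add: mean condvar_def)
  have a0: "0 \<le> a" unfolding a_def by (intro divide_nonneg_pos mult_nonneg_nonneg second_nonneg sum_nonneg) auto
  have "char (distr F borel ?D) t = (CLINT z|F. iexp (t * ?D z))"
    unfolding char_def by (subst integral_distr) (use m in auto)
  then have "cmod ((CLINT z|F. iexp (t * ?D z)) - (1 - t^2 * condvar c n x / 2))
     \<le> t^2 / 6 * (\<integral>z. min (6 * (?D z)^2) (\<bar>t\<bar> * \<bar>?D z\<bar>^3) \<partial>F)"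
    using char_approx3'[OF m i1 i2 mean var refl, of t] by simp
  also have "\<dots> \<le> t^2 / 6 * (\<integral>z. \<bar>t\<bar> * \<bar>?D z\<bar>^3 \<partial>F)"
    using i2 i3 by (intro mult_left_mono integral_mono) auto
  also have "\<dots> = \<bar>t\<bar>^3 / 6 * (\<integral>z. \<bar>?D z\<bar>^3 \<partial>F)"
    by (simp add: power3_eq_cube power2_eq_square)
  finally have 1: "cmod ((CLINT z|F. iexp (t * ?D z)) - (1 - t^2 * condvar c n x / 2))
      \<le> \<bar>t\<bar>^3 / 6 * (\<integral>z. \<bar>?D z\<bar>^3 \<partial>F)" .
  have "cmod (of_real (1 - t^2 * condvar c n x / 2) - of_real (exp (- a))) = \<bar>(1 - t^2 * condvar c n x / 2) - exp (- a)\<bar>"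
    by (simp only: of_real_diff[symmetric] norm_of_real)
  also have "\<dots> \<le> \<bar>t^2 / 2 * (condvar c n x - ?v)\<bar> + \<bar>exp (- a) - (1 - a)\<bar>"
    unfolding a_def by (simp add: right_diff_distrib)
  also have "\<dots> \<le> t^2 / 2 * \<bar>condvar c n x - ?v\<bar> + a^2"
    using exp_minus_approx[OF a0] by (simp add: abs_mult)
  finally have 2: "cmod (of_real (1 - t^2 * condvar c n x / 2) - of_real (exp (- a)))
    \<le> t^2 / 2 * \<bar>condvar c n x - ?v\<bar> + a^2" .
  from norm_triangle_ineq[of "(CLINT z|F. iexp (t * ?D z)) - of_real (1 - t^2 * condvar c n x / 2)"
       "of_real (1 - t^2 * condvar c n x / 2) - of_real (exp (- a))"] 1 2
  show ?thesis by simp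
qed

lemma cf_step:
  fixes t :: real and c :: "nat \<Rightarrow> nat \<Rightarrow> real"
  defines "a \<equiv> \<lambda>n. t^2 * (K_second * (\<Sum>i=1..n. (c i (Suc n))^2)) / 2"
  shows "cmod (cf c (Suc n) t - of_real (exp (- a n)) * cf c n t)
    \<le> t^2 / 2 * (\<integral>x. \<bar>condvar c n x - K_second * (\<Sum>i=1..n. (c i (Suc n))^2)\<bar> \<partial>iid F n)
      + \<bar>t\<bar>^3 / 6 * (\<integral>x. \<bar>increment c n x (x (Suc n))\<bar>^3 \<partial>iid F (Suc n)) + (a n)^2"
proof -
  interpret I: prob_space "iid F n" by (rule prob_space_iid) unfold_locales
  interpret J: prob_space "iid F (Suc n)" by (rule prob_space_iid) unfold_locales
  let ?D = "increment c n" and ?v = "K_second * (\<Sum>i=1..n. (c i (Suc n))^2)"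
  let ?\<psi> = "\<lambda>x. CLINT z|F. iexp (t * ?D x z)"
  let ?B = "\<lambda>x. t^2 / 2 * \<bar>condvar c n x - ?v\<bar> + \<bar>t\<bar>^3 / 6 * (\<integral>z. \<bar>?D x z\<bar>^3 \<partial>F) + (a n)^2"
  have i: "integrable (iid F (Suc n)) (\<lambda>x. iexp (t * ustat c (Suc n) x))"
    by (rule J.integrable_const_bound[of _ 1]) (auto intro!: AE_I2)
  have split: "(CLINT z|F. iexp (t * ustat c (Suc n) (x(Suc n := z)))) = iexp (t * ustat c n x) * ?\<psi> x" for x
    by (simp add: ustat_Suc ustat_upd increment_upd distrib_left exp_add)
  have e: "cf c (Suc n) t = (CLINT x|iid F n. iexp (t * ustat c n x) * ?\<psi> x)"
    unfolding cf_def integral_iid_Suc[OF i] split ..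
  have i\<psi>: "integrable (iid F n) (\<lambda>x. iexp (t * ustat c n x) * ?\<psi> x)"
    using integrable_iid_Suc[OF i] unfolding split .
  have iS: "integrable (iid F n) (\<lambda>x. iexp (t * ustat c n x))"
    by (rule I.integrable_const_bound[of _ 1]) (auto intro!: AE_I2)
  have i3: "integrable (iid F (Suc n)) (\<lambda>x. \<bar>?D x (x (Suc n))\<bar>^3)"
    using J.has_moment_mono[OF increment_moment[OF u_moment4, of n c], of 3] by (simp add: has_moment_def)
  have i3': "integrable (iid F n) (\<lambda>x. \<integral>z. \<bar>?D x z\<bar>^3 \<partial>F)"
    using integrable_iid_Suc[OF i3] by (simp add: increment_upd)
  have e3: "(\<integral>x. \<bar>?D x (x (Suc n))\<bar>^3 \<partial>iid F (Suc n)) = (\<integral>x. (\<integral>z. \<bar>?D x z\<bar>^3 \<partial>F) \<partial>iid F n)"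
    using integral_iid_Suc[OF i3] by (simp add: increment_upd)
  have eq: "cf c (Suc n) t - of_real (exp (- a n)) * cf c n t
      = (CLINT x|iid F n. iexp (t * ustat c n x) * (?\<psi> x - of_real (exp (- a n))))"
  proof -
    let ?E = "complex_of_real (exp (- a n))" and ?f = "\<lambda>x. iexp (t * ustat c n x)"
    have "(CLINT x|iid F n. ?f x * (?\<psi> x - ?E)) = (CLINT x|iid F n. ?f x * ?\<psi> x - ?E * ?f x)"
      by (simp only: right_diff_distrib mult.commute[of _ ?E])
    also have "\<dots> = (CLINT x|iid F n. ?f x * ?\<psi> x) - (CLINT x|iid F n. ?E * ?f x)"
      by (rule Bochner_Integration.integral_diff[OF i\<psi> integrable_mult_right[OF iS]])
    also have "(CLINT x|iid F n. ?E * ?f x) = ?E * cf c n t"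
      unfolding cf_def by (rule integral_mult_right_zero)
    finally show ?thesis unfolding e ..
  qed
  have "cmod (cf c (Suc n) t - of_real (exp (- a n)) * cf c n t) \<le> (\<integral>x. ?B x \<partial>iid F n)"
    unfolding eq
  proof (rule order_trans[OF integral_norm_bound integral_mono])
    show "integrable (iid F n) (\<lambda>x. cmod (iexp (t * ustat c n x) * (?\<psi> x - of_real (exp (- a n)))))"
      using i\<psi> iS by (intro integrable_norm) (simp add: right_diff_distrib)
    show "integrable (iid F n) ?B" using condvar_moment[of n c] i3' by simp
    fix x assume "x \<in> space (iid F n)"
    from section_cf[OF this, of t c]
    show "cmod (iexp (t * ustat c n x) * (?\<psi> x - of_real (exp (- a n)))) \<le> ?B x"
      by (simp add: norm_mult a_def)
  qed
  also have "\<dots> = t^2 / 2 * (\<integral>x. \<bar>condvar c n x - ?v\<bar> \<partial>iid F n)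
      + \<bar>t\<bar>^3 / 6 * (\<integral>x. \<bar>?D x (x (Suc n))\<bar>^3 \<partial>iid F (Suc n)) + (a n)^2"
    unfolding e3
  proof -
    have i1: "integrable (iid F n) (\<lambda>x. t^2 / 2 * \<bar>condvar c n x - ?v\<bar>)"
      using condvar_moment[of n c] by (intro integrable_mult_right integrable_abs Bochner_Integration.integrable_diff) auto
    have i2: "integrable (iid F n) (\<lambda>x. \<bar>t\<bar>^3 / 6 * (\<integral>z. \<bar>?D x z\<bar>^3 \<partial>F))"
      using i3' by (rule integrable_mult_right)
    show "(\<integral>x. ?B x \<partial>iid F n) = t^2 / 2 * (\<integral>x. \<bar>condvar c n x - ?v\<bar> \<partial>iid F n)
      + \<bar>t\<bar>^3 / 6 * (\<integral>x. (\<integral>z. \<bar>?D x z\<bar>^3 \<partial>F) \<partial>iid F n) + (a n)^2"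
      unfolding Bochner_Integration.integral_add[OF Bochner_Integration.integrable_add[OF i1 i2] I.integrable_const]
        Bochner_Integration.integral_add[OF i1 i2] by (simp only: integral_mult_right_zero) (simp add: I.prob_space)
  qed
  finally show ?thesis .
qed

text \<open>
  One-step errors add up without amplification because the factors \<open>e\<^bsup>-a\<^esup>\<close> are at most one.
\<close>

lemma cf_telescope:
  fixes t :: real and c :: "nat \<Rightarrow> nat \<Rightarrow> real"
  defines "a \<equiv> \<lambda>n. t^2 * (K_second * (\<Sum>i=1..n. (c i (Suc n))^2)) / 2"
  assumes step: "\<And>m. m < n \<Longrightarrow> cmod (cf c (Suc m) t - of_real (exp (- a m)) * cf c m t) \<le> \<epsilon>"
  shows "cmod (cf c n t - of_real (exp (- (t^2 * (K_second * (\<Sum>j=1..n. \<Sum>i=1..<j. (c i j)^2)) / 2)))) \<le> n * \<epsilon>"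
  using step
proof (induction n)
  case 0
  interpret I: prob_space "iid F 0" by (rule prob_space_iid) unfold_locales
  show ?case using I.prob_space by (simp add: cf_def ustat_def)
next
  case (Suc n)
  let ?s = "\<lambda>n. t^2 * (K_second * (\<Sum>j=1..n. \<Sum>i=1..<j. (c i j)^2)) / 2"
  have a0: "0 \<le> a n" unfolding a_def by (intro divide_nonneg_pos mult_nonneg_nonneg second_nonneg sum_nonneg) auto
  have s: "?s (Suc n) = a n + ?s n"
    by (simp add: a_def atLeastLessThanSuc_atLeastAtMost distrib_left add_divide_distrib)
  have ex: "complex_of_real (exp (- ?s (Suc n))) = of_real (exp (- a n)) * of_real (exp (- ?s n))"
    unfolding s minus_add_distrib exp_add of_real_mult ..
  have eq: "cf c (Suc n) t - of_real (exp (- ?s (Suc n))) =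
     (cf c (Suc n) t - of_real (exp (- a n)) * cf c n t) + of_real (exp (- a n)) * (cf c n t - of_real (exp (- ?s n)))"
    unfolding ex by (rule telescope_step)
  have "cmod (cf c (Suc n) t - of_real (exp (- ?s (Suc n)))) \<le> cmod (cf c (Suc n) t - of_real (exp (- a n)) * cf c n t) + cmod (of_real (exp (- a n)) * (cf c n t - of_real (exp (- ?s n))))"
    unfolding eq by (rule norm_triangle_ineq)
  also have "\<dots> \<le> \<epsilon> + 1 * (n * \<epsilon>)"
  proof (rule add_mono)
    show "cmod (of_real (exp (- a n)) * (cf c n t - of_real (exp (- ?s n)))) \<le> 1 * (n * \<epsilon>)"
    proof -
      have "cmod (cf c n t - of_real (exp (- ?s n))) \<le> n * \<epsilon>" by (rule Suc.IH) (rule Suc.prems, simp)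
      then show ?thesis unfolding norm_mult using a0 by (intro mult_mono) auto
    qed
  qed (use Suc.prems in auto)
  finally show ?case by (simp add: algebra_simps)
qed

text \<open>
  Quantitative central limit theorem: a weighted degenerate U-statistic of unit variance whose weights are
  bounded by \<open>C / (N \<surd>(E K\<^sup>2))\<close> is close to a standard normal variable when \<open>\<rho>\<close>, \<open>\<gamma>\<close> and \<open>1/N\<close> are small.
\<close>

theorem cf_bound:
  fixes t C :: real
  assumes N: "N \<ge> 1" and K2: "K_second > 0" and C: "C > 0"
    and c: "\<And>i j. 1 \<le> i \<Longrightarrow> i < j \<Longrightarrow> j \<le> N \<Longrightarrow> \<bar>c i j\<bar> \<le> C / (N * sqrt K_second)"
    and norm: "K_second * (\<Sum>j=1..N. \<Sum>i=1..<j. (c i j)^2) = 1"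
  defines "\<rho> \<equiv> K_fourth / (N * K_second^2)" and "\<gamma> \<equiv> K_cycle / K_second^2"
  shows "cmod (cf c N t - of_real (exp (- (t^2 / 2))))
    \<le> t^2 / 2 * (C^2 * (sqrt \<rho> + 2 * sqrt \<gamma>)) + \<bar>t\<bar>^3 / 6 * (sqrt 3 * C^3 * sqrt \<rho>) + t^4 * C^4 / (4 * real N)"
proof -
  define A where "A = C / (N * sqrt K_second)"
  have A: "A > 0" using N K2 C by (simp add: A_def)
  have A2: "A^2 = C^2 / (N^2 * K_second)" unfolding A_def power_divide power_mult_distrib using K2 by simp
  have NA: "N * A^2 = C^2 / (N * K_second)" unfolding A2 using N by (simp add: power2_eq_square)
  have K4: "K_fourth > 0" using second_sq_le_fourth K2 by (smt (verit) zero_less_power)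
  have N0: "real N > 0" using N by simp
  \<comment> \<open>bounds for the three error terms of a single step, uniform in the step\<close>
  define \<epsilon>1 where "\<epsilon>1 = C^2 * (sqrt \<rho> + 2 * sqrt \<gamma>) / N"
  define \<epsilon>2 where "\<epsilon>2 = sqrt 3 * C^3 * sqrt \<rho> / N"
  define \<epsilon>3 where "\<epsilon>3 = (t^2 * C^2 / (2 * N))^2"
  have step: "cmod (cf c (Suc m) t - of_real (exp (- (t^2 * (K_second * (\<Sum>i=1..m. (c i (Suc m))^2)) / 2))) * cf c m t)
     \<le> t^2 / 2 * \<epsilon>1 + \<bar>t\<bar>^3 / 6 * \<epsilon>2 + \<epsilon>3" if m: "m < N" for m
  proof -
    interpret J: prob_space "iid F (Suc m)" by (rule prob_space_iid) unfold_locales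
    let ?s = "\<Sum>i=1..m. (c i (Suc m))^2"
    have cA: "\<bar>c i (Suc m)\<bar> \<le> A" if "i \<in> {1..m}" for i using c[of i "Suc m"] that m by (auto simp: A_def)
    have s: "0 \<le> ?s" "?s \<le> N * A^2"
    proof -
      have "?s \<le> m * A^2" by (rule sum_square_le) (rule cA)
      also have "\<dots> \<le> N * A^2" using m by (intro mult_right_mono) auto
      finally show "?s \<le> N * A^2" .
    qed (auto intro: sum_nonneg)
    have v: "0 \<le> K_second * ?s" "K_second * ?s \<le> C^2 / N"
    proof -
      have "K_second * ?s \<le> K_second * (N * A^2)" using s K2 by (intro mult_left_mono) auto
      then show "K_second * ?s \<le> C^2 / N" unfolding NA using K2 by (simp add: field_simps)
    qed (use s K2 in auto)
    have 1: "(\<integral>x. \<bar>condvar c m x - K_second * ?s\<bar> \<partial>iid F m) \<le> \<epsilon>1"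
    proof -
      have "(\<integral>x. \<bar>condvar c m x - K_second * ?s\<bar> \<partial>iid F m) \<le> A^2 * (sqrt (m * K_fourth) + 2 * real m * sqrt K_cycle)"
        by (rule condvar_deviation) (rule cA)
      also have "\<dots> \<le> A^2 * (sqrt (N * K_fourth) + 2 * real N * sqrt K_cycle)"
        using m fourth_nonneg cycle_nonneg
        by (intro mult_left_mono add_mono real_sqrt_le_mono mult_right_mono mult_mono) auto
      also have "\<dots> = \<epsilon>1"
      proof -
        have r: "sqrt \<rho> = sqrt (N * K_fourth) / (N * K_second)" "sqrt \<gamma> = sqrt K_cycle / K_second"
          using N0 K2 unfolding \<rho>_def \<gamma>_def
          by (simp_all add: real_sqrt_divide real_sqrt_mult real_div_sqrt field_simps)
        show ?thesis unfolding \<epsilon>1_def r A2 using N0 K2 by (simp add: field_simps power2_eq_square)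
      qed
      finally show ?thesis .
    qed
    have 2: "(\<integral>x. \<bar>increment c m x (x (Suc m))\<bar>^3 \<partial>iid F (Suc m)) \<le> \<epsilon>2"
    proof -
      have "(\<integral>x. \<bar>increment c m x (x (Suc m))\<bar>^3 \<partial>iid F (Suc m)) \<le> sqrt ((C^2 / N) * (3 * K_fourth * (N * A^2)^2))"
      proof (rule J.third_moment_le)
        show "has_moment (iid F (Suc m)) 4 (\<lambda>x. increment c m x (x (Suc m)))" by (rule increment_moment[OF u_moment4])
        show "(\<integral>x. (increment c m x (x (Suc m)))^2 \<partial>iid F (Suc m)) \<le> C^2 / N"
          unfolding increment_second_moment by (rule v)
        have "(\<integral>x. (increment c m x (x (Suc m)))^4 \<partial>iid F (Suc m)) \<le> 3 * K_fourth * (m * A^2)^2"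
          by (rule increment_fourth_moment) (rule cA)
        also have "\<dots> \<le> 3 * K_fourth * (N * A^2)^2"
          using m fourth_nonneg by (intro mult_left_mono power_mono mult_right_mono) auto
        finally show "(\<integral>x. (increment c m x (x (Suc m)))^4 \<partial>iid F (Suc m)) \<le> 3 * K_fourth * (N * A^2)^2" .
      qed (use N0 C K4 A in auto)
      also have "(C^2 / N) * (3 * K_fourth * (N * A^2)^2) = 3 * (C^3)^2 * \<rho> / N^2"
        unfolding NA \<rho>_def using N0 K2 by (simp add: field_simps power2_eq_square power3_eq_cube)
      also have "sqrt \<dots> = \<epsilon>2"
        unfolding \<epsilon>2_def real_sqrt_mult real_sqrt_divide real_sqrt_abs using C N0 by simp
      finally show ?thesis .
    qed
    have 3: "(t^2 * (K_second * ?s) / 2)^2 \<le> \<epsilon>3"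
      unfolding \<epsilon>3_def
    proof (rule power_mono)
      have "t^2 * (K_second * ?s) / 2 \<le> t^2 * (C^2 / N) / 2"
        using v by (intro divide_right_mono mult_left_mono) auto
      then show "t^2 * (K_second * ?s) / 2 \<le> t^2 * C^2 / (2 * N)" by simp
    qed (use v in auto)
    show ?thesis
      using 1 2 3 by (intro order_trans[OF cf_step] add_mono mult_left_mono) auto
  qed
  have "cmod (cf c N t - of_real (exp (- (t^2 / 2)))) \<le> N * (t^2 / 2 * \<epsilon>1 + \<bar>t\<bar>^3 / 6 * \<epsilon>2 + \<epsilon>3)"
    using cf_telescope[of N c t, OF step] by (simp add: norm)
  also have "\<dots> = t^2 / 2 * (C^2 * (sqrt \<rho> + 2 * sqrt \<gamma>)) + \<bar>t\<bar>^3 / 6 * (sqrt 3 * C^3 * sqrt \<rho>) + t^4 * C^4 / (4 * real N)"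
    unfolding \<epsilon>1_def \<epsilon>2_def \<epsilon>3_def using N0 by (simp add: field_simps power2_eq_square power4_eq_xxxx)
  finally show ?thesis .
qed

end

section \<open>The bias-corrected variance estimator\<close>

text \<open>
  Off the diagonal \<open>B\<close> is \<open>e\<close> minus an additive matrix \<open>r\<^sub>k + r\<^sub>l\<close>, and its off-diagonal row sums vanish. Hence
  \<open>B\<close> is orthogonal to additive matrices and \<open>\<Sum> B\<^sup>2 = \<Sum> B e\<close>, which is linear in \<open>B\<close>.
\<close>

lemma u_centering:
  fixes e :: "nat \<Rightarrow> nat \<Rightarrow> real"
  assumes n: "n \<ge> 4" and sym: "\<And>i j. e i j = e j i" and diag: "\<And>i. e i i = 0"
  defines "R \<equiv> \<lambda>k. \<Sum>j=1..n. e k j" and "T \<equiv> \<Sum>i=1..n. \<Sum>j=1..n. e i j"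
  defines "B \<equiv> \<lambda>k l. e k l - R k / (real n - 2) - R l / (real n - 2) + T / ((real n - 1) * (real n - 2))"
  shows "(\<Sum>k=1..n. \<Sum>l\<in>{1..n} - {k}. (B k l)^2) =
     (\<Sum>k=1..n. \<Sum>l=1..n. (e k l)^2) - 2 / (real n - 2) * (\<Sum>k=1..n. (R k)^2) + T^2 / ((real n - 1) * (real n - 2))"
proof -
  \<comment> \<open>\<open>r\<close> is the additive part that the centering subtracts\<close>
  define \<alpha> where "\<alpha> = 1 / (real n - 2)"
  define \<beta> where "\<beta> = T / ((real n - 1) * (real n - 2))"
  define r where "r k = \<alpha> * R k - \<beta> / 2" for k
  have T: "T = (\<Sum>k=1..n. R k)" by (simp add: T_def R_def)
  have \<alpha>: "\<alpha> * (real n - 2) = 1" using n by (simp add: \<alpha>_def)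
  have \<beta>: "\<beta> * (real n - 1) = \<alpha> * T" using n by (simp add: \<alpha>_def \<beta>_def)
  have B: "B k l = e k l - r k - r l" for k l
    by (simp add: B_def r_def \<alpha>_def \<beta>_def)
  have B_sym: "B k l = B l k" for k l unfolding B using sym[of k l] by simp
  have row: "(\<Sum>l\<in>{1..n} - {k}. B k l) = 0" if k: "k \<in> {1..n}" for k
  proof -
    have "(\<Sum>l\<in>{1..n} - {k}. B k l) = (\<Sum>l=1..n. B k l) - B k k" using k by (subst sum_diff1) auto
    also have "(\<Sum>l=1..n. B k l) = (\<Sum>l=1..n. e k l) - n * r k - (\<Sum>l=1..n. r l)"
      by (simp add: B sum_subtractf)
    also have "(\<Sum>l=1..n. r l) = \<alpha> * T - n * (\<beta> / 2)"
      by (simp add: r_def sum_subtractf T sum_distrib_left)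
    also have "(\<Sum>l=1..n. e k l) = R k" by (simp add: R_def)
    also have "R k - n * r k - (\<alpha> * T - n * (\<beta> / 2)) - B k k = R k * (1 - \<alpha> * (real n - 2)) + (\<beta> * (real n - 1) - \<alpha> * T)"
      unfolding B diag r_def by (simp add: algebra_simps)
    finally show ?thesis using \<alpha> \<beta> by simp
  qed
  have z1: "(\<Sum>k=1..n. \<Sum>l\<in>{1..n} - {k}. B k l * r k) = 0"
    unfolding sum_distrib_right[symmetric] by (intro sum.neutral ballI) (simp add: row)
  have off: "(\<Sum>l\<in>{1..n} - {k}. f l) = (\<Sum>l=1..n. if l = k then 0 else f l)" for k and f :: "nat \<Rightarrow> real"
    by (rule sum.mono_neutral_cong_left) auto
  have "(\<Sum>k=1..n. \<Sum>l\<in>{1..n} - {k}. B k l * r l) = (\<Sum>k=1..n. \<Sum>l\<in>{1..n} - {k}. B k l * r k)"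
    unfolding off by (subst sum.swap) (intro sum.cong refl if_cong, auto simp: B_sym)
  then have z2: "(\<Sum>k=1..n. \<Sum>l\<in>{1..n} - {k}. B k l * r l) = 0" using z1 by simp
  have "(\<Sum>k=1..n. \<Sum>l\<in>{1..n} - {k}. (B k l)^2)
     = (\<Sum>k=1..n. \<Sum>l\<in>{1..n} - {k}. B k l * e k l - B k l * r k - B k l * r l)"
    by (intro sum.cong refl) (simp add: power2_eq_square B algebra_simps)
  also have "\<dots> = (\<Sum>k=1..n. \<Sum>l\<in>{1..n} - {k}. B k l * e k l)"
    using z1 z2 by (simp add: sum_subtractf)
  also have "\<dots> = (\<Sum>k=1..n. \<Sum>l=1..n. B k l * e k l)"
    by (intro sum.cong refl sum.mono_neutral_left) (auto simp: diag)
  also have "\<dots> = (\<Sum>k=1..n. (\<Sum>l=1..n. (e k l)^2) - \<alpha> * (R k * (\<Sum>l=1..n. e k l)) - \<alpha> * (\<Sum>l=1..n. R l * e k l) + \<beta> * (\<Sum>l=1..n. e k l))"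
    unfolding B r_def
    by (intro sum.cong refl)
       (simp add: sum_distrib_left sum_distrib_right sum_subtractf sum.distrib power2_eq_square algebra_simps)
  also have "\<dots> = (\<Sum>k=1..n. \<Sum>l=1..n. (e k l)^2) - \<alpha> * (\<Sum>k=1..n. (R k)^2) - \<alpha> * (\<Sum>k=1..n. \<Sum>l=1..n. R l * e k l) + \<beta> * T"
    unfolding T by (simp add: sum_subtractf sum.distrib sum_distrib_left power2_eq_square R_def)
  also have "(\<Sum>k=1..n. \<Sum>l=1..n. R l * e k l) = (\<Sum>l=1..n. (R l)^2)"
  proof -
    have "(\<Sum>k=1..n. e k l) = R l" for l unfolding R_def by (intro sum.cong refl sym)
    then show ?thesis by (subst sum.swap) (simp add: power2_eq_square flip: sum_distrib_left)
  qed
  finally show ?thesis using n by (simp add: \<alpha>_def \<beta>_def power2_eq_square)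
qed

context degenerate_kernel4
begin

text \<open>
  A symmetric matrix for all arguments: the kernel is symmetric only on the space of \<open>F\<close>, whereas the
  algebraic identities below hold for arbitrary points.
\<close>

definition offdiag :: "(nat \<Rightarrow> 'b) \<Rightarrow> nat \<Rightarrow> nat \<Rightarrow> real" where
  "offdiag x i j = (if i = j then 0 else K (x (min i j)) (x (max i j)))"

definition row_sum :: "nat \<Rightarrow> (nat \<Rightarrow> 'b) \<Rightarrow> nat \<Rightarrow> real" where
  "row_sum n x k = (\<Sum>j=1..n. offdiag x k j)"

abbreviation "square_sum n x \<equiv> (\<Sum>k=1..n. \<Sum>l=1..n. (offdiag x k l)^2)"

abbreviation "pair_total n x \<equiv> (\<Sum>i=1..n. \<Sum>j=1..n. offdiag x i j)"

text \<open>
  The right-hand side of \<open>u_centering\<close> for the kernel matrix, divided by \<open>n (n - 3)\<close>.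
\<close>

definition vstat :: "nat \<Rightarrow> (nat \<Rightarrow> 'b) \<Rightarrow> real" where
  "vstat n x = (square_sum n x - 2 / (real n - 2) * (\<Sum>k=1..n. (row_sum n x k)^2)
     + pair_total n x^2 / ((real n - 1) * (real n - 2))) / (real n * (real n - 3))"

lemma offdiag_sym: "offdiag x i j = offdiag x j i"
  by (simp add: offdiag_def min.commute max.commute)

lemma offdiag_diag[simp]: "offdiag x i i = 0" by (simp add: offdiag_def)

lemma offdiag_less[simp]: "i < j \<Longrightarrow> offdiag x i j = K (x i) (x j)" by (simp add: offdiag_def)

lemma row_sum_ustat:
  assumes k: "k \<in> {1..n}"
  shows "row_sum n x k = ustat (\<lambda>i j. of_bool (i = k) + of_bool (j = k)) n x"
proof -
  let ?d = "\<lambda>i. of_bool (i = k) :: real"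
  have "(\<Sum>i=1..n. \<Sum>j=1..n. (?d i + ?d j) * offdiag x i j)
     = (\<Sum>i=1..n. (?d i + ?d i) * offdiag x i i) + 2 * (\<Sum>j=1..n. \<Sum>i=1..<j. (?d i + ?d j) * offdiag x i j)"
    by (rule double_sum_symmetric) (simp add: offdiag_sym)
  also have "(\<Sum>j=1..n. \<Sum>i=1..<j. (?d i + ?d j) * offdiag x i j) = ustat (\<lambda>i j. ?d i + ?d j) n x"
    unfolding ustat_def by (intro sum.cong refl) auto
  finally have 1: "(\<Sum>i=1..n. \<Sum>j=1..n. (?d i + ?d j) * offdiag x i j) = 2 * ustat (\<lambda>i j. ?d i + ?d j) n x" by simp
  have 2: "(\<Sum>i=1..n. \<Sum>j=1..n. ?d i * offdiag x i j) = row_sum n x k"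
    using k unfolding row_sum_def sum_distrib_left[symmetric] by (simp add: of_bool_def if_distrib[of "\<lambda>x. x * _"] sum.delta cong: if_cong)
  have "(\<Sum>i=1..n. \<Sum>j=1..n. ?d j * offdiag x i j) = row_sum n x k"
    by (subst sum.swap, subst 2[symmetric]) (simp add: offdiag_sym)
  then have "(\<Sum>i=1..n. \<Sum>j=1..n. (?d i + ?d j) * offdiag x i j) = 2 * row_sum n x k"
    using 2 by (simp add: distrib_right sum.distrib)
  then show ?thesis using 1 by simp
qed

lemma total_ustat: "pair_total n x = 2 * ustat (\<lambda>_ _. 1) n x"
proof -
  have "pair_total n x = (\<Sum>i=1..n. offdiag x i i) + 2 * (\<Sum>j=1..n. \<Sum>i=1..<j. offdiag x i j)"
    by (rule double_sum_symmetric) (rule offdiag_sym)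
  also have "(\<Sum>j=1..n. \<Sum>i=1..<j. offdiag x i j) = ustat (\<lambda>_ _. 1) n x"
    unfolding ustat_def by (intro sum.cong refl) auto
  finally show ?thesis by simp
qed

text \<open>
  The degenerate part in the Hoeffding decomposition of the squared kernel.
\<close>

definition sq_kernel :: "'b \<Rightarrow> 'b \<Rightarrow> real" where
  "sq_kernel x y = (K x y)^2 - G x x - G y y + K_second"

definition "sq_bound x = 2 * (u x)^2 + 2 * Gu x + \<bar>K_second\<bar>"

lemma sq_bound_moment: "has_moment F 2 sq_bound"
proof -
  have "has_moment F 2 (\<lambda>x. u x * u x)" by (rule has_moment_mult) (use u_moment4 in auto)
  then show ?thesis unfolding sq_bound_def power2_eq_square
    by (intro has_moment_add has_moment_const has_moment_cmult Gu_moment)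
qed

lemma sq_kernel_bound:
  assumes x: "x \<in> space F" and y: "y \<in> space F"
  shows "\<bar>sq_kernel x y\<bar> \<le> sq_bound x + sq_bound y"
proof -
  have "(K x y)^2 \<le> (u x + u y)^2"
    using K_bound[OF x y] by (metis abs_ge_zero power2_abs power_mono)
  also have "\<dots> \<le> 2 * (u x)^2 + 2 * (u y)^2"
    using sum_squares_bound[of "u x" "u y"] by (simp add: power2_sum)
  finally have 1: "(K x y)^2 \<le> 2 * (u x)^2 + 2 * (u y)^2" .
  have 2: "0 \<le> (K x y)^2" "0 \<le> (u x)^2" "0 \<le> (u y)^2" by auto
  show ?thesis
    using 1 2 G_diag_bound[OF x] G_diag_bound[OF y] second_nonneg unfolding sq_kernel_def sq_bound_def by linarith
qed

sublocale sq_kernel: degenerate_kernel F sq_kernel sq_bound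
proof
  show "(\<lambda>(x, y). sq_kernel x y) \<in> borel_measurable (F \<Otimes>\<^sub>M F)"
    unfolding sq_kernel_def case_prod_unfold by measurable
  show "sq_kernel x y = sq_kernel y x" if "x \<in> space F" "y \<in> space F" for x y
    using K_sym[OF that] by (simp add: sq_kernel_def)
  show "(\<integral>z. sq_kernel x z \<partial>F) = 0" if x: "x \<in> space F" for x
  proof -
    have "integrable F (\<lambda>z. G z z)" using has_moment_mono[OF diag_moment, of 1] by (simp add: has_moment_1)
    then show ?thesis
      using section_integrable[OF x, of 2] unfolding sq_kernel_def
      by (simp add: prob_space diag_mean G_diag[of x])
  qed
qed (use sq_kernel_bound sq_bound_moment in auto)

lemma sq_kernel_second_le: "sq_kernel.K_second \<le> 16 * K_fourth"
proof -
  have d: "integrable F (\<lambda>x. (G x x)^2)" using diag_moment by (simp add: has_moment_def)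
  have pt: "(sq_kernel x y)^2 \<le> 4 * ((K x y)^4 + (G x x)^2 + (G y y)^2 + K_second^2)" for x y
  proof -
    have "(a - b - c + d)^2 \<le> 4 * (a^2 + b^2 + c^2 + d^2)" for a b c d :: real
    proof -
      have "4 * (a^2 + b^2 + c^2 + d^2) - (a - b - c + d)^2
         = (a + b)^2 + (a + c)^2 + (a - d)^2 + (b - c)^2 + (b + d)^2 + (c + d)^2"
        by (simp add: power2_eq_square algebra_simps)
      then show ?thesis by (smt (verit) zero_le_power2)
    qed
    from this[of "(K x y)^2" "G x x" "G y y" K_second] show ?thesis
      by (simp add: sq_kernel_def flip: power_mult)
  qed
  let ?g = "\<lambda>x. 4 * ((\<integral>z. (K x z)^4 \<partial>F) + (G x x)^2 + (\<integral>y. (G y y)^2 \<partial>F) + K_second^2)"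
  have inner: "(\<integral>z. (sq_kernel x z)^2 \<partial>F) \<le> ?g x" if x: "x \<in> space F" for x
  proof -
    have "(\<integral>z. (sq_kernel x z)^2 \<partial>F) \<le> (\<integral>z. 4 * ((K x z)^4 + (G x x)^2 + (G z z)^2 + K_second^2) \<partial>F)"
    proof (rule integral_mono)
      show "integrable F (\<lambda>z. (sq_kernel x z)^2)"
        using sq_kernel.K_moment_section(1)[OF sq_bound_moment x] by (simp add: has_moment_def)
    qed (use d section_integrable[OF x, of 4] pt in auto)
    also have "\<dots> = ?g x" using d section_integrable[OF x, of 4] by (simp add: prob_space)
    finally show ?thesis .
  qed
  have "sq_kernel.K_second \<le> (\<integral>x. ?g x \<partial>F)"
    unfolding sq_kernel.K_second_def
  proof (rule integral_mono)
    have "integrable (iid F (Suc 1)) (\<lambda>v. (sq_kernel (v 1) (v 2))^2)"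
      unfolding Suc_1 using sq_kernel.K_moment_iid[OF sq_bound_moment, of 1 2 2] by (simp add: has_moment_def)
    from integrable_iid_Suc[OF this]
    have "integrable (iid F 1) (\<lambda>v. (\<integral>z. (sq_kernel (v 1) z)^2 \<partial>F))" by simp
    then have "integrable (distr (iid F 1) F (\<lambda>v. v 1)) (\<lambda>x. \<integral>z. (sq_kernel x z)^2 \<partial>F)"
      by (subst integrable_distr_eq) auto
    then show "integrable F (\<lambda>x. \<integral>z. (sq_kernel x z)^2 \<partial>F)" by (subst (asm) iid_component) auto
  qed (use d fourth_integrable inner in auto)
  also have "\<dots> = 4 * (K_fourth + (\<integral>x. (G x x)^2 \<partial>F) + (\<integral>y. (G y y)^2 \<partial>F) + K_second^2)"
    using d fourth_integrable by (simp add: prob_space K_fourth_def)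
  also have "\<dots> \<le> 16 * K_fourth" using diag_second_moment second_sq_le_fourth by simp
  finally show ?thesis .
qed

lemma sum_pairs: "(\<Sum>j=1..n. \<Sum>i=1..<j. q i + q j) = (real n - 1) * (\<Sum>i=1..n. q i)" for q :: "nat \<Rightarrow> real"
proof (induction n)
  case (Suc n)
  then show ?case by (simp add: atLeastLessThanSuc_atLeastAtMost sum.distrib algebra_simps)
qed simp

lemma square_sum_decomp:
  "square_sum n x - n * (real n - 1) * K_second
    = 2 * (sq_kernel.ustat (\<lambda>_ _. 1) n x + (real n - 1) * (\<Sum>i=1..n. 1 * (G (x i) (x i) - K_second)))"
proof -
  have "square_sum n x = (\<Sum>k=1..n. (offdiag x k k)^2) + 2 * (\<Sum>j=1..n. \<Sum>i=1..<j. (offdiag x i j)^2)"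
    by (rule double_sum_symmetric) (metis offdiag_sym)
  also have "(\<Sum>j=1..n. \<Sum>i=1..<j. (offdiag x i j)^2) = (\<Sum>j=1..n. \<Sum>i=1..<j. (K (x i) (x j))^2)"
    by (intro sum.cong refl) auto
  also have "(\<Sum>k=1..n. (offdiag x k k)^2) = 0" by simp
  also have "(\<Sum>j=1..n. \<Sum>i=1..<j. (K (x i) (x j))^2) = (\<Sum>j=1..n. \<Sum>i=1..<j. sq_kernel (x i) (x j)
      + ((G (x i) (x i) - K_second) + (G (x j) (x j) - K_second)) + (K_second / 2 + K_second / 2))"
    by (intro sum.cong refl) (simp add: sq_kernel_def)
  also have "\<dots> = sq_kernel.ustat (\<lambda>_ _. 1) n x + (real n - 1) * (\<Sum>i=1..n. G (x i) (x i) - K_second)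
     + (real n - 1) * (\<Sum>i=1..n. K_second / 2)"
    unfolding sum.distrib[of _ "\<lambda>i. K_second / 2 + K_second / 2"]
    using sum_pairs[of "\<lambda>i. G (x i) (x i) - K_second" n] sum_pairs[of "\<lambda>i. K_second / 2" n]
    by (simp add: sum.distrib sq_kernel.ustat_def)
  finally show ?thesis by (simp add: field_simps)
qed

text \<open>
  A row sum is itself a U-statistic, with weight one on the pairs that contain the row index. Each pair
  contains two indices, which gives the order \<open>n\<^sup>2\<close> for all rows together.
\<close>

lemma row_sums_second_moment: "(\<integral>x. (\<Sum>k=1..n. (row_sum n x k)^2) \<partial>iid F n) \<le> 2 * (real n)^2 * K_second"
  and row_sums_integrable: "integrable (iid F n) (\<lambda>x. \<Sum>k=1..n. (row_sum n x k)^2)"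
proof -
  let ?c = "\<lambda>k i j. of_bool (i = k) + of_bool (j = k) :: real"
  have i: "integrable (iid F n) (\<lambda>x. (row_sum n x k)^2)" if "k \<in> {1..n}" for k
    using ustat_moment[OF u_moment, of n n "?c k"] unfolding row_sum_ustat[OF that] by (simp add: has_moment_def)
  then show "integrable (iid F n) (\<lambda>x. \<Sum>k=1..n. (row_sum n x k)^2)" by auto
  have "(\<integral>x. (\<Sum>k=1..n. (row_sum n x k)^2) \<partial>iid F n) = (\<Sum>k=1..n. \<integral>x. (row_sum n x k)^2 \<partial>iid F n)"
    using i by (rule Bochner_Integration.integral_sum)
  also have "\<dots> = (\<Sum>k=1..n. K_second * (\<Sum>j=1..n. \<Sum>i=1..<j. (?c k i j)^2))"
    by (intro sum.cong refl) (simp only: row_sum_ustat ustat_second_moment)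
  also have "\<dots> = K_second * (\<Sum>j=1..n. \<Sum>i=1..<j. \<Sum>k=1..n. (?c k i j)^2)"
    unfolding sum_distrib_left[symmetric]
    by (rule arg_cong2[where f="(*)", OF refl], rule trans[OF sum.swap], rule sum.cong[OF refl], rule sum.swap)
  also have "\<dots> \<le> K_second * (\<Sum>j=1..n. \<Sum>i=1..n. 2)"
  proof (intro mult_left_mono second_nonneg)
    have "(\<Sum>k=1..n. (?c k i j)^2) \<le> 2" if "i \<noteq> j" for i j
    proof -
      have "(\<Sum>k=1..n. (?c k i j)^2) = (\<Sum>k=1..n. ?c k i j)"
        using that by (intro sum.cong) (auto simp: of_bool_def)
      also have "\<dots> \<le> 2" by (simp add: sum.distrib of_bool_def sum.delta)
      finally show ?thesis .
    qed
    then have "(\<Sum>j=1..n. \<Sum>i=1..<j. \<Sum>k=1..n. (?c k i j)^2) \<le> (\<Sum>j=1..n. \<Sum>i=1..<j. 2)"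
      by (intro sum_mono) auto
    also have "\<dots> \<le> (\<Sum>j=1..n. \<Sum>i=1..n. 2)" by (intro sum_mono sum_mono2) auto
    finally show "(\<Sum>j=1..n. \<Sum>i=1..<j. \<Sum>k=1..n. (?c k i j)^2) \<le> (\<Sum>j=1..n. \<Sum>i=1..n. 2)" .
  qed
  also have "\<dots> = 2 * (real n)^2 * K_second" by (simp add: power2_eq_square)
  finally show "(\<integral>x. (\<Sum>k=1..n. (row_sum n x k)^2) \<partial>iid F n) \<le> 2 * (real n)^2 * K_second" .
qed

lemma total_second_moment: "(\<integral>x. pair_total n x^2 \<partial>iid F n) \<le> 4 * (real n)^2 * K_second"
  and total_integrable: "integrable (iid F n) (\<lambda>x. pair_total n x^2)"
proof -
  show "integrable (iid F n) (\<lambda>x. pair_total n x^2)"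
    unfolding total_ustat using ustat_moment[OF u_moment, of n n "\<lambda>_ _. 1"] by (simp add: has_moment_def power_mult_distrib)
  have "(\<integral>x. pair_total n x^2 \<partial>iid F n) = 4 * (K_second * (\<Sum>j=1..n. \<Sum>i=1..<j. 1^2))"
    unfolding total_ustat power_mult_distrib by (simp only: ustat_second_moment integral_mult_right_zero) simp
  also have "\<dots> \<le> 4 * (K_second * (\<Sum>j=1..n. \<Sum>i=1..n. 1))"
    using second_nonneg by (intro mult_left_mono sum_mono) auto
  finally show "(\<integral>x. pair_total n x^2 \<partial>iid F n) \<le> 4 * (real n)^2 * K_second"
    by (simp add: power2_eq_square mult_ac)
qed

lemma square_sum_deviation:
  "(\<integral>x. \<bar>square_sum n x - n * (real n - 1) * K_second\<bar> \<partial>iid F n) \<le> 10 * real n * sqrt (n * K_fourth)"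
  and square_sum_integrable: "integrable (iid F n) (\<lambda>x. square_sum n x - n * (real n - 1) * K_second)"
proof -
  interpret I: prob_space "iid F n" by (rule prob_space_iid) unfold_locales
  let ?A = "\<lambda>x. \<Sum>i=1..n. 1 * (G (x i) (x i) - K_second)"
  let ?B = "sq_kernel.ustat (\<lambda>_ _. 1) n"
  have mA: "has_moment (iid F n) 2 ?A"
    by (intro I.has_moment_sum has_moment_cmult has_moment_component[OF diag_centered(1)])
  have mB: "has_moment (iid F n) 2 ?B" by (rule sq_kernel.ustat_moment[OF sq_bound_moment]) simp
  have iA: "integrable (iid F n) ?A" and iB: "integrable (iid F n) ?B"
    using I.has_moment_mono[OF mA, of 1] I.has_moment_mono[OF mB, of 1] by (auto simp: has_moment_1)
  show "integrable (iid F n) (\<lambda>x. square_sum n x - n * (real n - 1) * K_second)"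
    unfolding square_sum_decomp using iA iB by simp
  have "(\<integral>x. \<bar>square_sum n x - n * (real n - 1) * K_second\<bar> \<partial>iid F n)
     \<le> (\<integral>x. 2 * (\<bar>?B x\<bar> + n * \<bar>?A x\<bar>) \<partial>iid F n)"
    unfolding square_sum_decomp
  proof (rule integral_mono)
    fix x
    have "\<bar>2 * (?B x + (real n - 1) * ?A x)\<bar> \<le> 2 * (\<bar>?B x\<bar> + \<bar>real n - 1\<bar> * \<bar>?A x\<bar>)"
      using abs_triangle_ineq[of "?B x" "(real n - 1) * ?A x"] by (simp only: abs_mult) simp
    also have "\<dots> \<le> 2 * (\<bar>?B x\<bar> + n * \<bar>?A x\<bar>)"
    proof (cases "n = 0")
      case False then show ?thesis by (intro mult_left_mono add_left_mono mult_right_mono) auto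
    qed simp
    finally show "\<bar>2 * (?B x + (real n - 1) * ?A x)\<bar> \<le> 2 * (\<bar>?B x\<bar> + n * \<bar>?A x\<bar>)" .
  qed (use iA iB in auto)
  also have "\<dots> = 2 * ((\<integral>x. \<bar>?B x\<bar> \<partial>iid F n) + n * (\<integral>x. \<bar>?A x\<bar> \<partial>iid F n))"
    using iA iB by simp
  also have "\<dots> \<le> 2 * (4 * real n * sqrt (n * K_fourth) + n * sqrt (n * K_fourth))"
  proof (intro mult_left_mono add_mono)
    have "(\<integral>x. \<bar>?A x\<bar> \<partial>iid F n) \<le> sqrt (\<integral>x. (?A x)^2 \<partial>iid F n)" by (rule I.abs_expectation_le_sqrt[OF mA])
    also have "(\<integral>x. (?A x)^2 \<partial>iid F n) \<le> n * K_fourth"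
      unfolding iid_sum_second_moment[OF diag_centered(1,2)] using diag_centered(3)
      by (simp add: mult.commute mult_left_mono)
    finally show "(\<integral>x. \<bar>?A x\<bar> \<partial>iid F n) \<le> sqrt (n * K_fourth)" by simp
    have "(\<integral>x. \<bar>?B x\<bar> \<partial>iid F n) \<le> sqrt (\<integral>x. (?B x)^2 \<partial>iid F n)" by (rule I.abs_expectation_le_sqrt[OF mB])
    also have "(\<integral>x. (?B x)^2 \<partial>iid F n) \<le> 16 * K_fourth * (real n * real n)"
      unfolding sq_kernel.ustat_second_moment
    proof (rule mult_mono)
      have "(\<Sum>j=1..n. \<Sum>i=1..<j. 1^2) \<le> (\<Sum>j=1..n. \<Sum>i=1..n. 1 :: real)" by (intro sum_mono) auto
      then show "(\<Sum>j=1..n. \<Sum>i=1..<j. 1^2) \<le> real n * real n" by simp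
    qed (use sq_kernel_second_le fourth_nonneg in \<open>auto intro!: sum_nonneg\<close>)
    also have "\<dots> \<le> 16 * K_fourth * ((real n)^2 * real n)"
    proof -
      have "real n \<le> (real n)^2" by (cases n) (auto simp: power2_eq_square)
      then show ?thesis using fourth_nonneg by (simp add: power2_eq_square mult_left_mono mult_right_mono)
    qed
    also have "\<dots> = (4 * real n)^2 * (n * K_fourth)" by (simp add: power2_eq_square)
    also have "sqrt \<dots> = 4 * real n * sqrt (n * K_fourth)" by (simp only: real_sqrt_mult[of "(4 * real n)^2"] real_sqrt_abs abs_mult abs_numeral abs_of_nat)
    finally show "(\<integral>x. \<bar>?B x\<bar> \<partial>iid F n) \<le> 4 * real n * sqrt (n * K_fourth)" by simp
  qed auto
  also have "\<dots> = 10 * real n * sqrt (n * K_fourth)" by simp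
  finally show "(\<integral>x. \<bar>square_sum n x - n * (real n - 1) * K_second\<bar> \<partial>iid F n) \<le> 10 * real n * sqrt (n * K_fourth)" .
qed

lemma vstat_integrable: "integrable (iid F n) (vstat n)"
proof -
  interpret I: prob_space "iid F n" by (rule prob_space_iid) unfold_locales
  have "integrable (iid F n) (\<lambda>x. (square_sum n x - n * (real n - 1) * K_second) + n * (real n - 1) * K_second)"
    by (intro Bochner_Integration.integrable_add square_sum_integrable) auto
  then show ?thesis unfolding vstat_def[abs_def]
    using row_sums_integrable[of n] total_integrable[of n] by simp
qed

lemma sqrt_ratio:
  fixes n k q :: real
  assumes "n > 0" "k > 0" "q \<ge> 0"
  shows "sqrt (n * q) / (n * k) = sqrt (q / (n * k^2))"
proof (rule sym, rule real_sqrt_unique)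
  have "(sqrt (n * q) / (n * k))^2 = (n * q) / (n * k)^2"
    using assms by (simp add: power_divide)
  also have "\<dots> = q / (n * k^2)"
    using assms by (simp add: power2_eq_square)
  finally show "(sqrt (n * q) / (n * k))^2 = q / (n * k^2)" .
qed (use assms in auto)

lemma vstat_arith:
  fixes n k s :: real
  assumes "n > 0" "k > 0"
  shows "2 / n^2 * (10 * n * s + 2 * n * k + 4 / n * (2 * n^2 * k) + (4 * n^2 * k) / n) / k
    = 20 * (s / (n * k)) + 28 / n"
proof -
  have "4 / n * (2 * n^2 * k) = 8 * n * k" "(4 * n^2 * k) / n = 4 * n * k"
    using assms by (simp_all add: power2_eq_square)
  then have "10 * n * s + 2 * n * k + 4 / n * (2 * n^2 * k) + (4 * n^2 * k) / n = n * (10 * s + 14 * k)"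
    by (simp add: algebra_simps)
  moreover have "2 / n^2 * (n * (10 * s + 14 * k)) / k = 20 * (s / (n * k)) + 28 / n"
    using assms by (simp add: power2_eq_square divide_simps)
  ultimately show ?thesis by (simp only:)
qed

text \<open>
  Of the three parts of the estimator the mean square dominates. Its deviation is of relative order
  \<open>\<surd>(E K\<^sup>4 / (n (E K\<^sup>2)\<^sup>2))\<close>, and the remaining parts together with the normalization contribute \<open>O(1/n)\<close>.
\<close>

lemma vstat_deviation:
  assumes n: "n \<ge> 6" and K2: "K_second > 0"
  shows "(\<integral>x. \<bar>vstat n x / K_second - 1\<bar> \<partial>iid F n) \<le> 20 * sqrt (K_fourth / (n * K_second^2)) + 28 / n"
proof -
  interpret I: prob_space "iid F n" by (rule prob_space_iid) unfold_locales
  define Q where "Q x = square_sum n x - n * (real n - 1) * K_second" for x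
  define R where "R x = (\<Sum>k=1..n. (row_sum n x k)^2)" for x
  define T where "T x = pair_total n x^2" for x
  have iQ: "integrable (iid F n) Q" and iR: "integrable (iid F n) R" and iT: "integrable (iid F n) T"
    unfolding Q_def R_def T_def by (rule square_sum_integrable row_sums_integrable total_integrable)+
  have R0: "0 \<le> R x" and T0: "0 \<le> T x" for x by (auto simp: R_def T_def intro: sum_nonneg)
  have n6: "real n \<ge> 6" using n by simp
  have d: "real n * (real n - 3) \<ge> n^2 / 2" "real n * (real n - 3) > 0" "(real n - 1) * (real n - 2) \<ge> n" "real n - 2 \<ge> n / 2"
  proof -
    have "0 \<le> real n * (real n - 6)" using n6 by simp
    then show "real n * (real n - 3) \<ge> n^2 / 2" by (simp add: power2_eq_square algebra_simps)
    have "6 * real n \<le> real n * real n" using n6 by (intro mult_right_mono) auto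
    then show "(real n - 1) * (real n - 2) \<ge> n" by (simp add: algebra_simps)
  qed (use n6 in auto)
  let ?B = "\<lambda>x. 2 / (real n)^2 * (\<bar>Q x\<bar> + 2 * real n * K_second + 4 / n * R x + T x / n)"
  have pt: "\<bar>vstat n x - K_second\<bar> \<le> ?B x" for x
  proof -
    have "vstat n x - K_second = (Q x + 2 * real n * K_second - 2 / (real n - 2) * R x + T x / ((real n - 1) * (real n - 2))) / (real n * (real n - 3))"
    proof -
      have "K_second = real n * (real n - 3) * K_second / (real n * (real n - 3))" using d(2) by (metis less_irrefl nonzero_mult_div_cancel_left)
      then have "vstat n x - K_second = vstat n x - real n * (real n - 3) * K_second / (real n * (real n - 3))" by simp
      then show ?thesis unfolding vstat_def Q_def R_def T_def diff_divide_distrib[symmetric]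
        by (simp add: algebra_simps)
    qed
    also have "\<bar>\<dots>\<bar> = \<bar>Q x + 2 * real n * K_second - 2 / (real n - 2) * R x + T x / ((real n - 1) * (real n - 2))\<bar> / (real n * (real n - 3))"
      using d(2) by (simp only: abs_divide abs_of_pos)
    also have "\<dots> \<le> (\<bar>Q x\<bar> + 2 * real n * K_second + 2 / (real n - 2) * R x + T x / ((real n - 1) * (real n - 2))) / (real n * (real n - 3))"
    proof (intro divide_right_mono)
      have "0 \<le> 2 * real n * K_second" "0 \<le> 2 / (real n - 2) * R x" "0 \<le> T x / ((real n - 1) * (real n - 2))"
        using K2 R0 T0 n6 by auto
      then show "\<bar>Q x + 2 * real n * K_second - 2 / (real n - 2) * R x + T x / ((real n - 1) * (real n - 2))\<bar>
        \<le> \<bar>Q x\<bar> + 2 * real n * K_second + 2 / (real n - 2) * R x + T x / ((real n - 1) * (real n - 2))" by linarith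
    qed (use d(2) in simp)
    also have "\<dots> \<le> (\<bar>Q x\<bar> + 2 * real n * K_second + 4 / n * R x + T x / n) / (n^2 / 2)"
    proof (rule frac_le)
      have "2 / (real n - 2) \<le> 2 / (n / 2)" using d(4) n6 by (intro divide_left_mono) auto
      then have "2 / (real n - 2) * R x \<le> 4 / n * R x" using R0 by (intro mult_right_mono) auto
      moreover have "T x / ((real n - 1) * (real n - 2)) \<le> T x / n" using d(3) T0 n6 by (intro divide_left_mono) auto
      ultimately show "\<bar>Q x\<bar> + 2 * real n * K_second + 2 / (real n - 2) * R x + T x / ((real n - 1) * (real n - 2))
         \<le> \<bar>Q x\<bar> + 2 * real n * K_second + 4 / n * R x + T x / n" by linarith
      show "0 \<le> \<bar>Q x\<bar> + 2 * real n * K_second + 4 / n * R x + T x / n" using K2 R0 T0 by simp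
    qed (use d n6 in auto)
    finally show ?thesis by (simp add: field_simps)
  qed
  have "(\<integral>x. \<bar>vstat n x / K_second - 1\<bar> \<partial>iid F n) \<le> (\<integral>x. ?B x / K_second \<partial>iid F n)"
  proof (rule integral_mono)
    fix x
    have "\<bar>vstat n x / K_second - 1\<bar> = \<bar>vstat n x - K_second\<bar> / K_second"
    proof -
      have "vstat n x / K_second - 1 = (vstat n x - K_second) / K_second"
        using K2 by (simp add: diff_divide_distrib)
      then show ?thesis using K2 by (simp only: abs_divide abs_of_pos)
    qed
    also have "\<dots> \<le> ?B x / K_second" using K2 by (intro divide_right_mono pt) simp
    finally show "\<bar>vstat n x / K_second - 1\<bar> \<le> ?B x / K_second" .
  qed (use vstat_integrable[of n] iQ iR iT in auto)
  also have "\<dots> = 2 / (real n)^2 * ((\<integral>x. \<bar>Q x\<bar> \<partial>iid F n) + 2 * real n * K_second + 4 / n * (\<integral>x. R x \<partial>iid F n) + (\<integral>x. T x \<partial>iid F n) / n) / K_second"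
    using iQ iR iT by (simp add: I.prob_space)
  also have "\<dots> \<le> 2 / (real n)^2 * (10 * real n * sqrt (n * K_fourth) + 2 * real n * K_second + 4 / n * (2 * (real n)^2 * K_second) + (4 * (real n)^2 * K_second) / n) / K_second"
    using K2 square_sum_deviation[of n] row_sums_second_moment[of n] total_second_moment[of n]
    by (intro divide_right_mono mult_left_mono add_mono) (auto simp: Q_def R_def T_def)
  also have "\<dots> = 20 * (sqrt (n * K_fourth) / (n * K_second)) + 28 / n"
    using K2 n6 by (intro vstat_arith) auto
  also have "sqrt (n * K_fourth) / (n * K_second) = sqrt (K_fourth / (n * K_second^2))"
    using K2 n6 fourth_nonneg by (intro sqrt_ratio) auto
  finally show ?thesis .
qed

end

section \<open>Studentization\<close>

lemma iexp_dist: "cmod (iexp a - iexp b) \<le> \<bar>a - b\<bar>"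
proof -
  have "iexp a - iexp b = iexp b * (iexp (a - b) - 1)"
    by (simp add: right_diff_distrib flip: exp_add)
  then have "cmod (iexp a - iexp b) = cmod (iexp (a - b) - 1)" by (simp add: norm_mult)
  also have "\<dots> \<le> \<bar>a - b\<bar>" using iexp_approx1[of "a - b" 0] by simp
  finally show ?thesis .
qed

lemma sqrt_inverse_close:
  fixes v \<eta> :: real
  assumes "\<eta> \<le> 1 / 2" "\<bar>v - 1\<bar> \<le> \<eta>"
  shows "\<bar>sqrt (1 / v) - 1\<bar> \<le> 2 * \<eta>"
proof -
  have v: "v \<ge> 1 / 2" using assms by linarith
  define r where "r = sqrt (1 / v)"
  have r: "r \<ge> 0" "r^2 = 1 / v" using v by (auto simp: r_def)
  have "\<bar>r - 1\<bar> * 1 \<le> \<bar>r - 1\<bar> * \<bar>r + 1\<bar>" using r by (intro mult_left_mono) auto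
  also have "\<dots> = \<bar>r^2 - 1\<bar>" by (simp add: power2_eq_square algebra_simps flip: abs_mult)
  also have "r^2 - 1 = (1 - v) / v" using v r by (simp add: diff_divide_distrib)
  also have "\<bar>(1 - v) / v\<bar> = \<bar>v - 1\<bar> / v" using v by (simp add: abs_divide abs_minus_commute)
  also have "\<dots> \<le> \<eta> / (1 / 2)" using assms v by (intro frac_le) auto
  finally show ?thesis by (simp add: r_def)
qed

text \<open>
  The first three terms bound the distance of the characteristic function of the U-statistic to that of the
  normal law. The last term is the price of estimating the variance.
\<close>

definition clt_error :: "real \<Rightarrow> real \<Rightarrow> real \<Rightarrow> real \<Rightarrow> real \<Rightarrow> real" where
  "clt_error t C \<rho> \<gamma> n = t^2 / 2 * (C^2 * (sqrt \<rho> + 2 * sqrt \<gamma>)) + \<bar>t\<bar>^3 / 6 * (sqrt 3 * C^3 * sqrt \<rho>)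
     + t^4 * C^4 / (4 * n) + (2 + 2 * \<bar>t\<bar>) * sqrt (20 * sqrt \<rho> + 28 / n)"

context degenerate_kernel4
begin

text \<open>
  If \<open>\<kappa>\<close> bounds the mean deviation of \<open>vstat / K_second\<close> from one, then that ratio is within \<open>\<eta> = \<surd>\<kappa>\<close> of one
  except on a set of probability at most \<open>\<surd>\<kappa>\<close>. On the former event the studentized and the standardized
  statistics differ by at most \<open>2 \<eta> |W|\<close>, and \<open>E|W| \<le> 1\<close>.
\<close>

theorem studentized_cf_bound:
  fixes t C :: real
  assumes N: "N \<ge> 6" and K2: "K_second > 0" and C: "C > 0"
    and c: "\<And>i j. 1 \<le> i \<Longrightarrow> i < j \<Longrightarrow> j \<le> N \<Longrightarrow> \<bar>c i j\<bar> \<le> C / (N * sqrt K_second)"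
    and norm: "K_second * (\<Sum>j=1..N. \<Sum>i=1..<j. (c i j)^2) = 1"
    and small: "20 * sqrt (K_fourth / (N * K_second^2)) + 28 / N \<le> 1 / 4"
  shows "cmod ((CLINT x|iid F N. iexp (t * (ustat c N x * sqrt (K_second / vstat N x)))) - of_real (exp (- (t^2 / 2))))
    \<le> clt_error t C (K_fourth / (N * K_second^2)) (K_cycle / K_second^2) N"
proof -
  interpret I: prob_space "iid F N" by (rule prob_space_iid) unfold_locales
  define \<kappa> where "\<kappa> = 20 * sqrt (K_fourth / (N * K_second^2)) + 28 / N"
  define \<eta> where "\<eta> = sqrt \<kappa>"
  have \<kappa>: "\<kappa> > 0" unfolding \<kappa>_def using N K2 fourth_nonneg by (intro add_nonneg_pos) auto
  have \<eta>: "\<eta> > 0" "\<eta> \<le> 1 / 2" "\<eta> * \<eta> = \<kappa>"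
  proof -
    show "\<eta> \<le> 1 / 2" unfolding \<eta>_def
      by (rule real_le_lsqrt) (use small in \<open>auto simp: \<kappa>_def power2_eq_square\<close>)
  qed (use \<kappa> in \<open>auto simp: \<eta>_def\<close>)
  let ?W = "ustat c N" and ?u = "\<lambda>x. vstat N x / K_second"
  let ?T = "\<lambda>x. ?W x * sqrt (K_second / vstat N x)"
  have mV[measurable]: "vstat N \<in> borel_measurable (iid F N)" by (rule borel_measurable_integrable[OF vstat_integrable])
  have iu: "integrable (iid F N) (\<lambda>x. \<bar>?u x - 1\<bar>)"
    using vstat_integrable[of N] by (intro integrable_abs Bochner_Integration.integrable_diff) auto
  have W: "has_moment (iid F N) 2 ?W" by (rule ustat_moment[OF u_moment]) simp
  have iW: "integrable (iid F N) (\<lambda>x. \<bar>?W x\<bar>)" using I.has_moment_mono[OF W, of 1] by (simp add: has_moment_1)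
  have EW: "(\<integral>x. \<bar>?W x\<bar> \<partial>iid F N) \<le> 1"
    using I.abs_expectation_le_sqrt[OF W] by (simp only: ustat_second_moment norm real_sqrt_one)
  have Eu: "(\<integral>x. \<bar>?u x - 1\<bar> \<partial>iid F N) \<le> \<kappa>" unfolding \<kappa>_def by (rule vstat_deviation[OF N K2])
  let ?B = "\<lambda>x. 2 / \<eta> * \<bar>?u x - 1\<bar> + 2 * \<bar>t\<bar> * \<eta> * \<bar>?W x\<bar>"
  have pt: "cmod (iexp (t * ?T x) - iexp (t * ?W x)) \<le> ?B x" for x
  proof (cases "\<bar>?u x - 1\<bar> \<le> \<eta>")
    case True
    have e: "K_second / vstat N x = 1 / ?u x" by simp
    have "cmod (iexp (t * ?T x) - iexp (t * ?W x)) \<le> \<bar>t * ?T x - t * ?W x\<bar>" by (rule iexp_dist)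
    also have "\<dots> = \<bar>t\<bar> * \<bar>?W x\<bar> * \<bar>sqrt (1 / ?u x) - 1\<bar>"
      unfolding e by (simp add: algebra_simps flip: abs_mult)
    also have "\<dots> \<le> \<bar>t\<bar> * \<bar>?W x\<bar> * (2 * \<eta>)"
      by (intro mult_left_mono sqrt_inverse_close True \<eta>) auto
    also have "\<dots> \<le> ?B x" using \<eta> by (simp add: mult_ac)
    finally show ?thesis .
  next
    case False
    have "cmod (iexp (t * ?T x) - iexp (t * ?W x)) \<le> cmod (iexp (t * ?T x)) + cmod (iexp (t * ?W x))"
      by (rule norm_triangle_ineq4)
    also have "\<dots> \<le> 2" by simp
    also have "\<dots> \<le> 2 / \<eta> * \<bar>?u x - 1\<bar>" using False \<eta> by (simp add: field_simps)
    also have "\<dots> \<le> ?B x" using \<eta> by simp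
    finally show ?thesis .
  qed
  have iT: "integrable (iid F N) (\<lambda>x. iexp (t * ?T x))" and iW': "integrable (iid F N) (\<lambda>x. iexp (t * ?W x))"
    by (rule I.integrable_const_bound[of _ 1]; auto intro!: AE_I2)+
  have eq: "(CLINT x|iid F N. iexp (t * ?T x)) - cf c N t = (CLINT x|iid F N. iexp (t * ?T x) - iexp (t * ?W x))"
    unfolding cf_def by (rule Bochner_Integration.integral_diff[OF iT iW', symmetric])
  have "cmod ((CLINT x|iid F N. iexp (t * ?T x)) - cf c N t) \<le> (\<integral>x. ?B x \<partial>iid F N)"
    unfolding eq
  proof (rule order_trans[OF integral_norm_bound integral_mono])
    show "integrable (iid F N) (\<lambda>x. cmod (iexp (t * ?T x) - iexp (t * ?W x)))"
      using iT iW' by (intro integrable_norm Bochner_Integration.integrable_diff)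
  qed (use iu iW pt in auto)
  also have "\<dots> = 2 / \<eta> * (\<integral>x. \<bar>?u x - 1\<bar> \<partial>iid F N) + 2 * \<bar>t\<bar> * \<eta> * (\<integral>x. \<bar>?W x\<bar> \<partial>iid F N)"
    unfolding Bochner_Integration.integral_add[OF integrable_mult_right[OF iu] integrable_mult_right[OF iW]]
    by (simp only: integral_mult_right_zero)
  also have "\<dots> \<le> 2 / \<eta> * \<kappa> + 2 * \<bar>t\<bar> * \<eta> * 1"
    using \<eta> by (intro add_mono mult_left_mono Eu EW) auto
  also have "\<dots> = (2 + 2 * \<bar>t\<bar>) * \<eta>"
    using \<eta>(1) unfolding \<eta>(3)[symmetric] by (simp add: algebra_simps)
  finally have 1: "cmod ((CLINT x|iid F N. iexp (t * ?T x)) - cf c N t) \<le> (2 + 2 * \<bar>t\<bar>) * \<eta>" .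
  have 2: "cmod (cf c N t - of_real (exp (- (t^2 / 2))))
    \<le> t^2 / 2 * (C^2 * (sqrt (K_fourth / (N * K_second^2)) + 2 * sqrt (K_cycle / K_second^2)))
      + \<bar>t\<bar>^3 / 6 * (sqrt 3 * C^3 * sqrt (K_fourth / (N * K_second^2))) + t^4 * C^4 / (4 * real N)"
    by (rule cf_bound) (use N K2 C c norm in auto)
  show ?thesis
    using norm_triangle_ineq[of "(CLINT x|iid F N. iexp (t * ?T x)) - cf c N t" "cf c N t - of_real (exp (- (t^2 / 2)))"] 1 2
    unfolding clt_error_def \<eta>_def \<kappa>_def by simp
qed

lemma ustat_scale: "ustat (\<lambda>i j. a * c i j) n x = a * ustat c n x"
  by (simp add: ustat_def sum_distrib_left mult_ac)

lemma K_power_iid: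
  assumes "k = 2 \<or> k = 4"
  shows "(\<integral>x. K (x 1) (x 2) ^ k \<partial>iid F 4) = (\<integral>x. (\<integral>z. K x z ^ k \<partial>F) \<partial>F)"
proof -
  have m: "has_moment F k u" using assms u_moment u_moment4 by auto
  have k: "even k" using assms by auto
  have i: "integrable (iid F n) (\<lambda>x. K (x 1) (x 2) ^ k)" if "n \<ge> 2" for n
    using K_moment_iid[OF m, of 1 n 2] that k by (simp add: has_moment_def power_even_abs)
  have "(\<integral>x. K (x 1) (x 2) ^ k \<partial>iid F 4) = (\<integral>x. K (x 1) (x 2) ^ k \<partial>iid F (Suc 3))" by simp
  also have "\<dots> = (\<integral>x. K (x 1) (x 2) ^ k \<partial>iid F 3)" by (rule integral_iid_Suc_const) (use i[of 4] in auto)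
  also have "\<dots> = (\<integral>x. K (x 1) (x 2) ^ k \<partial>iid F (Suc 2))" by simp
  also have "\<dots> = (\<integral>x. K (x 1) (x 2) ^ k \<partial>iid F 2)" by (rule integral_iid_Suc_const) (use i[of 3] in auto)
  also have "\<dots> = (\<integral>x. K (x 1) (x 2) ^ k \<partial>iid F (Suc 1))" by (simp only: Suc_1)
  also have "\<dots> = (\<integral>x. (\<integral>z. K (x 1) z ^ k \<partial>F) \<partial>iid F 1)"
    by (subst integral_iid_Suc) (use i[of 2] in \<open>auto simp: Suc_1\<close>)
  also have "\<dots> = (\<integral>x. (\<integral>z. K x z ^ k \<partial>F) \<partial>F)" by (rule integral_component) auto
  finally show ?thesis .
qed

text \<open>
  Integrating the fourth coordinate produces \<open>G\<close> at the first two points, and integrating the third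
  coordinate produces a second factor \<open>G\<close>.
\<close>

lemma K_cycle_iid:
  "(\<integral>x. K (x 1) (x 3) * K (x 2) (x 3) * K (x 1) (x 4) * K (x 2) (x 4) \<partial>iid F 4) = K_cycle"
proof -
  let ?f = "\<lambda>x. (K (x 1) (x 3) * K (x 2) (x 3)) * (K (x 1) (x 4) * K (x 2) (x (4::nat)))"
  have "has_moment (iid F 4) 1 ?f"
  proof (rule has_moment_mult)
    show "has_moment (iid F 4) (2 * 1) (\<lambda>x. K (x 1) (x 3) * K (x 2) (x 3))"
      by (rule has_moment_mult) (use K_moment_iid[OF u_moment4, of _ 4] in auto)
    show "has_moment (iid F 4) (2 * 1) (\<lambda>x. K (x 1) (x 4) * K (x 2) (x 4))"
      by (rule has_moment_mult) (use K_moment_iid[OF u_moment4, of _ 4] in auto)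
  qed
  then have i: "integrable (iid F (Suc 3)) ?f" by (simp add: has_moment_1)
  have "(\<integral>x. ?f x \<partial>iid F 4) = (\<integral>x. ?f x \<partial>iid F (Suc 3))" by simp
  also have "\<dots> = (\<integral>x. K (x 1) (x 3) * K (x 2) (x 3) * G (x 1) (x 2) \<partial>iid F 3)"
    unfolding integral_iid_Suc[OF i] by (simp add: G_def)
  also have "\<dots> = (\<integral>x. K (x 1) (x 3) * K (x 2) (x 3) * G (x 1) (x 2) \<partial>iid F (Suc 2))" by simp
  also have "\<dots> = (\<integral>x. (G (x 1) (x 2))^2 \<partial>iid F 2)"
  proof -
    have "has_moment (iid F 3) 1 (\<lambda>x. (K (x 1) (x 3) * K (x 2) (x 3)) * G (x 1) (x 2))"
    proof (rule has_moment_mult)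
      show "has_moment (iid F 3) (2 * 1) (\<lambda>x. K (x 1) (x 3) * K (x 2) (x 3))"
        by (rule has_moment_mult) (use K_moment_iid[OF u_moment4, of _ 3] in auto)
      show "has_moment (iid F 3) (2 * 1) (\<lambda>x. G (x 1) (x 2))"
        using G.K_moment_iid[OF Gu_moment, of 1 3 2] by simp
    qed
    then have i: "integrable (iid F (Suc 2)) (\<lambda>x. K (x 1) (x 3) * K (x 2) (x 3) * G (x 1) (x 2))"
      by (simp add: has_moment_1)
    show ?thesis unfolding integral_iid_Suc[OF i] by (simp add: G_def power2_eq_square)
  qed
  also have "\<dots> = (\<integral>x. (G (x 1) (x 2))^2 \<partial>iid F (Suc 1))" by (simp only: Suc_1)
  also have "\<dots> = (\<integral>x. (\<integral>z. (G (x 1) z)^2 \<partial>F) \<partial>iid F 1)"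
  proof -
    have "integrable (iid F (Suc 1)) (\<lambda>x. (G (x 1) (x 2))^2)"
      unfolding Suc_1 using G.K_moment_iid[OF Gu_moment, of 1 2 2] by (simp add: has_moment_def)
    from integral_iid_Suc[OF this] show ?thesis by simp
  qed
  also have "\<dots> = K_cycle" unfolding K_cycle_def by (rule integral_component) auto
  finally show ?thesis by (simp add: mult_ac)
qed

end

section \<open>The Gini covariance as a weighted sum over pairs\<close>

definition gini_weight :: "nat \<Rightarrow> (nat \<Rightarrow> 'l) \<Rightarrow> nat \<Rightarrow> (nat \<Rightarrow> 'l) \<Rightarrow> nat \<Rightarrow> nat \<Rightarrow> real" where
  "gini_weight K L n y i j = 1 / real (n choose 2)
     - (\<Sum>k=1..K. phat n y (L k) / real (class_size n y (L k) choose 2) * of_bool (y i = L k \<and> y j = L k))"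

definition weight_sq :: "nat \<Rightarrow> (nat \<Rightarrow> 'l) \<Rightarrow> nat \<Rightarrow> (nat \<Rightarrow> 'l) \<Rightarrow> real" where
  "weight_sq K L n y = (\<Sum>k=1..K. (phat n y (L k))\<^sup>2 / real (class_size n y (L k) choose 2)) - 1 / real (n choose 2)"

lemma choose_2_real: "real (m choose 2) = real m * (real m - 1) / 2"
proof -
  have "real (m choose 2) = real (m * (m - 1)) / 2"
    unfolding choose_two by (subst real_of_nat_div) (auto simp: even_mult_exp_div_exp_iff)
  then show ?thesis by (cases m) (auto simp: algebra_simps)
qed

lemma pair_sum:
  assumes "I \<subseteq> {1..n::nat}"
  shows "(\<Sum>(i, j) \<in> {(i, j). i \<in> I \<and> j \<in> I \<and> i < j}. f i j) = (\<Sum>j=1..n. \<Sum>i=1..<j. of_bool (i \<in> I \<and> j \<in> I) * (f i j :: real))"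
proof -
  have "(\<Sum>j=1..n. \<Sum>i=1..<j. of_bool (i \<in> I \<and> j \<in> I) * f i j)
     = (\<Sum>p\<in>(SIGMA j:{1..n}. {1..<j}). of_bool (snd p \<in> I \<and> fst p \<in> I) * f (snd p) (fst p))"
    by (subst sum.Sigma) (simp_all add: case_prod_unfold del: sum_of_bool_mult_eq sum_mult_of_bool_eq)
  also have "\<dots> = (\<Sum>p\<in>{p \<in> (SIGMA j:{1..n}. {1..<j}). snd p \<in> I \<and> fst p \<in> I}. f (snd p) (fst p))"
    by (rule sum.mono_neutral_cong_right) auto
  also have "\<dots> = (\<Sum>(i, j) \<in> {(i, j). i \<in> I \<and> j \<in> I \<and> i < j}. f i j)"
    by (rule sum.reindex_bij_witness[of _ "\<lambda>(i, j). (j, i)" "\<lambda>(i, j). (j, i)"]) (use assms in auto)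
  finally show ?thesis by simp
qed

text \<open>
  Each index of \<open>I\<close> belongs to \<open>card I - 1\<close> pairs.
\<close>

lemma pair_sum_additive:
  assumes I: "I \<subseteq> {1..n::nat}"
  shows "(\<Sum>j=1..n. \<Sum>i=1..<j. of_bool (i \<in> I \<and> j \<in> I) * (u i + u j)) = (real (card I) - 1) * (\<Sum>i\<in>I. u i)"
proof -
  let ?b = "\<lambda>i. of_bool (i \<in> I) :: real"
  have fI: "(\<Sum>i=1..n. ?b i * g i) = (\<Sum>i\<in>I. g i)" for g :: "nat \<Rightarrow> real"
    by (rule sum.mono_neutral_cong_right) (use I in auto)
  have c: "(\<Sum>i=1..n. ?b i) = card I" using fI[of "\<lambda>_. 1"] by simp
  have "(\<Sum>i=1..n. \<Sum>j=1..n. ?b i * ?b j * (u i + u j)) = (\<Sum>i=1..n. ?b i * ?b i * (u i + u i))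
     + 2 * (\<Sum>j=1..n. \<Sum>i=1..<j. ?b i * ?b j * (u i + u j))"
    by (rule double_sum_symmetric) (simp add: mult_ac add.commute)
  also have "(\<Sum>i=1..n. \<Sum>j=1..n. ?b i * ?b j * (u i + u j))
     = (\<Sum>i=1..n. \<Sum>j=1..n. (?b i * u i) * ?b j) + (\<Sum>i=1..n. \<Sum>j=1..n. ?b i * (?b j * u j))"
    by (simp add: sum.distrib[symmetric] algebra_simps)
  also have "\<dots> = 2 * (real (card I) * (\<Sum>i\<in>I. u i))"
    by (simp add: sum_product[symmetric] fI c del: sum_of_bool_mult_eq sum_mult_of_bool_eq)
  also have "(\<Sum>i=1..n. ?b i * ?b i * (u i + u i)) = 2 * (\<Sum>i\<in>I. u i)"
  proof -
    have "(\<Sum>i=1..n. ?b i * ?b i * (u i + u i)) = (\<Sum>i=1..n. ?b i * (2 * u i))"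
      by (intro sum.cong refl) auto
    then show ?thesis unfolding fI by (simp only: sum_distrib_left)
  qed
  finally have "(\<Sum>j=1..n. \<Sum>i=1..<j. ?b i * ?b j * (u i + u j)) = (real (card I) - 1) * (\<Sum>i\<in>I. u i)"
    by (simp add: algebra_simps)
  then show ?thesis by (simp only: of_bool_conj)
qed

lemma pair_count:
  assumes I: "I \<subseteq> {1..n::nat}"
  shows "(\<Sum>j=1..n. \<Sum>i=1..<j. of_bool (i \<in> I \<and> j \<in> I)) = real (card I choose 2)"
proof -
  have "(\<Sum>j=1..n. \<Sum>i=1..<j. of_bool (i \<in> I \<and> j \<in> I)) = (\<Sum>j=1..n. \<Sum>i=1..<j. of_bool (i \<in> I \<and> j \<in> I) * (1/2 + 1/2 :: real))"
    by simp
  also have "\<dots> = (real (card I) - 1) * (\<Sum>i\<in>I. 1/2)" by (rule pair_sum_additive[OF I])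
  finally show ?thesis by (simp add: choose_2_real algebra_simps)
qed

lemma U_stat_additive_split:
  assumes I: "I \<subseteq> {1..n}" and m: "card I \<ge> 2"
    and e: "\<And>i j. i \<in> {1..n} \<Longrightarrow> j \<in> {1..n} \<Longrightarrow> i < j \<Longrightarrow> edist p (x i) (x j) = e i j + u i + u j"
  shows "U_stat p I x = (\<Sum>j=1..n. \<Sum>i=1..<j. of_bool (i \<in> I \<and> j \<in> I) * e i j) / real (card I choose 2)
     + 2 / card I * (\<Sum>i\<in>I. u i)"
proof -
  have "(\<Sum>(i, j) \<in> {(i, j). i \<in> I \<and> j \<in> I \<and> i < j}. edist p (x i) (x j))
    = (\<Sum>j=1..n. \<Sum>i=1..<j. of_bool (i \<in> I \<and> j \<in> I) * edist p (x i) (x j))"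
    by (rule pair_sum[OF I])
  also have "\<dots> = (\<Sum>j=1..n. \<Sum>i=1..<j. of_bool (i \<in> I \<and> j \<in> I) * e i j + of_bool (i \<in> I \<and> j \<in> I) * (u i + u j))"
    by (intro sum.cong refl) (use e in \<open>auto simp: algebra_simps\<close>)
  also have "\<dots> = (\<Sum>j=1..n. \<Sum>i=1..<j. of_bool (i \<in> I \<and> j \<in> I) * e i j) + (real (card I) - 1) * (\<Sum>i\<in>I. u i)"
    by (simp only: sum.distrib pair_sum_additive[OF I])
  finally show ?thesis
    unfolding U_stat_def using m by (simp add: choose_2_real add_divide_distrib)
qed

lemma class_term:
  "n > 0 \<Longrightarrow> m > 1 \<Longrightarrow> (m / n)^2 / (m * (m - 1) / 2) = 2 / n^2 * (m / (m - 1))" for m n :: real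
  by (simp add: divide_simps power2_eq_square)

lemma mult_split: "a * (E / c + b * S) = a / c * E + (a * b) * S" for a E c b S :: real
  by (simp add: distrib_left)

context
  fixes K n :: nat and L :: "nat \<Rightarrow> 'l" and y :: "nat \<Rightarrow> 'l"
  assumes L: "inj_on L {1..K}" and y: "\<And>i. i \<in> {1..n} \<Longrightarrow> y i \<in> L ` {1..K}"
    and size2: "\<And>k. k \<in> {1..K} \<Longrightarrow> class_size n y (L k) \<ge> 2"
begin

lemma class_idx_sub: "class_idx n y l \<subseteq> {1..n}" by (auto simp: class_idx_def)

lemma sum_over_classes: "(\<Sum>k=1..K. \<Sum>i\<in>class_idx n y (L k). f i) = (\<Sum>i=1..n. f i)" for f :: "nat \<Rightarrow> real"
proof -
  have "(\<Sum>i\<in>(\<Union>k\<in>{1..K}. class_idx n y (L k)). f i) = (\<Sum>k=1..K. \<Sum>i\<in>class_idx n y (L k). f i)"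
    by (rule sum.UNION_disjoint) (auto simp: class_idx_def inj_on_eq_iff[OF L])
  also have "(\<Union>k\<in>{1..K}. class_idx n y (L k)) = {1..n}"
    using y by (force simp: class_idx_def)
  finally show ?thesis by simp
qed

lemma sum_class_sizes: "(\<Sum>k=1..K. real (class_size n y (L k))) = n"
  using sum_over_classes[of "\<lambda>_. 1"] by (simp add: class_size_def)

text \<open>
  Each U-statistic contains the additive part with total weight \<open>2 / card I\<close> on every index. After
  multiplication by \<open>n\<^sub>k / n\<close> this is \<open>2 / n\<close> for each observation, the same as in the overall U-statistic, and
  the classes partition the sample.
\<close>

lemma gCov_eq_weighted_sum:
  assumes n: "n \<ge> 2"
    and e: "\<And>i j. i \<in> {1..n} \<Longrightarrow> j \<in> {1..n} \<Longrightarrow> i < j \<Longrightarrow> edist p (x i) (x j) = e i j + u i + u j"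
  shows "gCov K p L n x y = (\<Sum>j=1..n. \<Sum>i=1..<j. gini_weight K L n y i j * e i j)"
proof -
  let ?I = "\<lambda>k. class_idx n y (L k)"
  let ?E = "\<lambda>I. \<Sum>j=1..n. \<Sum>i=1..<j. of_bool (i \<in> I \<and> j \<in> I) * e i j"
  have Uk: "phat n y (L k) * U_stat p (?I k) x = phat n y (L k) / real (class_size n y (L k) choose 2) * ?E (?I k)
     + 2 / n * (\<Sum>i\<in>?I k. u i)" if k: "k \<in> {1..K}" for k
  proof -
    have 2: "real (class_size n y (L k)) \<ge> 2" using size2[OF k] by simp
    have U: "U_stat p (?I k) x = ?E (?I k) / real (class_size n y (L k) choose 2) + 2 / real (class_size n y (L k)) * (\<Sum>i\<in>?I k. u i)"
      unfolding class_size_def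
      by (rule U_stat_additive_split[OF class_idx_sub]) (use e size2[OF k] in \<open>auto simp: class_size_def\<close>)
    have pm: "phat n y (L k) * (2 / real (class_size n y (L k))) = 2 / n"
      using 2 by (simp add: phat_def)
    show ?thesis unfolding U mult_split pm ..
  qed
  have Un: "U_stat p {1..n} x = 1 / real (n choose 2) * ?E {1..n} + 2 / n * (\<Sum>i=1..n. u i)"
    using U_stat_additive_split[of "{1..n}" n p x e u] e n by simp
  have "gCov K p L n x y = 1 / real (n choose 2) * ?E {1..n} - (\<Sum>k=1..K. phat n y (L k) / real (class_size n y (L k) choose 2) * ?E (?I k))
    + (2 / n * (\<Sum>i=1..n. u i) - 2 / n * (\<Sum>k=1..K. \<Sum>i\<in>?I k. u i))"
  proof -
    have "(\<Sum>k=1..K. phat n y (L k) * U_stat p (?I k) x)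
      = (\<Sum>k=1..K. phat n y (L k) / real (class_size n y (L k) choose 2) * ?E (?I k) + 2 / n * (\<Sum>i\<in>?I k. u i))"
      by (intro sum.cong refl Uk)
    then show ?thesis unfolding gCov_def Un sum.distrib sum_distrib_left[symmetric] by linarith
  qed
  also have "\<dots> = 1 / real (n choose 2) * ?E {1..n} - (\<Sum>k=1..K. phat n y (L k) / real (class_size n y (L k) choose 2) * ?E (?I k))"
    unfolding sum_over_classes by simp
  also have "?E {1..n} = (\<Sum>j=1..n. \<Sum>i=1..<j. e i j)"
    by (intro sum.cong refl) auto
  also have "(\<Sum>k=1..K. phat n y (L k) / real (class_size n y (L k) choose 2) * ?E (?I k))
    = (\<Sum>j=1..n. \<Sum>i=1..<j. (\<Sum>k=1..K. phat n y (L k) / real (class_size n y (L k) choose 2) * of_bool (y i = L k \<and> y j = L k)) * e i j)"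
  proof -
    have "(\<Sum>k=1..K. phat n y (L k) / real (class_size n y (L k) choose 2) * ?E (?I k))
     = (\<Sum>k=1..K. \<Sum>j=1..n. \<Sum>i=1..<j. phat n y (L k) / real (class_size n y (L k) choose 2) * of_bool (y i = L k \<and> y j = L k) * e i j)"
      unfolding sum_distrib_left by (intro sum.cong refl) (auto simp: class_idx_def)
    also have "\<dots> = (\<Sum>j=1..n. \<Sum>i=1..<j. \<Sum>k=1..K. phat n y (L k) / real (class_size n y (L k) choose 2) * of_bool (y i = L k \<and> y j = L k) * e i j)"
      by (rule trans[OF sum.swap], rule sum.cong[OF refl], rule sum.swap)
    finally show ?thesis by (simp only: sum_distrib_right)
  qed
  finally show ?thesis
    unfolding gini_weight_def left_diff_distrib sum_subtractf sum_distrib_left .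
qed

text \<open>
  A pair lies in at most one class, so the square of the class term has no mixed products. The cross term
  equals \<open>-2 / (n choose 2)\<close> since the class proportions sum to one.
\<close>

lemma weight_square_sum:
  assumes n: "n \<ge> 2"
  shows "(\<Sum>j=1..n. \<Sum>i=1..<j. (gini_weight K L n y i j)^2) = weight_sq K L n y"
proof -
  let ?N = "real (n choose 2)" and ?c = "\<lambda>k. real (class_size n y (L k) choose 2)" and ?p = "\<lambda>k. phat n y (L k)"
  let ?b = "\<lambda>k i j. of_bool (y i = L k \<and> y j = L k) :: real"
  have N: "?N > 0" using n by (simp add: choose_2_real)
  have c: "?c k > 0" if "k \<in> {1..K}" for k using size2[OF that] by (simp add: choose_2_real)
  have cross: "(\<Sum>k=1..K. ?p k / ?c k * ?b k i j)^2 = (\<Sum>k=1..K. (?p k / ?c k)^2 * ?b k i j)" for i j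
  proof -
    have "(\<Sum>k=1..K. ?p k / ?c k * ?b k i j)^2 = (\<Sum>k=1..K. \<Sum>l=1..K. (?p k / ?c k * ?b k i j) * (?p l / ?c l * ?b l i j))"
      by (simp add: power2_eq_square sum_product)
    also have "\<dots> = (\<Sum>k=1..K. \<Sum>l=1..K. if l = k then (?p k / ?c k)^2 * ?b k i j else 0)"
      by (intro sum.cong refl) (auto simp: power2_eq_square inj_on_eq_iff[OF L])
    also have "\<dots> = (\<Sum>k=1..K. (?p k / ?c k)^2 * ?b k i j)" by (simp add: sum.delta)
    finally show ?thesis .
  qed
  have cnt: "(\<Sum>j=1..n. \<Sum>i=1..<j. ?b k i j) = ?c k" for k
  proof -
    have "(\<Sum>j=1..n. \<Sum>i=1..<j. ?b k i j) = (\<Sum>j=1..n. \<Sum>i=1..<j. of_bool (i \<in> class_idx n y (L k) \<and> j \<in> class_idx n y (L k)))"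
      by (intro sum.cong refl) (auto simp: class_idx_def)
    then show ?thesis using pair_count[OF class_idx_sub, of "L k"] by (simp add: class_size_def)
  qed
  have swap: "(\<Sum>j=1..n. \<Sum>i=1..<j. \<Sum>k=1..K. a k * ?b k i j) = (\<Sum>k=1..K. a k * ?c k)" for a
  proof -
    have "(\<Sum>k=1..K. \<Sum>j=1..n. \<Sum>i=1..<j. a k * ?b k i j) = (\<Sum>j=1..n. \<Sum>i=1..<j. \<Sum>k=1..K. a k * ?b k i j)"
      by (rule trans[OF sum.swap], rule sum.cong[OF refl], rule sum.swap)
    then show ?thesis by (simp only: sum_distrib_left[symmetric] cnt)
  qed
  have one: "(\<Sum>j=1..n. \<Sum>i=1..<j. (1/?N)^2) = 1 / ?N"
  proof -
    have "(\<Sum>j=1..n. \<Sum>i=1..<j. (1/?N)^2) = (1/?N)^2 * (\<Sum>j=1..n. \<Sum>i=1..<j. of_bool (i \<in> {1..n} \<and> j \<in> {1..n}))"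
      unfolding sum_distrib_left by (intro sum.cong refl) auto
    also have "\<dots> = 1 / ?N" unfolding pair_count[OF subset_refl] using N by (simp add: power2_eq_square)
    finally show ?thesis .
  qed
  have "(\<Sum>j=1..n. \<Sum>i=1..<j. (gini_weight K L n y i j)^2)
    = (\<Sum>j=1..n. \<Sum>i=1..<j. (1/?N)^2 - 2 / ?N * (\<Sum>k=1..K. ?p k / ?c k * ?b k i j) + (\<Sum>k=1..K. (?p k / ?c k)^2 * ?b k i j))"
    unfolding gini_weight_def power2_diff cross by (intro sum.cong refl) simp
  also have "\<dots> = 1 / ?N - 2 / ?N * (\<Sum>k=1..K. ?p k / ?c k * ?c k) + (\<Sum>k=1..K. (?p k / ?c k)^2 * ?c k)"
    by (simp only: sum.distrib sum_subtractf sum_distrib_left[symmetric] swap one)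
  also have "(\<Sum>k=1..K. ?p k / ?c k * ?c k) = (\<Sum>k=1..K. ?p k)"
    using c by (intro sum.cong refl) (metis less_irrefl nonzero_eq_divide_eq)
  also have "(\<Sum>k=1..K. ?p k) = 1"
    using sum_class_sizes n by (simp add: phat_def flip: sum_divide_distrib)
  also have "(\<Sum>k=1..K. (?p k / ?c k)^2 * ?c k) = (\<Sum>k=1..K. (?p k)^2 / ?c k)"
    using c by (intro sum.cong refl) (force simp: power2_eq_square)
  finally show ?thesis by (simp add: weight_sq_def)
qed

text \<open>
  Each class contributes at least \<open>2 / n\<^sup>2\<close>, and two classes already outweigh \<open>1 / (n choose 2) \<le> 3 / n\<^sup>2\<close>.
  Together with the upper bound on the weights this makes the standardized weights \<open>O(1/n)\<close>.
\<close>

lemma weight_sq_lower: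
  assumes n: "n \<ge> 3" and K: "K \<ge> 2"
  shows "weight_sq K L n y \<ge> 1 / (real n)^2"
proof -
  have n3: "real n \<ge> 3" using n by simp
  have k: "(phat n y (L k))^2 / real (class_size n y (L k) choose 2) \<ge> 2 / (real n)^2" if k: "k \<in> {1..K}" for k
  proof -
    let ?m = "real (class_size n y (L k))"
    have m: "?m \<ge> 2" using size2[OF k] by simp
    have "(phat n y (L k))^2 / real (class_size n y (L k) choose 2) = 2 / (real n)^2 * (?m / (?m - 1))"
      unfolding phat_def choose_2_real using m n3 by (intro class_term) auto
    moreover have "?m / (?m - 1) \<ge> 1" using m by simp
    ultimately show ?thesis using mult_left_mono[of 1 "?m / (?m - 1)" "2 / (real n)^2"] by simp
  qed
  have "4 / (real n)^2 \<le> real K * (2 / (real n)^2)" using K n3 by (simp add: field_simps)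
  also have "\<dots> = (\<Sum>k=1..K. 2 / (real n)^2)" by simp
  also have "\<dots> \<le> (\<Sum>k=1..K. (phat n y (L k))\<^sup>2 / real (class_size n y (L k) choose 2))"
    by (rule sum_mono) (rule k)
  finally have 1: "4 / (real n)^2 \<le> (\<Sum>k=1..K. (phat n y (L k))\<^sup>2 / real (class_size n y (L k) choose 2))" .
  have "1 / real (n choose 2) \<le> 3 / (real n)^2"
  proof -
    have "1 / real (n choose 2) = 2 / (real n * (real n - 1))" by (simp add: choose_2_real)
    also have "\<dots> \<le> 3 / (real n)^2"
    proof -
      have "2 * real n \<le> 3 * (real n - 1)" using n3 by simp
      then have "2 * real n * real n \<le> 3 * (real n - 1) * real n" using n3 by (intro mult_right_mono) auto
      then show ?thesis using n3 by (simp add: field_simps power2_eq_square)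
    qed
    finally show ?thesis .
  qed
  then show ?thesis using 1 unfolding weight_sq_def by (simp add: diff_divide_distrib[symmetric])
qed

lemma gini_weight_bound:
  fixes c0 :: real
  assumes n: "n \<ge> 2" and c0: "c0 > 0" "\<And>k. k \<in> {1..K} \<Longrightarrow> real (class_size n y (L k)) \<ge> c0 * n"
  shows "\<bar>gini_weight K L n y i j\<bar> \<le> (4 + 4 / c0) / (real n)^2"
proof -
  have n2: "real n \<ge> 2" using n by simp
  let ?a = "\<lambda>k. phat n y (L k) / real (class_size n y (L k) choose 2)"
  let ?b = "\<lambda>k. of_bool (y i = L k \<and> y j = L k) :: real"
  have a: "0 \<le> ?a k" "?a k \<le> 4 / c0 / (real n)^2" if k: "k \<in> {1..K}" for k
  proof -
    let ?m = "real (class_size n y (L k))"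
    have m: "?m \<ge> 2" using size2[OF k] by simp
    have "?a k = 2 / (real n * (?m - 1))" using m by (simp add: phat_def choose_2_real)
    also have "\<dots> \<le> 2 / (real n * (c0 * n / 2))"
      using m c0(1) c0(2)[OF k] n2 by (intro divide_left_mono mult_left_mono mult_pos_pos) auto
    finally show "?a k \<le> 4 / c0 / (real n)^2" using n2 c0 by (simp add: power2_eq_square field_simps)
    show "0 \<le> ?a k" by (simp add: phat_def)
  qed
  have "0 \<le> (\<Sum>k=1..K. ?a k * ?b k)" by (intro sum_nonneg mult_nonneg_nonneg a) auto
  moreover have "(\<Sum>k=1..K. ?a k * ?b k) \<le> 4 / c0 / (real n)^2"
  proof -
    have "(\<Sum>k=1..K. ?a k * ?b k) \<le> (\<Sum>k=1..K. 4 / c0 / (real n)^2 * of_bool (y i = L k))"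
      using a c0 by (intro sum_mono mult_mono) auto
    also have "\<dots> = 4 / c0 / (real n)^2 * (\<Sum>k=1..K. of_bool (y i = L k))" by (simp only: sum_distrib_left)
    also have "\<dots> \<le> 4 / c0 / (real n)^2 * 1"
    proof (rule mult_left_mono)
    show "(\<Sum>k=1..K. of_bool (y i = L k)) \<le> (1::real)"
    proof (cases "y i \<in> L ` {1..K}")
      case True
      then obtain k where k: "k \<in> {1..K}" "y i = L k" by auto
      have "(\<Sum>l=1..K. of_bool (y i = L l)) = (\<Sum>l=1..K. if l = k then 1 else 0 :: real)"
        by (intro sum.cong refl) (use k in \<open>auto simp: inj_on_eq_iff[OF L]\<close>)
      then show ?thesis using k by simp
    next
      case False
      then have "(\<Sum>l=1..K. of_bool (y i = L l)) = (\<Sum>l=1..K. 0 :: real)" by (intro sum.cong refl) auto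
      then show ?thesis by simp
    qed
    qed (use c0 in simp)
    finally show ?thesis by simp
  qed
  moreover have "0 \<le> 1 / real (n choose 2)" "1 / real (n choose 2) \<le> 4 / (real n)^2"
  proof -
    have "1 / real (n choose 2) = 2 / (real n * (real n - 1))" by (simp add: choose_2_real)
    also have "\<dots> \<le> 2 / (real n * (real n / 2))" using n2 by (intro divide_left_mono mult_left_mono) auto
    finally show "1 / real (n choose 2) \<le> 4 / (real n)^2" by (simp add: power2_eq_square)
  qed simp
  ultimately show ?thesis unfolding gini_weight_def add_divide_distrib by linarith
qed

end

section \<open>The double centered distance as a degenerate kernel\<close>

lemma edist_nonneg: "0 \<le> edist p x y" by (simp add: edist_def enorm_def)

lemma edist_self[simp]: "edist p x x = 0" by (simp add: edist_def enorm_def L2_set_def)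

lemma edist_sym: "edist p x y = edist p y x"
  by (simp add: edist_def enorm_def L2_set_def power2_commute)

lemma edist_le: "edist p x y \<le> enorm p x + enorm p y"
proof -
  have "L2_set (\<lambda>i. x i + - y i) {..<p} \<le> L2_set x {..<p} + L2_set (\<lambda>i. - y i) {..<p}"
    by (rule L2_set_triangle_ineq)
  also have "L2_set (\<lambda>i. - y i) {..<p} = L2_set y {..<p}" by (simp add: L2_set_def)
  finally show ?thesis by (simp add: edist_def enorm_def)
qed

lemma enorm_nonneg: "0 \<le> enorm p x" by (simp add: enorm_def)

lemma measurable_euclid_component:
  "i < p \<Longrightarrow> f \<in> N \<rightarrow>\<^sub>M euclid p \<Longrightarrow> (\<lambda>x. f x i) \<in> borel_measurable N"
  unfolding euclid_def by (rule measurable_component_singleton[THEN measurable_compose_rev]) auto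

lemma measurable_enorm[measurable (raw)]:
  "f \<in> N \<rightarrow>\<^sub>M euclid p \<Longrightarrow> (\<lambda>x. enorm p (f x)) \<in> borel_measurable N"
  unfolding enorm_def L2_set_def
  by (rule measurable_compose[OF _ borel_measurable_sqrt], intro borel_measurable_sum borel_measurable_power)
     (auto intro: measurable_euclid_component)

lemma measurable_edist[measurable (raw)]:
  "f \<in> N \<rightarrow>\<^sub>M euclid p \<Longrightarrow> g \<in> N \<rightarrow>\<^sub>M euclid p \<Longrightarrow> (\<lambda>x. edist p (f x) (g x)) \<in> borel_measurable N"
  unfolding edist_def enorm_def L2_set_def
  by (rule measurable_compose[OF _ borel_measurable_sqrt], intro borel_measurable_sum borel_measurable_power borel_measurable_diff)
     (auto intro: measurable_euclid_component)

lemma centering_arith: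
  fixes n :: real
  assumes "n > 2"
  shows "e + uk + ul - (rl + S + (n - 2) * ul) / (n - 2) - (rk + S + (n - 2) * uk) / (n - 2)
      + (T + 2 * (n - 1) * S) / ((n - 1) * (n - 2))
    = e - rk / (n - 2) - rl / (n - 2) + T / ((n - 1) * (n - 2))"
proof -
  have "(r + S + (n - 2) * v) / (n - 2) = r / (n - 2) + S / (n - 2) + v" for r v
    using assms by (simp add: add_divide_distrib)
  moreover have "(T + 2 * (n - 1) * S) / ((n - 1) * (n - 2)) = T / ((n - 1) * (n - 2)) + 2 * (S / (n - 2))"
  proof -
    have "2 * (n - 1) * S / ((n - 1) * (n - 2)) = 2 * (S / (n - 2))" using assms by (simp add: divide_simps)
    then show ?thesis unfolding add_divide_distrib by simp
  qed
  ultimately show ?thesis by simp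
qed

locale euclid_law = prob_space F for F :: "(nat \<Rightarrow> real) measure" and p :: nat +
  assumes sets_F[measurable_cong]: "sets F = sets (euclid p)"
    and norm_moment: "integrable F (\<lambda>x. enorm p x ^ 4)"
begin

lemma norm_moment4: "has_moment F 4 (enorm p)"
  unfolding has_moment_def using norm_moment by (auto simp: power_even_abs)

lemma norm_integrable: "integrable F (enorm p)"
  using has_moment_mono[OF norm_moment4, of 1] by (simp add: has_moment_1)

definition "mean_norm = (\<integral>x. enorm p x \<partial>F)"
definition "mean_dist x = (\<integral>z. edist p x z \<partial>F)"
definition "gini_diff = (LINT w|(F \<Otimes>\<^sub>M F). edist p (fst w) (snd w))"

lemma mean_norm_nonneg: "0 \<le> mean_norm" by (simp add: mean_norm_def enorm_nonneg)

lemma edist_integrable: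
  assumes x: "x \<in> space F"
  shows "integrable F (\<lambda>z. edist p x z)"
proof (rule Bochner_Integration.integrable_bound)
  show "integrable F (\<lambda>z. enorm p x + enorm p z)" using norm_integrable by simp
  show "(\<lambda>z. edist p x z) \<in> borel_measurable F"
    by (rule measurable_edist) (use x sets_eq_imp_space_eq[OF sets_F] measurable_ident_sets[OF sets_F] in auto)
qed (use edist_le edist_nonneg in \<open>auto simp: enorm_nonneg\<close>)

lemma mean_dist_measurable[measurable]: "mean_dist \<in> borel_measurable F"
  unfolding mean_dist_def[abs_def] by measurable

lemma mean_dist_bound: "x \<in> space F \<Longrightarrow> 0 \<le> mean_dist x" "x \<in> space F \<Longrightarrow> mean_dist x \<le> enorm p x + mean_norm"
proof -
  show "0 \<le> mean_dist x" by (simp add: mean_dist_def edist_nonneg)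
  assume x: "x \<in> space F"
  have "mean_dist x \<le> (\<integral>z. enorm p x + enorm p z \<partial>F)"
    unfolding mean_dist_def by (rule integral_mono) (use edist_integrable[OF x] norm_integrable edist_le in auto)
  then show "mean_dist x \<le> enorm p x + mean_norm" using norm_integrable by (simp add: prob_space mean_norm_def)
qed

lemma mean_dist_integrable: "integrable F mean_dist"
  by (rule Bochner_Integration.integrable_bound[of _ "\<lambda>z. enorm p z + mean_norm"])
     (use norm_integrable mean_dist_bound mean_norm_nonneg in \<open>auto simp: enorm_nonneg\<close>)

lemma gini_diff_eq: "gini_diff = (\<integral>x. mean_dist x \<partial>F)"
proof -
  interpret P: pair_prob_space F F ..
  have "integrable (F \<Otimes>\<^sub>M F) (\<lambda>w. edist p (fst w) (snd w))"
  proof (rule P.Fubini_integrable)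
    show "integrable F (\<lambda>x. \<integral>y. norm (edist p (fst (x, y)) (snd (x, y))) \<partial>F)"
      using mean_dist_integrable by (simp add: mean_dist_def[abs_def] edist_nonneg)
    show "AE x in F. integrable F (\<lambda>y. edist p (fst (x, y)) (snd (x, y)))"
      by (auto intro!: AE_I2 edist_integrable)
  qed measurable
  from P.integral_fst'[OF this] show ?thesis by (simp add: gini_diff_def mean_dist_def)
qed

lemma gini_diff_bound: "0 \<le> gini_diff" "gini_diff \<le> 2 * mean_norm"
proof -
  show "0 \<le> gini_diff" by (simp add: gini_diff_def edist_nonneg)
  have "gini_diff \<le> (\<integral>x. enorm p x + mean_norm \<partial>F)"
    unfolding gini_diff_eq by (rule integral_mono) (use mean_dist_integrable norm_integrable mean_dist_bound in auto)
  then show "gini_diff \<le> 2 * mean_norm" using norm_integrable by (simp add: prob_space mean_norm_def)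
qed

lemma dcdist_eq: "dcdist p F x y = edist p x y - mean_dist x - mean_dist y + gini_diff"
  by (simp add: dcdist_def mean_dist_def gini_diff_def edist_sym[of p _ y])

sublocale d: degenerate_kernel4 F "dcdist p F" "\<lambda>x. 2 * enorm p x + 2 * mean_norm"
proof
  show "(\<lambda>(x, y). dcdist p F x y) \<in> borel_measurable (F \<Otimes>\<^sub>M F)"
    unfolding dcdist_eq case_prod_unfold by measurable
  show "dcdist p F x y = dcdist p F y x" for x y by (simp add: dcdist_eq edist_sym[of p x y])
  show "\<bar>dcdist p F x y\<bar> \<le> 2 * enorm p x + 2 * mean_norm + (2 * enorm p y + 2 * mean_norm)"
    if "x \<in> space F" "y \<in> space F" for x y
    using edist_le[of p x y] edist_nonneg[of p x y] mean_dist_bound[OF that(1)] mean_dist_bound[OF that(2)]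
      gini_diff_bound enorm_nonneg[of p x] enorm_nonneg[of p y]
    unfolding dcdist_eq by linarith
  show m4: "has_moment F 4 (\<lambda>x. 2 * enorm p x + 2 * mean_norm)"
    by (intro has_moment_add has_moment_cmult has_moment_const norm_moment4)
  show "has_moment F 2 (\<lambda>x. 2 * enorm p x + 2 * mean_norm)"
    by (rule has_moment_mono[OF m4]) simp
  show "(\<integral>z. dcdist p F x z \<partial>F) = 0" if x: "x \<in> space F" for x
    using edist_integrable[OF x] mean_dist_integrable
    by (simp add: dcdist_eq prob_space mean_dist_def[of x, symmetric] gini_diff_eq[symmetric])
qed

lemma d_moment_2: "d_moment p F 2 = d.K_second"
  using d.K_power_iid[of 2] by (simp add: d_moment_def iid4_def d.K_second_def)

lemma d_moment_4: "d_moment p F 4 = d.K_fourth"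
  using d.K_power_iid[of 4] by (simp add: d_moment_def iid4_def d.K_fourth_def)

lemma d_cycle_eq: "d_cycle p F = d.K_cycle"
  using d.K_cycle_iid by (simp add: d_cycle_def iid4_def)

text \<open>
  Half of \<open>gini_diff\<close> goes to each argument, so that the distance is the kernel plus a sum of offsets.
\<close>

definition "offset x = mean_dist x - gini_diff / 2"

lemma edist_split: "i \<noteq> j \<Longrightarrow> edist p (x i) (x j) = d.offdiag x i j + offset (x i) + offset (x j)"
  by (cases "i < j") (auto simp: d.offdiag_def dcdist_eq offset_def min_def max_def edist_sym)

lemma edist_row:
  assumes l: "l \<in> {1..n}"
  shows "(\<Sum>i=1..n. edist p (x i) (x l)) = d.row_sum n x l + (\<Sum>i=1..n. offset (x i)) + (real n - 2) * offset (x l)"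
proof -
  have "(\<Sum>i=1..n. edist p (x i) (x l)) = (\<Sum>i=1..n. d.offdiag x l i + (offset (x i) + offset (x l)) - (if i = l then 2 * offset (x l) else 0))"
    by (intro sum.cong refl) (auto simp: edist_split d.offdiag_sym)
  also have "\<dots> = d.row_sum n x l + ((\<Sum>i=1..n. offset (x i)) + n * offset (x l)) - 2 * offset (x l)"
    using l by (simp add: sum.distrib sum_subtractf d.row_sum_def)
  finally show ?thesis by (simp add: algebra_simps)
qed

text \<open>
  The centering annihilates matrices that are additive off a zero diagonal, so distances may be replaced by the
  kernel.
\<close>

lemma A_centered_eq:
  assumes n: "n \<ge> 4" and k: "k \<in> {1..n}" and l: "l \<in> {1..n}" and kl: "k \<noteq> l"
  shows "A_centered p n x k l = d.offdiag x k l - d.row_sum n x k / (real n - 2) - d.row_sum n x l / (real n - 2)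
    + d.pair_total n x / ((real n - 1) * (real n - 2))"
proof -
  have n4: "real n \<ge> 4" using n by simp
  let ?S = "\<Sum>i=1..n. offset (x i)" and ?T = "d.pair_total n x"
  have r: "(\<Sum>j=1..n. edist p (x k) (x j)) = d.row_sum n x k + ?S + (real n - 2) * offset (x k)"
    using edist_row[OF k, of x] by (simp add: edist_sym[of p "x k"])
  have "(\<Sum>i=1..n. \<Sum>j=1..n. edist p (x i) (x j)) = (\<Sum>i=1..n. d.row_sum n x i + ?S + (real n - 2) * offset (x i))"
  proof (rule sum.cong[OF refl])
    fix i assume "i \<in> {1..n}"
    from edist_row[OF this, of x] show "(\<Sum>j=1..n. edist p (x i) (x j)) = d.row_sum n x i + ?S + (real n - 2) * offset (x i)"
      by (simp add: edist_sym[of p "x i"])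
  qed
  also have "\<dots> = ?T + 2 * (real n - 1) * ?S"
    by (simp add: sum.distrib d.row_sum_def left_diff_distrib sum_subtractf flip: sum_distrib_left)
  finally have t: "(\<Sum>i=1..n. \<Sum>j=1..n. edist p (x i) (x j)) = ?T + 2 * (real n - 1) * ?S" .
  show ?thesis
    unfolding A_centered_def r t edist_row[OF l] edist_split[OF kl]
    by (rule centering_arith) (use n4 in auto)
qed

lemma V2_eq: "n \<ge> 4 \<Longrightarrow> V2 p n x = d.vstat n x"
proof -
  assume n: "n \<ge> 4"
  have "(\<Sum>(k, l) \<in> {(k, l). k \<in> {1..n} \<and> l \<in> {1..n} \<and> k \<noteq> l}. (A_centered p n x k l)\<^sup>2)
     = (\<Sum>k=1..n. \<Sum>l\<in>{1..n} - {k}. (A_centered p n x k l)^2)"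
    by (subst sum.Sigma) (auto intro!: sum.cong)
  also have "\<dots> = (\<Sum>k=1..n. \<Sum>l\<in>{1..n} - {k}. (d.offdiag x k l - d.row_sum n x k / (real n - 2) - d.row_sum n x l / (real n - 2)
    + d.pair_total n x / ((real n - 1) * (real n - 2)))^2)"
    by (intro sum.cong refl) (subst A_centered_eq[OF n]; simp)
  also have "\<dots> = d.square_sum n x - 2 / (real n - 2) * (\<Sum>k=1..n. (d.row_sum n x k)^2)
     + d.pair_total n x^2 / ((real n - 1) * (real n - 2))"
    unfolding d.row_sum_def by (rule u_centering[OF n]) (auto simp: d.offdiag_sym)
  finally show "V2 p n x = d.vstat n x" by (simp add: V2_def d.vstat_def)
qed

end

definition gini_stat :: "nat \<Rightarrow> nat \<Rightarrow> (nat \<Rightarrow> 'l) \<Rightarrow> nat \<Rightarrow> (nat \<Rightarrow> nat \<Rightarrow> real) \<Rightarrow> (nat \<Rightarrow> 'l) \<Rightarrow> real" where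
  "gini_stat K p L n x y = Delta_hat p n x / sigma0_hat K p L n x y * gCor K p L n x y"

text \<open>
  If the overall mean difference vanishes, all observations coincide and the covariance is zero as well, so
  the convention for division by zero agrees with the cancelled form.
\<close>

lemma gini_stat_eq:
  assumes n: "n \<ge> 2"
  shows "gini_stat K p L n x y = gCov K p L n x y / sigma0_hat K p L n x y"
proof (cases "Delta_hat p n x = 0")
  case True
  let ?P = "\<lambda>I. {(i, j). i \<in> I \<and> j \<in> I \<and> i < (j::nat)}"
  have fin: "finite (?P {1..n})" by (rule finite_subset[of _ "{1..n} \<times> {1..n}"]) auto
  have "real (card {1..n} choose 2) > 0" using n by (simp add: choose_2_real)
  then have "(\<Sum>(i, j) \<in> ?P {1..n}. edist p (x i) (x j)) = 0"
    using True by (simp add: Delta_hat_def U_stat_def)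
  then have z: "edist p (x i) (x j) = 0" if "(i, j) \<in> ?P {1..n}" for i j
    using that by (subst (asm) sum_nonneg_eq_0_iff[OF fin]) (auto simp: edist_nonneg)
  have U0: "U_stat p I x = 0" if "I \<subseteq> {1..n}" for I
  proof -
    have "(\<Sum>(i, j) \<in> ?P I. edist p (x i) (x j)) = 0"
      by (rule sum.neutral) (use z subsetD[OF that] in auto)
    then show ?thesis by (simp add: U_stat_def)
  qed
  have "class_idx n y l \<subseteq> {1..n}" for l by (auto simp: class_idx_def)
  then have "gCov K p L n x y = 0" by (simp add: gCov_def U0)
  then show ?thesis by (simp add: gini_stat_def True)
qed (simp add: gini_stat_def gCor_def)

context euclid_law
begin

text \<open>
  For fixed labels the statistic is the studentized U-statistic with weights standardized to unit variance.
  The constant \<open>4 + 4 / c0\<close> comes from the bounds on the weights when all classes have at least \<open>c0 n\<close> members.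
\<close>

theorem labelled_cf_bound:
  fixes y :: "nat \<Rightarrow> 'l" and c0 t :: real
  assumes K: "K \<ge> 2" and L: "inj_on L {1..K}" and y: "\<And>i. i \<in> {1..n} \<Longrightarrow> y i \<in> L ` {1..K}"
    and n: "n \<ge> 6" and size2: "\<And>k. k \<in> {1..K} \<Longrightarrow> class_size n y (L k) \<ge> 2"
    and c0: "c0 > 0" "\<And>k. k \<in> {1..K} \<Longrightarrow> real (class_size n y (L k)) \<ge> c0 * n"
    and pos: "d_moment p F 2 > 0"
    and small: "20 * sqrt (d_moment p F 4 / (n * (d_moment p F 2)^2)) + 28 / n \<le> 1 / 4"
  shows "cmod ((CLINT x|iid F n. iexp (t * gini_stat K p L n x y)) - of_real (exp (- (t^2 / 2))))
    \<le> clt_error t (4 + 4 / c0) (d_moment p F 4 / (n * (d_moment p F 2)^2)) (d_cycle p F / (d_moment p F 2)^2) n"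
proof -
  let ?w = "gini_weight K L n y" and ?s = "sqrt (weight_sq K L n y)" and ?m = "sqrt d.K_second"
  define c where "c = (\<lambda>i j. 1 / (?s * ?m) * ?w i j)"
  have m0: "d.K_second > 0" using pos by (simp add: d_moment_2)
  have n0: "real n > 0" using n by simp
  have s2: "weight_sq K L n y \<ge> 1 / (real n)^2"
    by (rule weight_sq_lower[OF L y size2]) (use n K in auto)
  then have s: "?s \<ge> 1 / n" using real_sqrt_le_mono[OF s2] n0 by (simp add: real_sqrt_divide)
  then have s0: "?s > 0" using n0 by (meson divide_pos_pos less_le_trans zero_less_one)
  have stat: "gini_stat K p L n x y = d.ustat c n x * sqrt (d.K_second / d.vstat n x)" for x
  proof -
    have "gCov K p L n x y = (\<Sum>j=1..n. \<Sum>i=1..<j. ?w i j * d.offdiag x i j)"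
      by (rule gCov_eq_weighted_sum[OF L y size2, where u="\<lambda>i. offset (x i)"]) (use n edist_split in auto)
    also have "\<dots> = d.ustat ?w n x"
      unfolding d.ustat_def by (intro sum.cong refl) auto
    finally have 1: "gCov K p L n x y = d.ustat ?w n x" .
    have 2: "sigma0_hat K p L n x y = ?s * sqrt (d.vstat n x)"
      unfolding sigma0_hat_def sigma0_sq_hat_def weight_sq_def[symmetric] real_sqrt_mult
      using n by (simp add: V2_eq)
    have "gini_stat K p L n x y = d.ustat ?w n x / (?s * sqrt (d.vstat n x))"
      using gini_stat_eq[of n K p L x y] n by (simp add: 1 2)
    also have "\<dots> = 1 / (?s * ?m) * d.ustat ?w n x * sqrt (d.K_second / d.vstat n x)"
      using m0 by (simp add: real_sqrt_divide)
    finally show ?thesis unfolding c_def d.ustat_scale .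
  qed
  have "cmod ((CLINT x|iid F n. iexp (t * (d.ustat c n x * sqrt (d.K_second / d.vstat n x)))) - of_real (exp (- (t^2 / 2))))
    \<le> clt_error t (4 + 4 / c0) (d.K_fourth / (n * d.K_second^2)) (d.K_cycle / d.K_second^2) n"
  proof (rule d.studentized_cf_bound[OF n m0])
    show "4 + 4 / c0 > 0" using c0 by (simp add: add_pos_pos)
    show "20 * sqrt (d.K_fourth / (n * d.K_second^2)) + 28 / n \<le> 1 / 4"
      using small by (simp add: d_moment_2 d_moment_4)
    show "\<bar>c i j\<bar> \<le> (4 + 4 / c0) / (n * ?m)" for i j
    proof -
      have "\<bar>?w i j\<bar> \<le> (4 + 4 / c0) / (real n)^2"
        by (rule gini_weight_bound[OF L y size2]) (use n c0 in auto)
      then have "\<bar>c i j\<bar> \<le> 1 / (?s * ?m) * ((4 + 4 / c0) / (real n)^2)"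
        using s0 m0 unfolding c_def abs_mult by (intro mult_mono) auto
      also have "\<dots> \<le> 1 / (1 / n * ?m) * ((4 + 4 / c0) / (real n)^2)"
        using s s0 m0 n0 c0 by (intro mult_right_mono divide_left_mono) auto
      also have "\<dots> = (4 + 4 / c0) / (n * ?m)" using n0 m0 by (simp add: power2_eq_square)
      finally show ?thesis .
    qed
    have "(\<Sum>j=1..n. \<Sum>i=1..<j. (c i j)^2) = (1 / (?s * ?m))^2 * (\<Sum>j=1..n. \<Sum>i=1..<j. (?w i j)^2)"
      unfolding c_def power_mult_distrib sum_distrib_left ..
    also have "(\<Sum>j=1..n. \<Sum>i=1..<j. (?w i j)^2) = weight_sq K L n y"
      by (rule weight_square_sum[OF L y size2]) (use n in auto)
    also have "weight_sq K L n y = ?s^2" using s0 by simp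
    finally show "d.K_second * (\<Sum>j=1..n. \<Sum>i=1..<j. (c i j)^2) = 1"
      using s0 m0 by (simp add: power_divide power_mult_distrib)
  qed
  then show ?thesis unfolding stat by (simp add: d_moment_2 d_moment_4 d_cycle_eq)
qed

end

section \<open>Conditioning on the labels\<close>

lemma U_stat_cong: "(\<And>i. i \<in> I \<Longrightarrow> x i = x' i) \<Longrightarrow> U_stat p I x = U_stat p I x'"
  unfolding U_stat_def by (intro arg_cong2[where f="(/)"] refl sum.cong) auto

lemma class_idx_cong: "(\<And>i. i \<in> {1..n} \<Longrightarrow> y i = y' i) \<Longrightarrow> class_idx n y = class_idx n y'"
  by (auto simp: class_idx_def fun_eq_iff)

lemma A_centered_cong:
  assumes "\<And>i. i \<in> {1..n} \<Longrightarrow> x i = x' i" "k \<in> {1..n}" "l \<in> {1..n}"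
  shows "A_centered p n x k l = A_centered p n x' k l"
proof -
  have "(\<Sum>i=1..n. edist p (x i) (x l)) = (\<Sum>i=1..n. edist p (x' i) (x' l))"
    "(\<Sum>j=1..n. edist p (x k) (x j)) = (\<Sum>j=1..n. edist p (x' k) (x' j))"
    "(\<Sum>i=1..n. \<Sum>j=1..n. edist p (x i) (x j)) = (\<Sum>i=1..n. \<Sum>j=1..n. edist p (x' i) (x' j))"
    using assms by (auto intro!: sum.cong)
  then show ?thesis using assms by (simp add: A_centered_def)
qed

text \<open>
  The statistic reads only the indices \<open>1, \<dots>, n\<close>. This allows the sample to be replaced by its restriction,
  a point of the finite product space.
\<close>

lemma gini_stat_cong:
  assumes x: "\<And>i. i \<in> {1..n} \<Longrightarrow> x i = x' i" and y: "\<And>i. i \<in> {1..n} \<Longrightarrow> y i = y' i"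
  shows "gini_stat K p L n x y = gini_stat K p L n x' y'"
proof -
  have c: "class_idx n y = class_idx n y'" by (rule class_idx_cong) (rule y)
  have U: "U_stat p I x = U_stat p I x'" if "I \<subseteq> {1..n}" for I
    by (rule U_stat_cong) (use x that in auto)
  have sub: "class_idx n y' l \<subseteq> {1..n}" for l by (auto simp: class_idx_def)
  have V: "V2 p n x = V2 p n x'"
    unfolding V2_def using A_centered_cong[of n x x'] x
    by (intro arg_cong2[where f="(/)"] refl sum.cong) auto
  show ?thesis
    unfolding gini_stat_def Delta_hat_def gCor_def gCov_def sigma0_hat_def sigma0_sq_hat_def phat_def class_size_def c
      U[OF sub] U[OF order_refl] V ..
qed

lemma (in euclid_law) gini_stat_measurable: "(\<lambda>x. gini_stat K p L n x y) \<in> borel_measurable (iid F n)"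
proof -
  have e: "(\<lambda>x. edist p (x i) (x j)) \<in> borel_measurable (iid F n)" if "i \<in> {1..n}" "j \<in> {1..n}" for i j
    by (rule measurable_edist) (use that in \<open>auto intro!: measurable_component_singleton simp: measurable_cong_sets[OF refl sets_F, symmetric]\<close>)
  have U: "(\<lambda>x. U_stat p I x) \<in> borel_measurable (iid F n)" if "I \<subseteq> {1..n}" for I
    unfolding U_stat_def case_prod_unfold
    by (intro borel_measurable_divide borel_measurable_sum borel_measurable_const e) (use that in auto)
  have sub: "class_idx n y l \<subseteq> {1..n}" for l by (auto simp: class_idx_def)
  have V: "(\<lambda>x. V2 p n x) \<in> borel_measurable (iid F n)"
    unfolding V2_def A_centered_def case_prod_unfold
    by (intro borel_measurable_divide borel_measurable_sum borel_measurable_const borel_measurable_power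
        borel_measurable_add borel_measurable_diff e) auto
  show ?thesis
    unfolding gini_stat_def Delta_hat_def gCor_def gCov_def sigma0_hat_def sigma0_sq_hat_def
    by (intro borel_measurable_times borel_measurable_divide borel_measurable_diff borel_measurable_sum borel_measurable_const
        U[OF sub] U[OF order_refl] V measurable_compose[OF _ borel_measurable_sqrt])
qed

text \<open>
  One stage of the asymptotic sequence, with dimension, sample size and law fixed.
\<close>

locale labelled_sample = prob_space M for M :: "'a measure" +
  fixes p n :: nat and S :: "'l set" and X :: "'a \<Rightarrow> nat \<Rightarrow> real" and Y :: "'a \<Rightarrow> 'l"
    and Xs :: "nat \<Rightarrow> 'a \<Rightarrow> nat \<Rightarrow> real" and Ys :: "nat \<Rightarrow> 'a \<Rightarrow> 'l" and F :: "(nat \<Rightarrow> real) measure"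
  assumes finS: "finite S"
    and X: "X \<in> M \<rightarrow>\<^sub>M euclid p" and Y: "Y \<in> M \<rightarrow>\<^sub>M count_space S"
    and F: "F = distr M (euclid p) X"
    and sample: "iid_sample M p S n X Y Xs Ys"
    and indep: "indep_rvs M (euclid p) X (count_space S) Y"
begin

lemma sets_F: "sets F = sets (euclid p)" by (simp add: F)

lemma prob_F: "prob_space F" unfolding F by (rule prob_space_distr[OF X])

lemma pair_measurable: "i \<in> {1..n} \<Longrightarrow> (\<lambda>\<omega>. (Xs i \<omega>, Ys i \<omega>)) \<in> M \<rightarrow>\<^sub>M euclid p \<Otimes>\<^sub>M count_space S"
  using sample unfolding iid_sample_def indep_vars_def by auto

lemma Xs_measurable: "i \<in> {1..n} \<Longrightarrow> Xs i \<in> M \<rightarrow>\<^sub>M euclid p"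
  using measurable_compose[OF pair_measurable measurable_fst] by simp

lemma Ys_measurable: "i \<in> {1..n} \<Longrightarrow> Ys i \<in> M \<rightarrow>\<^sub>M count_space S"
  using measurable_compose[OF pair_measurable measurable_snd] by simp

lemma Ys_in: "i \<in> {1..n} \<Longrightarrow> \<omega> \<in> space M \<Longrightarrow> Ys i \<omega> \<in> S"
  using measurable_space[OF Ys_measurable] by simp

definition "label_prob l = prob (Y -` {l} \<inter> space M)"

text \<open>
  The pair \<open>(Xs i, Ys i)\<close> has the law of \<open>(X, Y)\<close>, and \<open>X\<close> and \<open>Y\<close> are independent.
\<close>

lemma pair_prob:
  assumes i: "i \<in> {1..n}" and A: "A \<in> sets F" and B: "B \<subseteq> S"
  shows "prob ((\<lambda>\<omega>. (Xs i \<omega>, Ys i \<omega>)) -` (A \<times> B) \<inter> space M) = measure F A * prob (Y -` B \<inter> space M)"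
proof -
  have A': "A \<in> sets (euclid p)" using A sets_F by simp
  have AB: "A \<times> B \<in> sets (euclid p \<Otimes>\<^sub>M count_space S)" using A' B by auto
  have XY: "(\<lambda>\<omega>. (X \<omega>, Y \<omega>)) \<in> M \<rightarrow>\<^sub>M euclid p \<Otimes>\<^sub>M count_space S" using X Y by measurable
  have "distr M (euclid p \<Otimes>\<^sub>M count_space S) (\<lambda>\<omega>. (Xs i \<omega>, Ys i \<omega>)) = distr M (euclid p \<Otimes>\<^sub>M count_space S) (\<lambda>\<omega>. (X \<omega>, Y \<omega>))"
    using sample i unfolding iid_sample_def by blast
  then have "prob ((\<lambda>\<omega>. (Xs i \<omega>, Ys i \<omega>)) -` (A \<times> B) \<inter> space M) = prob ((\<lambda>\<omega>. (X \<omega>, Y \<omega>)) -` (A \<times> B) \<inter> space M)"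
    using measure_distr[OF pair_measurable[OF i] AB] measure_distr[OF XY AB] by simp
  also have "(\<lambda>\<omega>. (X \<omega>, Y \<omega>)) -` (A \<times> B) \<inter> space M = (X -` A \<inter> space M) \<inter> (Y -` B \<inter> space M)" by auto
  also have "prob \<dots> = prob (X -` A \<inter> space M) * prob (Y -` B \<inter> space M)"
  proof (rule indep_setD)
    show "indep_set (sigma_sets (space M) {X -` A \<inter> space M |A. A \<in> sets (euclid p)})
       (sigma_sets (space M) {Y -` B \<inter> space M |B. B \<in> sets (count_space S)})"
      using indep by (simp add: indep_rvs_def)
    show "X -` A \<inter> space M \<in> sigma_sets (space M) {X -` A \<inter> space M |A. A \<in> sets (euclid p)}"
      using A' by (intro sigma_sets.Basic) auto
    show "Y -` B \<inter> space M \<in> sigma_sets (space M) {Y -` B \<inter> space M |B. B \<in> sets (count_space S)}"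
      using B by (intro sigma_sets.Basic) auto
  qed
  also have "prob (X -` A \<inter> space M) = measure F A"
    unfolding F using measure_distr[OF X A'] by simp
  finally show ?thesis .
qed

definition Xvec :: "'a \<Rightarrow> nat \<Rightarrow> nat \<Rightarrow> real" where "Xvec \<omega> = (\<lambda>i\<in>{1..n}. Xs i \<omega>)"

definition Yvec :: "'a \<Rightarrow> nat \<Rightarrow> 'l" where "Yvec \<omega> = (\<lambda>i\<in>{1..n}. Ys i \<omega>)"

definition labelling :: "(nat \<Rightarrow> 'l) \<Rightarrow> 'a set" where
  "labelling y = {\<omega> \<in> space M. Yvec \<omega> = y}"

lemma Xvec_measurable: "Xvec \<in> M \<rightarrow>\<^sub>M iid F n"
  unfolding Xvec_def
  by (rule measurable_restrict) (use Xs_measurable in \<open>simp add: measurable_cong_sets[OF refl sets_F]\<close>)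

lemma labelling_eq:
  assumes "y \<in> {1..n} \<rightarrow>\<^sub>E S"
  shows "labelling y = {\<omega> \<in> space M. \<forall>i\<in>{1..n}. Ys i \<omega> = y i}"
  using assms unfolding labelling_def Yvec_def
  by (auto simp: fun_eq_iff PiE_iff extensional_def)

lemma labelling_sets:
  assumes y: "y \<in> {1..n} \<rightarrow>\<^sub>E S"
  shows "labelling y \<in> sets M"
proof -
  have "{\<omega> \<in> space M. Ys i \<omega> = y i} \<in> sets M" if "i \<in> {1..n}" for i
  proof -
    have "Ys i -` {y i} \<inter> space M \<in> sets M"
      by (rule measurable_sets[OF Ys_measurable[OF that]]) (use y that in auto)
    moreover have "Ys i -` {y i} \<inter> space M = {\<omega> \<in> space M. Ys i \<omega> = y i}" by auto
    ultimately show ?thesis by simp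
  qed
  then show ?thesis unfolding labelling_eq[OF y] by (intro sets.sets_Collect_finite_All) auto
qed

lemma Yvec_in: "\<omega> \<in> space M \<Longrightarrow> Yvec \<omega> \<in> {1..n} \<rightarrow>\<^sub>E S"
  using Ys_in by (auto simp: Yvec_def)

lemma finite_labellings: "finite ({1..n} \<rightarrow>\<^sub>E S)" by (intro finite_PiE finS) auto

lemma sum_indicator_labelling:
  fixes f :: "(nat \<Rightarrow> 'l) \<Rightarrow> 'c::real_vector"
  assumes "\<omega> \<in> space M"
  shows "(\<Sum>y\<in>{1..n} \<rightarrow>\<^sub>E S. indicator (labelling y) \<omega> *\<^sub>R f y) = f (Yvec \<omega>)"
proof -
  have "(\<Sum>y\<in>{1..n} \<rightarrow>\<^sub>E S. indicator (labelling y) \<omega> *\<^sub>R f y) = (\<Sum>y\<in>{1..n} \<rightarrow>\<^sub>E S. if y = Yvec \<omega> then f y else 0)"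
    using assms by (intro sum.cong refl) (auto simp: labelling_def indicator_def)
  then show ?thesis using Yvec_in[OF assms] finite_labellings by simp
qed

lemma box_prob:
  assumes n: "n \<ge> 1" and y: "y \<in> {1..n} \<rightarrow>\<^sub>E S" and A: "\<And>i. i \<in> {1..n} \<Longrightarrow> A i \<in> sets F"
  shows "prob (labelling y \<inter> (Xvec -` (Pi\<^sub>E {1..n} A) \<inter> space M)) = (\<Prod>i\<in>{1..n}. measure F (A i) * label_prob (y i))"
proof -
  let ?Z = "\<lambda>i \<omega>. (Xs i \<omega>, Ys i \<omega>)"
  have "labelling y \<inter> (Xvec -` (Pi\<^sub>E {1..n} A) \<inter> space M) = (\<Inter>i\<in>{1..n}. ?Z i -` (A i \<times> {y i}) \<inter> space M)"
    using n unfolding labelling_eq[OF y] by (auto simp: Xvec_def PiE_iff)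
  also have "prob \<dots> = (\<Prod>i\<in>{1..n}. prob (?Z i -` (A i \<times> {y i}) \<inter> space M))"
  proof (rule indep_varsD_finite)
    show "indep_vars (\<lambda>_. euclid p \<Otimes>\<^sub>M count_space S) ?Z {1..n}" using sample by (simp add: iid_sample_def)
    show "A i \<times> {y i} \<in> sets (euclid p \<Otimes>\<^sub>M count_space S)" if "i \<in> {1..n}" for i
    proof -
      have "y i \<in> S" using y that by auto
      then show ?thesis using A[OF that] sets_F by (intro pair_measureI) auto
    qed
  qed (use n in auto)
  also have "\<dots> = (\<Prod>i\<in>{1..n}. measure F (A i) * label_prob (y i))"
    unfolding label_prob_def by (intro prod.cong refl pair_prob A) (use y in auto)
  finally show ?thesis .
qed

lemma labelling_prob:
  assumes n: "n \<ge> 1" and y: "y \<in> {1..n} \<rightarrow>\<^sub>E S"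
  shows "prob (labelling y) = (\<Prod>i\<in>{1..n}. label_prob (y i))"
proof -
  interpret F: prob_space F by (rule prob_F)
  have "labelling y \<inter> (Xvec -` (Pi\<^sub>E {1..n} (\<lambda>_. space F)) \<inter> space M) = labelling y"
    using measurable_space[OF Xvec_measurable] by (auto simp: labelling_def space_PiM)
  then show ?thesis using box_prob[OF n y, of "\<lambda>_. space F"] by (simp add: F.prob_space)
qed

text \<open>
  Given the whole labelling the observations are still i.i.d. with law \<open>F\<close>: on boxes the joint probability is
  a product over \<open>i\<close>, from which the label factors cancel.
\<close>

lemma conditional_law:
  assumes n: "n \<ge> 1" and y: "y \<in> {1..n} \<rightarrow>\<^sub>E S" and pos: "prob (labelling y) > 0"
  shows "distr (uniform_measure M (labelling y)) (iid F n) Xvec = iid F n"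
proof -
  interpret F: prob_space F by (rule prob_F)
  interpret P: product_prob_space "\<lambda>_::nat. F" "{1..n}" by (simp add: product_prob_spaceI prob_F)
  have mX: "Xvec \<in> uniform_measure M (labelling y) \<rightarrow>\<^sub>M iid F n"
    using Xvec_measurable by (simp cong: measurable_cong_sets)
  show ?thesis
  proof (rule P.PiM_eqI)
    fix A assume A: "\<And>i. i \<in> {1..n} \<Longrightarrow> A i \<in> sets F"
    have box: "Pi\<^sub>E {1..n} A \<in> sets (iid F n)" using A by (intro sets_PiM_I_finite) auto
    have pre: "Xvec -` (Pi\<^sub>E {1..n} A) \<inter> space M \<in> sets M" by (rule measurable_sets[OF Xvec_measurable box])
    have "emeasure (distr (uniform_measure M (labelling y)) (iid F n) Xvec) (Pi\<^sub>E {1..n} A)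
       = emeasure (uniform_measure M (labelling y)) (Xvec -` (Pi\<^sub>E {1..n} A) \<inter> space M)"
      using emeasure_distr[OF mX box] by simp
    also have "\<dots> = emeasure M (labelling y \<inter> (Xvec -` (Pi\<^sub>E {1..n} A) \<inter> space M)) / emeasure M (labelling y)"
      by (rule emeasure_uniform_measure[OF labelling_sets[OF y] pre])
    also have "\<dots> = ennreal (prob (labelling y \<inter> (Xvec -` (Pi\<^sub>E {1..n} A) \<inter> space M)) / prob (labelling y))"
      using pos by (simp add: emeasure_eq_measure divide_ennreal)
    also have "prob (labelling y \<inter> (Xvec -` (Pi\<^sub>E {1..n} A) \<inter> space M)) / prob (labelling y) = (\<Prod>i\<in>{1..n}. measure F (A i))"
    proof -
      have "prob (labelling y \<inter> (Xvec -` (Pi\<^sub>E {1..n} A) \<inter> space M)) = (\<Prod>i\<in>{1..n}. measure F (A i)) * prob (labelling y)"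
        unfolding labelling_prob[OF n y] prod.distrib[symmetric] by (rule box_prob[OF n y A])
      then show ?thesis using pos by simp
    qed
    also have "ennreal \<dots> = (\<Prod>i\<in>{1..n}. emeasure F (A i))"
      by (simp add: F.emeasure_eq_measure prod_ennreal)
    finally show "emeasure (distr (uniform_measure M (labelling y)) (iid F n) Xvec) (Pi\<^sub>E {1..n} A) = (\<Prod>i\<in>{1..n}. emeasure F (A i))" .
  qed auto
qed

lemma integral_on_labelling:
  fixes f :: "(nat \<Rightarrow> nat \<Rightarrow> real) \<Rightarrow> complex"
  assumes n: "n \<ge> 1" and y: "y \<in> {1..n} \<rightarrow>\<^sub>E S" and f: "f \<in> borel_measurable (iid F n)"
  shows "(CLINT \<omega>|M. indicator (labelling y) \<omega> *\<^sub>R f (Xvec \<omega>)) = prob (labelling y) *\<^sub>R (CLINT x|iid F n. f x)"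
proof (cases "prob (labelling y) > 0")
  case True
  let ?P = "prob (labelling y)"
  have B: "labelling y \<in> sets M" by (rule labelling_sets[OF y])
  have mX: "Xvec \<in> uniform_measure M (labelling y) \<rightarrow>\<^sub>M iid F n"
    using Xvec_measurable by (simp cong: measurable_cong_sets)
  have mfX: "(\<lambda>\<omega>. f (Xvec \<omega>)) \<in> borel_measurable M" by (rule measurable_compose[OF Xvec_measurable f])
  have u: "uniform_measure M (labelling y) = density M (\<lambda>\<omega>. ennreal (indicator (labelling y) \<omega> / ?P))"
    unfolding uniform_measure_def using divide_ennreal[of 1 ?P] True
    by (intro arg_cong2[where f=density] refl ext) (auto simp: emeasure_eq_measure indicator_def)
  have "(CLINT x|iid F n. f x) = (CLINT \<omega>|uniform_measure M (labelling y). f (Xvec \<omega>))"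
    by (subst conditional_law[OF n y True, symmetric]) (rule integral_distr[OF mX f])
  also have "\<dots> = (CLINT \<omega>|M. (indicator (labelling y) \<omega> / ?P) *\<^sub>R f (Xvec \<omega>))"
    unfolding u by (rule integral_density) (use mfX B in auto)
  also have "\<dots> = (CLINT \<omega>|M. (1 / ?P) *\<^sub>R (indicator (labelling y) \<omega> *\<^sub>R f (Xvec \<omega>)))" by simp
  also have "\<dots> = (1 / ?P) *\<^sub>R (CLINT \<omega>|M. indicator (labelling y) \<omega> *\<^sub>R f (Xvec \<omega>))"
    by (rule integral_scaleR_right)
  finally show ?thesis using True by simp
next
  case False
  then have 0: "prob (labelling y) = 0" using measure_nonneg[of M "labelling y"] by linarith
  have "AE \<omega> in M. \<omega> \<notin> labelling y"
    using labelling_sets[OF y] 0 by (intro AE_not_in) (auto simp: null_sets_def emeasure_eq_measure)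
  then have "(CLINT \<omega>|M. indicator (labelling y) \<omega> *\<^sub>R f (Xvec \<omega>)) = (CLINT \<omega>|M. 0)"
    using labelling_sets[OF y] measurable_compose[OF Xvec_measurable f]
    by (intro integral_cong_AE) (auto elim!: eventually_mono)
  then show ?thesis by (simp add: 0)
qed

text \<open>
  The expectation is the mixture of the conditional expectations over the finitely many labellings. Good
  labellings contribute at most \<open>\<epsilon>\<close>, and the trivial bound \<open>2\<close> is used on the others.
\<close>

theorem mixture_bound:
  fixes f :: "(nat \<Rightarrow> nat \<Rightarrow> real) \<Rightarrow> (nat \<Rightarrow> 'l) \<Rightarrow> complex"
  assumes n: "n \<ge> 1" and f: "\<And>y. (\<lambda>x. f x y) \<in> borel_measurable (iid F n)"
    and f1: "\<And>x y. cmod (f x y) \<le> 1" and z: "cmod z \<le> 1" and \<epsilon>: "\<epsilon> \<ge> 0"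
    and good: "\<And>y. y \<in> {1..n} \<rightarrow>\<^sub>E S \<Longrightarrow> good y \<Longrightarrow> cmod ((CLINT x|iid F n. f x y) - z) \<le> \<epsilon>"
  shows "cmod ((CLINT \<omega>|M. f (Xvec \<omega>) (Yvec \<omega>)) - z) \<le> \<epsilon> + 2 * prob {\<omega> \<in> space M. \<not> good (Yvec \<omega>)}"
proof -
  interpret I: prob_space "iid F n" by (rule prob_space_iid[OF prob_F])
  let ?L = "{1..n} \<rightarrow>\<^sub>E S" and ?P = "\<lambda>y. prob (labelling y)" and ?E = "\<lambda>y. CLINT x|iid F n. f x y"
  have int: "integrable M (\<lambda>\<omega>. indicator (labelling y) \<omega> *\<^sub>R f (Xvec \<omega>) y)" if "y \<in> ?L" for y
  proof (rule integrable_const_bound[of _ 1])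
    show "AE \<omega> in M. cmod (indicator (labelling y) \<omega> *\<^sub>R f (Xvec \<omega>) y) \<le> 1"
      using f1 by (intro AE_I2) (auto simp: indicator_def)
  qed (use labelling_sets[OF that] measurable_compose[OF Xvec_measurable f] in auto)
  have "(CLINT \<omega>|M. f (Xvec \<omega>) (Yvec \<omega>)) = (CLINT \<omega>|M. \<Sum>y\<in>?L. indicator (labelling y) \<omega> *\<^sub>R f (Xvec \<omega>) y)"
    by (intro lebesgue_integral_cong refl) (simp add: sum_indicator_labelling)
  also have "\<dots> = (\<Sum>y\<in>?L. CLINT \<omega>|M. indicator (labelling y) \<omega> *\<^sub>R f (Xvec \<omega>) y)"
    by (rule Bochner_Integration.integral_sum) (rule int)
  also have "\<dots> = (\<Sum>y\<in>?L. ?P y *\<^sub>R ?E y)"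
    by (intro sum.cong refl integral_on_labelling[OF n _ f])
  finally have mix: "(CLINT \<omega>|M. f (Xvec \<omega>) (Yvec \<omega>)) = (\<Sum>y\<in>?L. ?P y *\<^sub>R ?E y)" .
  have disj: "disjoint_family_on labelling Z" for Z by (auto simp: disjoint_family_on_def labelling_def)
  have Psum: "(\<Sum>y\<in>Z. ?P y) = prob {\<omega> \<in> space M. Yvec \<omega> \<in> Z}" if Z: "Z \<subseteq> ?L" for Z
  proof -
    have "prob (\<Union>y\<in>Z. labelling y) = (\<Sum>y\<in>Z. ?P y)"
      by (rule finite_measure_finite_Union)
         (use finite_subset[OF Z finite_labellings] labelling_sets Z disj in auto)
    moreover have "(\<Union>y\<in>Z. labelling y) = {\<omega> \<in> space M. Yvec \<omega> \<in> Z}" by (auto simp: labelling_def)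
    ultimately show ?thesis by simp
  qed
  have total: "(\<Sum>y\<in>?L. ?P y) = 1"
  proof -
    have "{\<omega> \<in> space M. Yvec \<omega> \<in> ?L} = space M" using Yvec_in by auto
    then show ?thesis using Psum[of ?L] prob_space by simp
  qed
  have bad: "(\<Sum>y\<in>{y \<in> ?L. \<not> good y}. ?P y) = prob {\<omega> \<in> space M. \<not> good (Yvec \<omega>)}"
  proof -
    have "{\<omega> \<in> space M. Yvec \<omega> \<in> {y \<in> ?L. \<not> good y}} = {\<omega> \<in> space M. \<not> good (Yvec \<omega>)}" using Yvec_in by auto
    then show ?thesis using Psum[of "{y \<in> ?L. \<not> good y}"] by simp
  qed
  have each: "cmod (?E y - z) \<le> \<epsilon> + (if good y then 0 else 2)" if y: "y \<in> ?L" for y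
  proof (cases "good y")
    case False
    have "cmod (?E y) \<le> (\<integral>x. cmod (f x y) \<partial>iid F n)" by (rule integral_norm_bound)
    also have "\<dots> \<le> (\<integral>x. 1 \<partial>iid F n)"
      by (rule integral_mono) (use f f1 in \<open>auto intro!: I.integrable_const_bound[of _ 1]\<close>)
    finally have "cmod (?E y) \<le> 1" by (simp add: I.prob_space)
    then show ?thesis using norm_triangle_ineq4[of "?E y" z] z \<epsilon> False by simp
  qed (use good[OF y] in auto)
  have diff: "(\<Sum>y\<in>?L. ?P y *\<^sub>R ?E y) - z = (\<Sum>y\<in>?L. ?P y *\<^sub>R (?E y - z))"
    by (simp add: scaleR_diff_right sum_subtractf total flip: scaleR_left.sum)
  have "cmod ((CLINT \<omega>|M. f (Xvec \<omega>) (Yvec \<omega>)) - z) \<le> (\<Sum>y\<in>?L. cmod (?P y *\<^sub>R (?E y - z)))"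
    unfolding mix diff by (rule norm_sum)
  also have "\<dots> \<le> (\<Sum>y\<in>?L. ?P y * (\<epsilon> + (if good y then 0 else 2)))"
    unfolding norm_scaleR abs_of_nonneg[OF measure_nonneg]
    by (intro sum_mono mult_left_mono each measure_nonneg)
  also have "\<dots> = \<epsilon> * (\<Sum>y\<in>?L. ?P y) + 2 * (\<Sum>y\<in>?L. if \<not> good y then ?P y else 0)"
    unfolding sum_distrib_left sum.distrib[symmetric] by (intro sum.cong refl) (auto simp: algebra_simps)
  also have "(\<Sum>y\<in>?L. if \<not> good y then ?P y else 0) = (\<Sum>y\<in>{y \<in> ?L. \<not> good y}. ?P y)"
    using finite_labellings by (simp add: sum.inter_filter)
  finally show ?thesis by (simp add: total bad)
qed

lemma Ys_indep_distr:
  assumes n: "n \<ge> 1"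
  shows "distr M (Pi\<^sub>M {1..n} (\<lambda>_. count_space S)) Yvec = iid (distr M (count_space S) Y) n"
proof -
  have "indep_vars (\<lambda>_. count_space S) (\<lambda>i \<omega>. snd (Xs i \<omega>, Ys i \<omega>)) {1..n}"
    by (rule indep_vars_compose2[where M'="\<lambda>_. euclid p \<Otimes>\<^sub>M count_space S"])
       (use sample in \<open>auto simp: iid_sample_def\<close>)
  then have ind: "indep_vars (\<lambda>_. count_space S) Ys {1..n}" by simp
  have d: "distr M (count_space S) (Ys i) = distr M (count_space S) Y" if i: "i \<in> {1..n}" for i
  proof (rule measure_eqI)
    fix B assume "B \<in> sets (distr M (count_space S) (Ys i))"
    then have B: "B \<subseteq> S" by simp
    interpret F: prob_space F by (rule prob_F)
    have "(\<lambda>\<omega>. (Xs i \<omega>, Ys i \<omega>)) -` (space F \<times> B) \<inter> space M = Ys i -` B \<inter> space M"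
      using measurable_space[OF Xs_measurable[OF i]] sets_eq_imp_space_eq[OF sets_F] by auto
    then have "prob (Ys i -` B \<inter> space M) = prob (Y -` B \<inter> space M)"
      using pair_prob[OF i sets.top B] by (simp add: F.prob_space)
    then show "emeasure (distr M (count_space S) (Ys i)) B = emeasure (distr M (count_space S) Y) B"
      using B by (simp add: emeasure_distr[OF Ys_measurable[OF i]] emeasure_distr[OF Y] emeasure_eq_measure)
  qed simp
  have "distr M (Pi\<^sub>M {1..n} (\<lambda>_. count_space S)) (\<lambda>x. \<lambda>i\<in>{1..n}. Ys i x) = Pi\<^sub>M {1..n} (\<lambda>i. distr M (count_space S) (Ys i))"
    using indep_vars_iff_distr_eq_PiM'[where I="{1..n}" and M'="\<lambda>_. count_space S" and X=Ys] ind n Ys_measurable by auto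
  also have "\<dots> = iid (distr M (count_space S) Y) n" by (intro PiM_cong d refl)
  finally show ?thesis by (simp add: Yvec_def[abs_def])
qed

lemma Yvec_measurable: "Yvec \<in> M \<rightarrow>\<^sub>M Pi\<^sub>M {1..n} (\<lambda>_. count_space S)"
  unfolding Yvec_def by (rule measurable_restrict) (rule Ys_measurable)

lemma class_size_eq: "real (class_size n y l) = (\<Sum>i=1..n. of_bool (y i = l))"
proof -
  have "class_idx n y l = {1..n} \<inter> {i. y i = l}" by (auto simp: class_idx_def)
  then show ?thesis by (simp add: class_size_def)
qed

text \<open>
  Chebyshev's inequality for the class size, a sum of independent indicators.
\<close>

lemma small_class_prob:
  assumes n: "n \<ge> 1" and l: "l \<in> S" and q: "label_prob l > 0"
  shows "prob {\<omega> \<in> space M. real (class_size n (Yvec \<omega>) l) < label_prob l / 2 * n} \<le> 4 / ((label_prob l)^2 * n)"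
proof -
  let ?q = "label_prob l" and ?\<mu> = "distr M (count_space S) Y"
  interpret Q: prob_space ?\<mu> by (rule prob_space_distr[OF Y])
  let ?f = "\<lambda>l'. of_bool (l' = l) - ?q"
  let ?D = "\<lambda>y. \<Sum>i=1..n. 1 * ?f (y i)"
  have q1: "?q \<le> 1" by (simp add: label_prob_def)
  have b: "\<bar>?f l'\<bar> \<le> 1" for l' using q q1 by (auto simp: of_bool_def)
  have f: "has_moment ?\<mu> 2 ?f"
    by (rule has_moment_bound[of _ "\<lambda>_. 1"]) (use b in \<open>auto simp: abs_square_le_1\<close>)
  have "(\<integral>l'. of_bool (l' = l) \<partial>?\<mu>) = (\<integral>l'. indicator {l} l' \<partial>?\<mu>)"
    by (intro lebesgue_integral_cong) (auto simp: indicator_def)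
  also have "\<dots> = measure ?\<mu> {l}" using l by simp
  also have "\<dots> = ?q" unfolding label_prob_def using l by (subst measure_distr[OF Y]) auto
  finally have mean1: "(\<integral>l'. of_bool (l' = l) \<partial>?\<mu>) = ?q" .
  have "integrable ?\<mu> (\<lambda>l'. of_bool (l' = l) :: real)"
    by (rule Q.integrable_const_bound[of _ 1]) (auto intro!: AE_I2)
  then have f0: "(\<integral>l'. ?f l' \<partial>?\<mu>) = 0" using mean1 Q.prob_space by simp
  have f2: "(\<integral>l'. (?f l')^2 \<partial>?\<mu>) \<le> 1"
  proof -
    have "(\<integral>l'. (?f l')^2 \<partial>?\<mu>) \<le> (\<integral>l'. 1 \<partial>?\<mu>)"
      by (rule integral_mono) (use f b in \<open>auto simp: has_moment_def abs_square_le_1\<close>)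
    then show ?thesis using Q.prob_space by simp
  qed
  have mD: "has_moment (iid ?\<mu> n) 2 ?D"
  proof -
    interpret I: prob_space "iid ?\<mu> n" by (rule prob_space_iid) unfold_locales
    show ?thesis by (intro I.has_moment_sum has_moment_cmult Q.has_moment_component[OF f])
  qed
  have law: "distr M (Pi\<^sub>M {1..n} (\<lambda>_. count_space S)) Yvec = iid ?\<mu> n" by (rule Ys_indep_distr[OF n])
  have D: "has_moment M 2 (\<lambda>\<omega>. ?D (Yvec \<omega>))"
    by (rule has_moment_distr[OF Yvec_measurable law mD])
  have mD': "(\<lambda>y. (?D y)^2) \<in> borel_measurable (Pi\<^sub>M {1..n} (\<lambda>_. count_space S))"
  proof -
    have "?D \<in> borel_measurable (iid ?\<mu> n)" using mD by (simp add: has_moment_def)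
    moreover have "sets (iid ?\<mu> n) = sets (Pi\<^sub>M {1..n} (\<lambda>_. count_space S))" by (rule sets_PiM_cong) auto
    ultimately show ?thesis by (intro borel_measurable_power) (simp cong: measurable_cong_sets)
  qed
  have "(\<integral>\<omega>. (?D (Yvec \<omega>))^2 \<partial>M) = (\<integral>y. (?D y)^2 \<partial>iid ?\<mu> n)"
    using integral_distr[OF Yvec_measurable mD'] unfolding law by simp
  also have "\<dots> = (\<integral>l'. (?f l')^2 \<partial>?\<mu>) * (\<Sum>i=1..n. 1^2)" by (rule Q.iid_sum_second_moment[OF f f0])
  also have "\<dots> \<le> 1 * real n" using f2 by (intro mult_mono) auto
  finally have ED: "(\<integral>\<omega>. (?D (Yvec \<omega>))^2 \<partial>M) \<le> n" by simp
  have sum: "?D y = real (class_size n y l) - ?q * n" for y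
    unfolding class_size_eq by (simp add: sum_subtractf)
  have a: "?q / 2 * n > 0" using q n by simp
  have "prob {\<omega> \<in> space M. real (class_size n (Yvec \<omega>) l) < ?q / 2 * n} \<le> prob {\<omega> \<in> space M. ?q / 2 * n \<le> \<bar>?D (Yvec \<omega>)\<bar>}"
  proof (rule finite_measure_mono)
    show "{\<omega> \<in> space M. real (class_size n (Yvec \<omega>) l) < ?q / 2 * n} \<subseteq> {\<omega> \<in> space M. ?q / 2 * n \<le> \<bar>?D (Yvec \<omega>)\<bar>}"
      unfolding sum
    proof (intro Collect_mono conj_mono impI)
      fix \<omega> assume "real (class_size n (Yvec \<omega>) l) < ?q / 2 * n"
      then show "?q / 2 * n \<le> \<bar>real (class_size n (Yvec \<omega>) l) - ?q * n\<bar>" by linarith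
    qed
    have [measurable]: "(\<lambda>\<omega>. ?D (Yvec \<omega>)) \<in> borel_measurable M" using D by (simp only: has_moment_def)
    show "{\<omega> \<in> space M. ?q / 2 * n \<le> \<bar>?D (Yvec \<omega>)\<bar>} \<in> sets M" by measurable
  qed
  also have "\<dots> \<le> (\<integral>\<omega>. (?D (Yvec \<omega>))^2 \<partial>M) / (?q / 2 * n)^2"
    by (rule second_moment_method) (use D a in \<open>auto simp: has_moment_def\<close>)
  also have "\<dots> \<le> n / (?q / 2 * n)^2" using ED by (intro divide_right_mono) auto
  also have "\<dots> = 4 / (?q^2 * n)" using n q by (simp add: power2_eq_square field_simps)
  finally show ?thesis .
qed

end

section \<open>The limit theorem\<close>

lemma clt_error_nonneg: "0 \<le> C \<Longrightarrow> 0 \<le> \<rho> \<Longrightarrow> 0 \<le> \<gamma> \<Longrightarrow> 0 \<le> n \<Longrightarrow> 0 \<le> clt_error t C \<rho> \<gamma> n"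
  unfolding clt_error_def by (intro add_nonneg_nonneg mult_nonneg_nonneg divide_nonneg_nonneg) auto

lemma clt_error_tendsto_0:
  fixes \<rho> \<gamma> n :: "nat \<Rightarrow> real"
  assumes "\<rho> \<longlonglongrightarrow> 0" "\<gamma> \<longlonglongrightarrow> 0" "filterlim n at_top sequentially"
  shows "(\<lambda>\<nu>. clt_error t C (\<rho> \<nu>) (\<gamma> \<nu>) (n \<nu>)) \<longlonglongrightarrow> 0"
proof -
  have inv: "(\<lambda>\<nu>. 1 / n \<nu>) \<longlonglongrightarrow> 0"
    by (rule tendsto_divide_0[OF tendsto_const filterlim_at_top_imp_at_infinity[OF assms(3)]])
  have s: "(\<lambda>\<nu>. sqrt (\<rho> \<nu>)) \<longlonglongrightarrow> 0" "(\<lambda>\<nu>. sqrt (\<gamma> \<nu>)) \<longlonglongrightarrow> 0"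
    using tendsto_real_sqrt[OF assms(1)] tendsto_real_sqrt[OF assms(2)] by simp_all
  have k: "(\<lambda>\<nu>. sqrt (20 * sqrt (\<rho> \<nu>) + 28 * (1 / n \<nu>))) \<longlonglongrightarrow> 0"
    using tendsto_real_sqrt[OF tendsto_add[OF tendsto_mult[OF tendsto_const[of 20] s(1)] tendsto_mult[OF tendsto_const[of 28] inv]]] by simp
  have "(\<lambda>\<nu>. t^2 / 2 * (C^2 * (sqrt (\<rho> \<nu>) + 2 * sqrt (\<gamma> \<nu>))) + \<bar>t\<bar>^3 / 6 * (sqrt 3 * C^3 * sqrt (\<rho> \<nu>))
     + t^4 * C^4 / 4 * (1 / n \<nu>) + (2 + 2 * \<bar>t\<bar>) * sqrt (20 * sqrt (\<rho> \<nu>) + 28 * (1 / n \<nu>)))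
     \<longlonglongrightarrow> t^2 / 2 * (C^2 * (0 + 2 * 0)) + \<bar>t\<bar>^3 / 6 * (sqrt 3 * C^3 * 0) + t^4 * C^4 / 4 * 0 + (2 + 2 * \<bar>t\<bar>) * 0"
    by (intro tendsto_intros s k inv)
  then show ?thesis by (simp add: clt_error_def)
qed

context labelled_sample
begin

lemma gini_stat_vec:
  "gini_stat K p L n (\<lambda>i. Xs i \<omega>) (\<lambda>i. Ys i \<omega>) = gini_stat K p L n (Xvec \<omega>) (Yvec \<omega>)"
  by (rule gini_stat_cong) (auto simp: Xvec_def Yvec_def)

lemma euclid_law_F:
  assumes "integrable M (\<lambda>\<omega>. enorm p (X \<omega>) ^ 4)"
  shows "euclid_law F p"
proof -
  interpret F: prob_space F by (rule prob_F)
  show ?thesis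
  proof
    show "sets F = sets (euclid p)" by (rule sets_F)
    show "integrable F (\<lambda>x. enorm p x ^ 4)"
      unfolding F by (subst integrable_distr_eq[OF X]) (use assms in auto)
  qed
qed

text \<open>
  The class index sets are random. Splitting along the finitely many labellings reduces the claim to fixed
  index sets.
\<close>

lemma gini_stat_sample_measurable:
  assumes "integrable M (\<lambda>\<omega>. enorm p (X \<omega>) ^ 4)"
  shows "(\<lambda>\<omega>. gini_stat K p L n (\<lambda>i. Xs i \<omega>) (\<lambda>i. Ys i \<omega>)) \<in> borel_measurable M"
proof -
  interpret F: euclid_law F p by (rule euclid_law_F[OF assms])
  have "(\<lambda>\<omega>. \<Sum>y\<in>{1..n} \<rightarrow>\<^sub>E S. indicator (labelling y) \<omega> *\<^sub>R gini_stat K p L n (Xvec \<omega>) y) \<in> borel_measurable M"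
    by (intro borel_measurable_sum borel_measurable_scaleR borel_measurable_indicator labelling_sets
        measurable_compose[OF Xvec_measurable F.gini_stat_measurable])
  then show ?thesis
    by (rule measurable_cong[THEN iffD1, rotated]) (simp only: sum_indicator_labelling gini_stat_vec)
qed

lemma class_size_measurable: "(\<lambda>\<omega>. real (class_size n (Yvec \<omega>) l)) \<in> borel_measurable M"
  unfolding class_size_eq
proof (rule borel_measurable_sum)
  fix i assume i: "i \<in> {1..n}"
  have "(\<lambda>\<omega>. of_bool (Ys i \<omega> = l) :: real) \<in> borel_measurable M"
    using measurable_compose[OF Ys_measurable[OF i] borel_measurable_count_space] .
  then show "(\<lambda>\<omega>. of_bool (Yvec \<omega> i = l) :: real) \<in> borel_measurable M" using i by (simp add: Yvec_def)
qed

text \<open>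
  Labellings are called good when every class has at least \<open>c0 n\<close> members. As \<open>c0\<close> is at most half of each label
  probability, the others have small probability.
\<close>

theorem gini_cf_bound:
  fixes t c0 :: real
  assumes K: "K \<ge> 2" and L: "inj_on L {1..K}" and S: "S = L ` {1..K}"
    and moment: "integrable M (\<lambda>\<omega>. enorm p (X \<omega>) ^ 4)" and pos: "d_moment p F 2 > 0"
    and c0: "c0 > 0" "\<And>k. k \<in> {1..K} \<Longrightarrow> c0 \<le> label_prob (L k) / 2" and n: "n \<ge> 6" "c0 * n \<ge> 2"
    and small: "20 * sqrt (d_moment p F 4 / (n * (d_moment p F 2)^2)) + 28 / n \<le> 1 / 4"
  shows "cmod ((CLINT \<omega>|M. iexp (t * gini_stat K p L n (\<lambda>i. Xs i \<omega>) (\<lambda>i. Ys i \<omega>))) - of_real (exp (- (t^2 / 2))))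
    \<le> clt_error t (4 + 4 / c0) (d_moment p F 4 / (n * (d_moment p F 2)^2)) (d_cycle p F / (d_moment p F 2)^2) n
      + 2 * (\<Sum>k=1..K. 4 / ((label_prob (L k))^2 * n))"
proof -
  interpret F: euclid_law F p by (rule euclid_law_F[OF moment])
  let ?\<epsilon> = "clt_error t (4 + 4 / c0) (d_moment p F 4 / (n * (d_moment p F 2)^2)) (d_cycle p F / (d_moment p F 2)^2) n"
  let ?good = "\<lambda>y. \<forall>k\<in>{1..K}. c0 * n \<le> real (class_size n y (L k))"
  have "cmod ((CLINT \<omega>|M. iexp (t * gini_stat K p L n (Xvec \<omega>) (Yvec \<omega>))) - of_real (exp (- (t^2 / 2))))
     \<le> ?\<epsilon> + 2 * prob {\<omega> \<in> space M. \<not> ?good (Yvec \<omega>)}"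
  proof (rule mixture_bound)
    show "(\<lambda>x. iexp (t * gini_stat K p L n x y)) \<in> borel_measurable (iid F n)" for y
      using F.gini_stat_measurable[of K L n y] by measurable
    show "0 \<le> ?\<epsilon>"
      using c0 F.d.fourth_nonneg F.d.cycle_nonneg
      by (intro clt_error_nonneg) (auto simp: F.d_moment_4 F.d_cycle_eq)
    show "cmod ((CLINT x|iid F n. iexp (t * gini_stat K p L n x y)) - of_real (exp (- (t^2 / 2)))) \<le> ?\<epsilon>"
      if y: "y \<in> {1..n} \<rightarrow>\<^sub>E S" and good: "?good y" for y
    proof (rule F.labelled_cf_bound[OF K L _ n(1) _ c0(1) _ pos small])
      show "y i \<in> L ` {1..K}" if "i \<in> {1..n}" for i using y that S by auto
      show "2 \<le> class_size n y (L k)" if "k \<in> {1..K}" for k using good that n(2) by force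
      show "c0 * n \<le> real (class_size n y (L k))" if "k \<in> {1..K}" for k using good that by auto
    qed
  qed (use n in auto)
  also have "prob {\<omega> \<in> space M. \<not> ?good (Yvec \<omega>)} \<le> (\<Sum>k=1..K. 4 / ((label_prob (L k))^2 * n))"
  proof -
    let ?B = "\<lambda>k. {\<omega> \<in> space M. real (class_size n (Yvec \<omega>) (L k)) < label_prob (L k) / 2 * n}"
    have B: "?B k \<in> sets M" for k using class_size_measurable[of "L k"] by measurable
    have "prob {\<omega> \<in> space M. \<not> ?good (Yvec \<omega>)} \<le> prob (\<Union>k\<in>{1..K}. ?B k)"
    proof (rule finite_measure_mono)
      show "{\<omega> \<in> space M. \<not> ?good (Yvec \<omega>)} \<subseteq> (\<Union>k\<in>{1..K}. ?B k)"
      proof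
        fix \<omega> assume "\<omega> \<in> {\<omega> \<in> space M. \<not> ?good (Yvec \<omega>)}"
        then obtain k where k: "\<omega> \<in> space M" "k \<in> {1..K}" "real (class_size n (Yvec \<omega>) (L k)) < c0 * n" by force
        have "c0 * n \<le> label_prob (L k) / 2 * n" using c0(2)[OF k(2)] by (intro mult_right_mono) auto
        then have "\<omega> \<in> ?B k" using k by simp
        then show "\<omega> \<in> (\<Union>k\<in>{1..K}. ?B k)" using k(2) by blast
      qed
    qed (use B in auto)
    also have "\<dots> \<le> (\<Sum>k=1..K. prob (?B k))"
      by (rule finite_measure_subadditive_finite) (use B in auto)
    also have "\<dots> \<le> (\<Sum>k=1..K. 4 / ((label_prob (L k))^2 * n))"
    proof (rule sum_mono)
      fix k assume k: "k \<in> {1..K}"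
      show "prob (?B k) \<le> 4 / ((label_prob (L k))^2 * n)"
        by (rule small_class_prob) (use n S k c0(1) c0(2)[OF k] in auto)
    qed
    finally show ?thesis .
  qed
  finally show ?thesis unfolding gini_stat_vec by simp
qed

end

theorem corollary2p1:
  fixes M :: "nat \<Rightarrow> 'a measure"
    and N p :: "nat \<Rightarrow> nat"
    and K :: nat and L :: "nat \<Rightarrow> 'l" and q :: "nat \<Rightarrow> real"
    and X :: "nat \<Rightarrow> 'a \<Rightarrow> nat \<Rightarrow> real" and Y :: "nat \<Rightarrow> 'a \<Rightarrow> 'l"
    and Xs :: "nat \<Rightarrow> nat \<Rightarrow> 'a \<Rightarrow> nat \<Rightarrow> real" and Ys :: "nat \<Rightarrow> nat \<Rightarrow> 'a \<Rightarrow> 'l"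
    and F :: "nat \<Rightarrow> (nat \<Rightarrow> real) measure"
  assumes K: "K \<ge> 2" and labels: "inj_on L {1..K}"
    and prob: "\<And>\<nu>. prob_space (M \<nu>)"
    and X: "\<And>\<nu>. X \<nu> \<in> M \<nu> \<rightarrow>\<^sub>M euclid (p \<nu>)"
    and Y: "\<And>\<nu>. Y \<nu> \<in> M \<nu> \<rightarrow>\<^sub>M count_space (L ` {1..K})"
    and F: "\<And>\<nu>. F \<nu> = distr (M \<nu>) (euclid (p \<nu>)) (X \<nu>)"
    and q: "\<And>\<nu> k. k \<in> {1..K} \<Longrightarrow> \<P>(\<omega> in M \<nu>. Y \<nu> \<omega> = L k) = q k"
    and q_pos: "\<And>k. k \<in> {1..K} \<Longrightarrow> q k > 0"
    and sample: "\<And>\<nu>. iid_sample (M \<nu>) (p \<nu>) (L ` {1..K}) (N \<nu>) (X \<nu>) (Y \<nu>) (Xs \<nu>) (Ys \<nu>)"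
    and indep: "\<And>\<nu>. indep_rvs (M \<nu>)
                   (euclid (p \<nu>)) (X \<nu>) (count_space (L ` {1..K})) (Y \<nu>)"
    and moment4: "\<And>\<nu>. integrable (M \<nu>) (\<lambda>\<omega>. enorm (p \<nu>) (X \<nu> \<omega>) ^ 4)"
    and nondegenerate: "\<And>\<nu>. d_moment (p \<nu>) (F \<nu>) 2 > 0"
    and cond2: "(\<lambda>\<nu>. d_moment (p \<nu>) (F \<nu>) 4 / (real (N \<nu>) * (d_moment (p \<nu>) (F \<nu>) 2)\<^sup>2))
                  \<longlonglongrightarrow> 0"
    and cond3: "(\<lambda>\<nu>. d_cycle (p \<nu>) (F \<nu>) / (d_moment (p \<nu>) (F \<nu>) 2)\<^sup>2) \<longlonglongrightarrow> 0"
    and N_at_top: "filterlim N at_top sequentially"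
    and p_at_top: "filterlim p at_top sequentially"
    and min_at_top: "\<And>c. (\<lambda>\<nu>. \<P>(\<omega> in M \<nu>.
            c \<le> Min ((\<lambda>k. class_size (N \<nu>) (\<lambda>i. Ys \<nu> i \<omega>) (L k)) ` {1..K}))) \<longlonglongrightarrow> 1"
  shows "weak_conv_m
     (\<lambda>\<nu>. distr (M \<nu>) borel (\<lambda>\<omega>.
        Delta_hat (p \<nu>) (N \<nu>) (\<lambda>i. Xs \<nu> i \<omega>)
          / sigma0_hat K (p \<nu>) L (N \<nu>) (\<lambda>i. Xs \<nu> i \<omega>) (\<lambda>i. Ys \<nu> i \<omega>)
          * gCor K (p \<nu>) L (N \<nu>) (\<lambda>i. Xs \<nu> i \<omega>) (\<lambda>i. Ys \<nu> i \<omega>)))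
     std_normal_distribution"
  unfolding gini_stat_def[symmetric]
proof (rule levy_continuity)
  let ?S = "L ` {1..K}"
  let ?T = "\<lambda>\<nu> \<omega>. gini_stat K (p \<nu>) L (N \<nu>) (\<lambda>i. Xs \<nu> i \<omega>) (\<lambda>i. Ys \<nu> i \<omega>)"
  have ls: "labelled_sample (M \<nu>) (p \<nu>) (N \<nu>) ?S (X \<nu>) (Y \<nu>) (Xs \<nu>) (Ys \<nu>) (F \<nu>)" for \<nu>
    by (intro labelled_sample.intro labelled_sample_axioms.intro prob X Y F sample indep) auto
  have T: "?T \<nu> \<in> borel_measurable (M \<nu>)" for \<nu>
    by (rule labelled_sample.gini_stat_sample_measurable[OF ls moment4])
  show "real_distribution (distr (M \<nu>) borel (?T \<nu>))" for \<nu>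
    by (rule prob_space.real_distribution_distr[OF prob T])
  show "real_distribution std_normal_distribution" by (rule real_dist_normal_dist)
  fix t :: real
  have lp: "labelled_sample.label_prob (M \<nu>) (Y \<nu>) (L k) = q k" if "k \<in> {1..K}" for \<nu> k
    unfolding labelled_sample.label_prob_def[OF ls] q[OF that, of \<nu>, symmetric]
    by (rule arg_cong[where f="measure (M \<nu>)"]) auto
  \<comment> \<open>a fraction of \<open>n\<close> that every class exceeds with probability tending to one\<close>
  define c0 where "c0 = Min (q ` {1..K}) / 2"
  have ne: "q ` {1..K} \<noteq> {}" using K by auto
  have c0: "c0 > 0" "\<And>k. k \<in> {1..K} \<Longrightarrow> c0 \<le> q k / 2"
    using q_pos ne by (auto simp: c0_def Min_gr_iff)
  let ?\<rho> = "\<lambda>\<nu>. d_moment (p \<nu>) (F \<nu>) 4 / (real (N \<nu>) * (d_moment (p \<nu>) (F \<nu>) 2)\<^sup>2)"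
  let ?\<gamma> = "\<lambda>\<nu>. d_cycle (p \<nu>) (F \<nu>) / (d_moment (p \<nu>) (F \<nu>) 2)\<^sup>2"
  let ?b = "\<lambda>\<nu>. clt_error t (4 + 4 / c0) (?\<rho> \<nu>) (?\<gamma> \<nu>) (N \<nu>) + 2 * (\<Sum>k=1..K. 4 / (q k)^2 * (1 / real (N \<nu>)))"
  have N: "filterlim (\<lambda>\<nu>. real (N \<nu>)) at_top sequentially"
    by (rule filterlim_compose[OF filterlim_real_sequentially N_at_top])
  have inv: "(\<lambda>\<nu>. 1 / real (N \<nu>)) \<longlonglongrightarrow> 0"
    by (rule tendsto_divide_0[OF tendsto_const filterlim_at_top_imp_at_infinity[OF N]])
  have b0: "?b \<longlonglongrightarrow> 0 + 2 * (\<Sum>k=1..K. 4 / (q k)^2 * 0)"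
    by (intro tendsto_add clt_error_tendsto_0 cond2 cond3 N tendsto_mult tendsto_const tendsto_sum inv)
  have small: "(\<lambda>\<nu>. 20 * sqrt (?\<rho> \<nu>) + 28 * (1 / real (N \<nu>))) \<longlonglongrightarrow> 0"
    using tendsto_add[OF tendsto_mult[OF tendsto_const[of 20] tendsto_real_sqrt[OF cond2]] tendsto_mult[OF tendsto_const[of 28] inv]] by simp
  have ev: "\<forall>\<^sub>F \<nu> in sequentially. cmod (char (distr (M \<nu>) borel (?T \<nu>)) t - char std_normal_distribution t) \<le> ?b \<nu>"
  proof -
    have e1: "\<forall>\<^sub>F \<nu> in sequentially. 20 * sqrt (?\<rho> \<nu>) + 28 * (1 / real (N \<nu>)) < 1 / 4"
      using small by (rule order_tendstoD) simp
    have e2: "\<forall>\<^sub>F \<nu> in sequentially. 6 \<le> N \<nu>" using N_at_top by (simp add: filterlim_at_top)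
    have e3: "\<forall>\<^sub>F \<nu> in sequentially. 2 / c0 \<le> real (N \<nu>)" using N by (simp add: filterlim_at_top)
    from e1 e2 e3 show ?thesis
    proof eventually_elim
      case (elim \<nu>)
      have "cmod ((CLINT \<omega>|M \<nu>. iexp (t * ?T \<nu> \<omega>)) - of_real (exp (- (t^2 / 2))))
        \<le> clt_error t (4 + 4 / c0) (?\<rho> \<nu>) (?\<gamma> \<nu>) (N \<nu>)
          + 2 * (\<Sum>k=1..K. 4 / ((labelled_sample.label_prob (M \<nu>) (Y \<nu>) (L k))^2 * N \<nu>))"
        by (rule labelled_sample.gini_cf_bound[OF ls K labels refl moment4 nondegenerate c0(1)])
           (use elim c0 lp in \<open>auto simp: field_simps\<close>)
      also have "(\<Sum>k=1..K. 4 / ((labelled_sample.label_prob (M \<nu>) (Y \<nu>) (L k))^2 * N \<nu>)) = (\<Sum>k=1..K. 4 / (q k)^2 * (1 / real (N \<nu>)))"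
        by (intro sum.cong refl) (simp add: lp)
      also have "(CLINT \<omega>|M \<nu>. iexp (t * ?T \<nu> \<omega>)) = char (distr (M \<nu>) borel (?T \<nu>)) t"
        unfolding char_def by (rule integral_distr[OF T, symmetric]) auto
      finally show ?case by (simp add: char_std_normal_distribution)
    qed
  qed
  have "(\<lambda>\<nu>. char (distr (M \<nu>) borel (?T \<nu>)) t - char std_normal_distribution t) \<longlonglongrightarrow> 0"
    by (rule Lim_null_comparison[OF ev]) (use b0 in simp)
  then show "(\<lambda>\<nu>. char (distr (M \<nu>) borel (?T \<nu>)) t) \<longlonglongrightarrow> char std_normal_distribution t"
    by (rule LIM_zero_cancel)
qed

end
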